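(* Let $n=2m+1\ge5$ be an odd integer and let $\xi\in\mathbb{R}$ with $[\mathbb{Q}(\xi):\mathbb{Q}]>n$. Then $\widehat{\lambda}_{2m+1}(\xi)\le\alpha_m$, where $\alpha_m$ is the positive root of the polynomial $P_m(x)=1-(m+1)x-mx^2$.
   Context: For $\xi\in\mathbb{R}$ and an integer $n\ge1$, $\widehat{\lambda}_n(\xi)$ denotes the supremum of all $\lambda\ge0$ such that, for every sufficiently large real $X$, the conditions $|x_0|\le X$ and $\max_{1\le k\le n}|x_0\xi^k-x_k|\le X^{-\lambda}$ admit a non-zero solution $(x_0,\dots,x_n)\in\mathbb{Z}^{n+1}$. *)

theory Defs
  imports
    "HOL-Analysis.Analysis"
    "HOL-Computational_Algebra.Polynomial"
    "HOL-Algebra.Generated_Fields"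
    "HOL-Algebra.Algebraic_Closure_Type"
begin

text \<open>
  The supremum is taken in the extended reals, since the set of admissible exponents is unbounded
  for rational \<open>\<xi>\<close>. Only the values at \<open>0, \<dots>, n\<close> of the sequence \<open>x\<close> matter; \<open>n \<ge> 1\<close> is
  intended (the maximum is over an empty set for \<open>n = 0\<close>).
\<close>

definition uniform_exponent_ok :: "nat \<Rightarrow> real \<Rightarrow> real \<Rightarrow> bool" where
  "uniform_exponent_ok n \<xi> l \<longleftrightarrow>
     (\<forall>\<^sub>F B in (at_top :: real filter). \<exists>x :: nat \<Rightarrow> int.
        (\<exists>k\<le>n. x k \<noteq> 0) \<and>
        \<bar>real_of_int (x 0)\<bar> \<le> B \<and>
        (MAX k\<in>{1..n}. \<bar>real_of_int (x 0) * \<xi> ^ k - real_of_int (x k)\<bar>) \<le> B powr (- l))"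

definition lambda_hat :: "nat \<Rightarrow> real \<Rightarrow> ereal" where
  "lambda_hat n \<xi> = Sup {ereal l | l. 0 \<le> l \<and> uniform_exponent_ok n \<xi> l}"

abbreviation real_ring :: "real ring" where
  "real_ring \<equiv> ring_of_type_algebra"

definition rat_adjoin :: "real \<Rightarrow> real set" where
  "rat_adjoin \<xi> = generate_field real_ring (insert \<xi> \<rat>)"

text \<open>The degree \<open>[\<rat>(\<xi>) : \<rat>]\<close>, infinite if \<open>\<xi>\<close> is transcendental.\<close>

definition rat_adjoin_degree :: "real \<Rightarrow> enat" where
  "rat_adjoin_degree \<xi> =
     (if ring.finite_dimension real_ring \<rat> (rat_adjoin \<xi>)
      then enat (ring.dim real_ring \<rat> (rat_adjoin \<xi>)) else \<infinity>)"

definition P_poly :: "nat \<Rightarrow> real poly" where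
  "P_poly m = [:1, - (real m + 1), - real m:]"

definition alpha :: "nat \<Rightarrow> real" where
  "alpha m = (THE x. x > 0 \<and> poly (P_poly m) x = 0)"

lemma P_poly_ex1_positive_root: "\<exists>!x. x > 0 \<and> poly (P_poly m) x = 0"
proof (rule ex_ex1I)
  have "\<exists>x\<ge>0. x \<le> 1 \<and> poly (P_poly m) x = 0"
    by (rule IVT2) (auto simp: P_poly_def)
  then obtain x where x: "0 \<le> x" "poly (P_poly m) x = 0" by blast
  moreover have "x \<noteq> 0" using x by (auto simp: P_poly_def)
  ultimately show "\<exists>x. x > 0 \<and> poly (P_poly m) x = 0" by (intro exI[of _ x]) auto
next
  fix x y :: real
  assume x: "x > 0 \<and> poly (P_poly m) x = 0" and y: "y > 0 \<and> poly (P_poly m) y = 0"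
  have "(x - y) * (real m + 1 + real m * (x + y)) = 0"
    using x y by (simp add: P_poly_def algebra_simps)
  moreover have "real m + 1 + real m * (x + y) > 0"
    using x y by (intro add_pos_nonneg[of "real m + 1"] mult_nonneg_nonneg) auto
  ultimately show "x = y" by simp
qed

end

theory Submission
  imports Defs "Jordan_Normal_Form.Determinant"
begin

text \<open>
  Suppose that some exponent \<open>l > alpha m\<close> is admissible, and let \<open>alpha m < \<lambda> < l\<close>. The best simultaneous
  approximations to \<open>\<xi>, \<dots>, \<xi>\<^sup>n\<close> form a sequence of integer points whose distance to the line through
  \<open>(1, \<xi>, \<dots>, \<xi>\<^sup>n)\<close> is at most the power \<open>- \<lambda>\<close> of the height of the next point. A polynomial with \<open>N\<close>
  coefficients annihilates a point if it is orthogonal to all its blocks of \<open>N\<close> consecutive coordinates.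

  The height of a polynomial determined by the points that it annihilates is bounded from above by a
  determinant whose rows are blocks of these points: all rows are nearly multiples of
  \<open>(1, \<xi>, \<xi>\<^sup>2, \<dots>)\<close>, so the determinant is small. It is bounded from below because a polynomial that
  annihilates one point but not the preceding one takes a non-zero integer value there. Comparing both
  bounds shows first that large points have no annihilator of degree at most \<open>m\<close>. On the subsequence \<open>y\<close>
  of points at which the plane through two consecutive best approximations changes, it then shows that
  the annihilators of degree \<open>m + 1\<close> of \<open>y k\<close> and \<open>y (k + 1)\<close> differ, and that three consecutive points
  have exactly one common annihilator of degree at most \<open>m + 2\<close>. No polynomial annihilates all points, so
  the latter changes infinitely often; wherever it changes, the bounds are linear inequalities between
  logarithms of heights that have no solution if \<open>\<lambda> > alpha m\<close>.
\<close>

section \<open>Linear algebra over the integers\<close>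

text \<open>
  A vector of length \<open>N\<close> is a function of which only the values below \<open>N\<close> matter; \<open>rat_span N A\<close> is
  the set of integer vectors in the rational span of \<open>A\<close>, see \<open>rat_span_set_iff\<close>.
\<close>

definition dotp :: "nat \<Rightarrow> (nat \<Rightarrow> int) \<Rightarrow> (nat \<Rightarrow> int) \<Rightarrow> int" where
  "dotp N r p = (\<Sum>j<N. r j * p j)"

definition nonzero_below :: "nat \<Rightarrow> (nat \<Rightarrow> int) \<Rightarrow> bool" where
  "nonzero_below N p \<longleftrightarrow> (\<exists>j<N. p j \<noteq> 0)"

definition orth :: "nat \<Rightarrow> (nat \<Rightarrow> int) set \<Rightarrow> (nat \<Rightarrow> int) set" where
  "orth N A = {p. \<forall>r\<in>A. dotp N r p = 0}"

definition rat_span :: "nat \<Rightarrow> (nat \<Rightarrow> int) set \<Rightarrow> (nat \<Rightarrow> int) set" where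
  "rat_span N A = orth N (orth N A)"

definition lincomb :: "(nat \<Rightarrow> int) list \<Rightarrow> (nat \<Rightarrow> int) \<Rightarrow> nat \<Rightarrow> int" where
  "lincomb gs c = (\<lambda>j. \<Sum>i<length gs. c i * (gs ! i) j)"

definition lin_indep :: "nat \<Rightarrow> (nat \<Rightarrow> int) list \<Rightarrow> bool" where
  "lin_indep N gs \<longleftrightarrow> (\<forall>c. (\<forall>j<N. lincomb gs c j = 0) \<longrightarrow> (\<forall>i<length gs. c i = 0))"

definition rows_mat :: "nat \<Rightarrow> (nat \<Rightarrow> int) list \<Rightarrow> int mat" where
  "rows_mat N rs = mat N N (\<lambda>(i, j). (rs ! i) j)"

lemma rows_mat_carrier [simp]: "rows_mat N rs \<in> carrier_mat N N"
  by (simp add: rows_mat_def)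

lemma dotp_commute: "dotp N r p = dotp N p r"
  by (simp add: dotp_def mult.commute)

lemma dotp_cong: "(\<And>j. j < N \<Longrightarrow> r j = r' j) \<Longrightarrow> (\<And>j. j < N \<Longrightarrow> p j = p' j) \<Longrightarrow> dotp N r p = dotp N r' p'"
  by (simp add: dotp_def)

lemma dotp_sum_left: "dotp N (\<lambda>j. \<Sum>i\<in>I. c i * f i j) p = (\<Sum>i\<in>I. c i * dotp N (f i) p)"
  unfolding dotp_def sum_distrib_left sum_distrib_right
  by (subst sum.swap) (simp add: mult.assoc)

lemma dotp_sum_right: "dotp N r (\<lambda>j. \<Sum>i\<in>I. c i * f i j) = (\<Sum>i\<in>I. c i * dotp N r (f i))"
  by (simp add: dotp_commute[of N r] dotp_sum_left)

lemma dotp_lincomb_left: "dotp N (lincomb gs c) p = (\<Sum>i<length gs. c i * dotp N (gs ! i) p)"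
  by (simp add: lincomb_def dotp_sum_left)

lemma dotp_lincomb_right: "dotp N r (lincomb gs c) = (\<Sum>i<length gs. c i * dotp N r (gs ! i))"
  by (simp add: dotp_commute[of N r] dotp_lincomb_left)

lemma dotp_add_left: "dotp N (\<lambda>j. a * r j + b * s j) p = a * dotp N r p + b * dotp N s p"
  by (simp add: dotp_def sum.distrib sum_distrib_left algebra_simps)

lemma dotp_add_right: "dotp N r (\<lambda>j. a * p j + b * q j) = a * dotp N r p + b * dotp N r q"
  by (simp add: dotp_commute[of N r] dotp_add_left)

lemma dotp_scale_right: "dotp N r (\<lambda>j. a * p j) = a * dotp N r p"
  by (simp add: dotp_def sum_distrib_left algebra_simps)

lemma dotp_self_eq_0_iff: "dotp N p p = 0 \<longleftrightarrow> \<not> nonzero_below N p"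
  unfolding dotp_def nonzero_below_def by (subst sum_nonneg_eq_0_iff) auto

lemma orthD: "p \<in> orth N A \<Longrightarrow> r \<in> A \<Longrightarrow> dotp N r p = 0"
  by (simp add: orth_def)

lemma orth_insert: "p \<in> orth N (insert r A) \<longleftrightarrow> dotp N r p = 0 \<and> p \<in> orth N A"
  by (auto simp: orth_def)

lemma orth_Un: "orth N (A \<union> B) = orth N A \<inter> orth N B"
  by (auto simp: orth_def)

lemma orth_antimono: "A \<subseteq> B \<Longrightarrow> orth N B \<subseteq> orth N A"
  by (auto simp: orth_def)

lemma orth_cong: "(\<And>j. j < N \<Longrightarrow> p j = q j) \<Longrightarrow> p \<in> orth N A \<longleftrightarrow> q \<in> orth N A"
  unfolding orth_def using dotp_cong[of N _ _ p q] by auto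

lemma orth_scale_iff: "a \<noteq> 0 \<Longrightarrow> (\<lambda>j. a * p j) \<in> orth N A \<longleftrightarrow> p \<in> orth N A"
  by (simp add: orth_def dotp_scale_right)

lemma orth_add: "p \<in> orth N A \<Longrightarrow> q \<in> orth N A \<Longrightarrow> (\<lambda>j. a * p j + b * q j) \<in> orth N A"
  by (simp add: orth_def dotp_add_right)

lemma orth_lincomb: "set gs \<subseteq> orth N A \<Longrightarrow> lincomb gs c \<in> orth N A"
  by (auto simp: orth_def dotp_lincomb_right subset_iff intro!: sum.neutral)

lemma subset_orth_orth: "A \<subseteq> orth N (orth N A)"
  by (auto simp: orth_def dotp_commute)

lemma orth_orth_orth [simp]: "orth N (orth N (orth N A)) = orth N A"
  by (meson orth_antimono subset_antisym subset_orth_orth)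

lemma orth_rat_span [simp]: "orth N (rat_span N A) = orth N A"
  by (simp add: rat_span_def)

lemma subset_rat_span: "A \<subseteq> rat_span N A"
  by (simp add: rat_span_def subset_orth_orth)

lemma rat_span_base: "p \<in> A \<Longrightarrow> p \<in> rat_span N A"
  using subset_rat_span by blast

lemma rat_span_subset_orth: "A \<subseteq> orth N B \<Longrightarrow> rat_span N A \<subseteq> orth N B"
  unfolding rat_span_def using orth_antimono[OF orth_antimono, of A "orth N B" N N] by simp

lemma rat_span_minimal: "A \<subseteq> rat_span N B \<Longrightarrow> rat_span N A \<subseteq> rat_span N B"
  using rat_span_subset_orth unfolding rat_span_def[of N B] .

lemma rat_span_mono: "A \<subseteq> B \<Longrightarrow> rat_span N A \<subseteq> rat_span N B"
  using rat_span_minimal[of A N B] subset_rat_span[of B N] by blast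

lemma rat_span_orth_eq_0: "p \<in> rat_span N A \<Longrightarrow> p \<in> orth N A \<Longrightarrow> \<not> nonzero_below N p"
  unfolding rat_span_def using orthD dotp_self_eq_0_iff by blast

lemma zero_in_orth: "\<not> nonzero_below N p \<Longrightarrow> p \<in> orth N A"
  by (simp add: orth_def nonzero_below_def dotp_def)

lemma rat_span_scale_iff: "a \<noteq> 0 \<Longrightarrow> (\<lambda>j. a * p j) \<in> rat_span N A \<longleftrightarrow> p \<in> rat_span N A"
  unfolding rat_span_def by (rule orth_scale_iff)

lemma rat_span_add: "p \<in> rat_span N A \<Longrightarrow> q \<in> rat_span N A \<Longrightarrow> (\<lambda>j. a * p j + b * q j) \<in> rat_span N A"
  unfolding rat_span_def by (rule orth_add)

lemma rat_spanI:
  assumes "a \<noteq> 0" "\<And>j. j < N \<Longrightarrow> a * p j = lincomb gs c j" "set gs \<subseteq> rat_span N A"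
  shows "p \<in> rat_span N A"
  using assms orth_lincomb[of gs N "orth N A" c] orth_cong[of N "\<lambda>j. a * p j" "lincomb gs c"] orth_scale_iff[of a p N]
  unfolding rat_span_def by blast

lemma lincomb_Nil [simp]: "lincomb [] c = (\<lambda>j. 0)"
  by (simp add: lincomb_def)

lemma lincomb_Cons [simp]: "lincomb (g # gs) c = (\<lambda>j. c 0 * g j + lincomb gs (\<lambda>i. c (Suc i)) j)"
  by (simp add: lincomb_def sum.lessThan_Suc_shift del: sum.lessThan_Suc)

lemma lincomb_append: "lincomb (gs @ hs) c j = lincomb gs c j + lincomb hs (\<lambda>i. c (length gs + i)) j"
  by (induction gs arbitrary: c) simp_all

lemma lin_indepD: "lin_indep N gs \<Longrightarrow> (\<And>j. j < N \<Longrightarrow> lincomb gs c j = 0) \<Longrightarrow> i < length gs \<Longrightarrow> c i = 0"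
  unfolding lin_indep_def by blast

lemma lin_indep_Nil [simp]: "lin_indep N []"
  by (simp add: lin_indep_def)

lemma lin_indep_singleton: "lin_indep N [p] \<longleftrightarrow> nonzero_below N p"
proof
  assume "lin_indep N [p]"
  then show "nonzero_below N p" using lin_indepD[of N "[p]" "\<lambda>_. 1" 0] by (auto simp: nonzero_below_def)
qed (auto simp: lin_indep_def nonzero_below_def)

lemma lin_indep_appendD: "lin_indep N (gs @ hs) \<Longrightarrow> lin_indep N gs"
  unfolding lin_indep_def
proof (intro allI impI)
  fix c i
  assume indep: "\<forall>c. (\<forall>j<N. lincomb (gs @ hs) c j = 0) \<longrightarrow> (\<forall>i<length (gs @ hs). c i = 0)"
    and rel: "\<forall>j<N. lincomb gs c j = 0" and i_less: "i < length gs"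
  define d where "d = (\<lambda>i. if i < length gs then c i else 0)"
  have "lincomb gs d = lincomb gs c" "lincomb hs (\<lambda>i. d (length gs + i)) = (\<lambda>j. 0)"
    by (auto simp: d_def lincomb_def intro!: sum.cong)
  then have "\<forall>j<N. lincomb (gs @ hs) d j = 0" using rel by (simp add: lincomb_append)
  then have "\<forall>i<length (gs @ hs). d i = 0" using indep by blast
  then show "c i = 0" using i_less by (metis d_def length_append trans_less_add1)
qed

lemma rows_mat_mult_vec_zero_iff:
  assumes "length rs = N"
  shows "rows_mat N rs *\<^sub>v vec N p = 0\<^sub>v N \<longleftrightarrow> p \<in> orth N (set rs)"
proof -
  have "rows_mat N rs *\<^sub>v vec N p = 0\<^sub>v N \<longleftrightarrow> (\<forall>i<N. dotp N (rs ! i) p = 0)"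
    by (auto simp: vec_eq_iff rows_mat_def scalar_prod_def dotp_def lessThan_atLeast0)
  then show ?thesis using assms by (simp add: orth_def all_set_conv_all_nth)
qed

lemma det_rows_mat_eq_0_iff:
  assumes "length rs = N"
  shows "det (rows_mat N rs) = 0 \<longleftrightarrow> (\<exists>p \<in> orth N (set rs). nonzero_below N p)"
proof -
  have "det (rows_mat N rs) = 0 \<longleftrightarrow> (\<exists>v \<in> carrier_vec N. v \<noteq> 0\<^sub>v N \<and> rows_mat N rs *\<^sub>v v = 0\<^sub>v N)"
    using det_0_iff_vec_prod_zero[OF rows_mat_carrier] by blast
  also have "\<dots> \<longleftrightarrow> (\<exists>p. vec N p \<noteq> 0\<^sub>v N \<and> rows_mat N rs *\<^sub>v vec N p = 0\<^sub>v N)"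
    by (metis dim_vec eq_vecI index_vec vec_carrier carrier_vecD)
  also have "\<dots> \<longleftrightarrow> (\<exists>p \<in> orth N (set rs). nonzero_below N p)"
  proof -
    have "vec N p \<noteq> 0\<^sub>v N \<longleftrightarrow> nonzero_below N p" for p by (auto simp: nonzero_below_def vec_eq_iff)
    then show ?thesis unfolding rows_mat_mult_vec_zero_iff[OF assms] by blast
  qed
  finally show ?thesis .
qed

lemma exists_orth:
  assumes "length rs < N"
  obtains p where "nonzero_below N p" "p \<in> orth N (set rs)"
proof -
  define rs' where "rs' = rs @ replicate (N - length rs) (\<lambda>_. 0)"
  have len: "length rs' = N" using assms by (simp add: rs'_def)
  have "\<not> N - 1 < length rs" "N - 1 - length rs < N - length rs" using assms by linarith+
  then have last_row: "rs' ! (N - 1) = (\<lambda>_. 0)" by (simp add: rs'_def nth_append)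
  let ?T = "transpose_mat (rows_mat N rs')"
  have "?T *\<^sub>v unit_vec N (N - 1) = 0\<^sub>v N"
    using assms last_row
    by (auto simp: vec_eq_iff rows_mat_def scalar_prod_def unit_vec_def if_distrib sum.delta cong: if_cong)
  moreover have "unit_vec N (N - 1) \<noteq> (0\<^sub>v N :: int vec)" using assms by simp
  ultimately have "det ?T = 0"
    using det_0_iff_vec_prod_zero[of ?T N] by (metis rows_mat_carrier transpose_carrier_mat unit_vec_carrier)
  then have "det (rows_mat N rs') = 0" using det_transpose[OF rows_mat_carrier] by metis
  then obtain p where "p \<in> orth N (set rs')" "nonzero_below N p" using det_rows_mat_eq_0_iff[OF len] by blast
  then show thesis using that orth_antimono[of "set rs" "set rs'" N] by (auto simp: rs'_def)
qed

definition columns :: "nat \<Rightarrow> (nat \<Rightarrow> int) list \<Rightarrow> (nat \<Rightarrow> int) list" where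
  "columns N rs = map (\<lambda>j i. (rs ! i) j) [0..<N]"

lemma length_columns [simp]: "length (columns N rs) = N"
  by (simp add: columns_def)

lemma orth_columns_iff: "c \<in> orth (length rs) (set (columns N rs)) \<longleftrightarrow> (\<forall>j<N. lincomb rs c j = 0)"
  by (auto simp: orth_def columns_def lincomb_def dotp_def mult.commute)

lemma lin_indep_iff_columns:
  "lin_indep N rs \<longleftrightarrow> (\<forall>c \<in> orth (length rs) (set (columns N rs)). \<not> nonzero_below (length rs) c)"
  by (auto simp: lin_indep_def orth_columns_iff nonzero_below_def)

lemma lin_indep_length_le:
  assumes "lin_indep N rs"
  shows "length rs \<le> N"
proof (rule ccontr)
  assume "\<not> length rs \<le> N"
  then have "length (columns N rs) < length rs" by simp
  then obtain c where "nonzero_below (length rs) c" "c \<in> orth (length rs) (set (columns N rs))"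
    using exists_orth by blast
  then show False using assms by (simp add: lin_indep_iff_columns)
qed

lemma lin_indep_iff_det:
  assumes "length rs = N"
  shows "lin_indep N rs \<longleftrightarrow> det (rows_mat N rs) \<noteq> 0"
proof -
  have "rows_mat N (columns N rs) = transpose_mat (rows_mat N rs)"
    by (auto simp: rows_mat_def columns_def)
  then have "det (rows_mat N (columns N rs)) = det (rows_mat N rs)"
    using det_transpose[OF rows_mat_carrier] by metis
  then show ?thesis
    using det_rows_mat_eq_0_iff[of "columns N rs" N] assms by (auto simp: lin_indep_iff_columns)
qed

lemma lin_indep_snocI:
  assumes "lin_indep N rs" "p \<in> orth N (set rs)" "dotp N r p \<noteq> 0"
  shows "lin_indep N (rs @ [r])"
  unfolding lin_indep_def
proof (intro allI impI)
  fix c i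
  assume rel: "\<forall>j<N. lincomb (rs @ [r]) c j = 0" and i_less: "i < length (rs @ [r])"
  have "0 = dotp N (lincomb (rs @ [r]) c) p" using rel by (simp add: dotp_def)
  also have "\<dots> = (\<Sum>i<length rs. c i * dotp N (rs ! i) p) + c (length rs) * dotp N r p"
    by (simp add: dotp_lincomb_left nth_append)
  also have "(\<Sum>i<length rs. c i * dotp N (rs ! i) p) = 0"
    using assms(2) by (auto simp: orth_def intro!: sum.neutral)
  finally have last: "c (length rs) = 0" using assms(3) by simp
  then have "lincomb rs c j = 0" if "j < N" for j using rel that by (simp add: lincomb_append)
  then have "c i = 0" if "i < length rs" for i using lin_indepD[OF assms(1)] that by blast
  then show "c i = 0" using i_less last by (cases "i < length rs") (auto simp: less_Suc_eq)
qed

lemma lin_indep_extend: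
  assumes "lin_indep N rs"
  obtains ts where "set ts \<subseteq> A" "lin_indep N (rs @ ts)" "orth N (set (rs @ ts)) \<subseteq> orth N A"
  using assms
proof (induction "N - length rs" arbitrary: rs thesis rule: less_induct)
  case less
  show ?case
  proof (cases "orth N (set rs) \<subseteq> orth N A")
    case True
    then show ?thesis using less.prems(1)[of "[]"] less.prems(2) by simp
  next
    case False
    then obtain p r where r_in: "p \<in> orth N (set rs)" "r \<in> A" "dotp N r p \<noteq> 0"
      by (auto simp: orth_def)
    have indep: "lin_indep N (rs @ [r])" by (rule lin_indep_snocI[OF less.prems(2) r_in(1,3)])
    then have "N - length (rs @ [r]) < N - length rs" using lin_indep_length_le by fastforce
    then obtain ts where "set ts \<subseteq> A" "lin_indep N ((rs @ [r]) @ ts)"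
      "orth N (set ((rs @ [r]) @ ts)) \<subseteq> orth N A"
      using less.hyps[of "rs @ [r]"] indep by blast
    then show ?thesis using less.prems(1)[of "r # ts"] r_in(2) by simp
  qed
qed

lemma lin_indep_append_orth:
  assumes rs: "lin_indep N rs" and gs: "lin_indep N gs" "set gs \<subseteq> orth N (set rs)"
  shows "lin_indep N (rs @ gs)"
  unfolding lin_indep_def
proof (intro allI impI)
  fix c i
  assume rel: "\<forall>j<N. lincomb (rs @ gs) c j = 0" and i_less: "i < length (rs @ gs)"
  define u where "u = lincomb rs c"
  define w where "w = lincomb gs (\<lambda>i. c (length rs + i))"
  have u_eq: "u j = - w j" if "j < N" for j
    using rel that by (simp add: lincomb_append u_def w_def add_eq_0_iff2)
  have "w \<in> orth N (set rs)" unfolding w_def by (rule orth_lincomb[OF gs(2)])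
  moreover have "w \<in> rat_span N (set rs)"
    by (rule rat_spanI[of "-1" N w rs c, OF _ _ subset_rat_span]) (use u_eq in \<open>auto simp: u_def\<close>)
  ultimately have w_eq_0: "w j = 0" if "j < N" for j
    using rat_span_orth_eq_0 that by (auto simp: nonzero_below_def)
  have "c i = 0" if "i < length rs" for i
    using lin_indepD[OF rs _ that, of c] u_eq w_eq_0 by (simp add: u_def)
  moreover have "c (length rs + i) = 0" if "i < length gs" for i
    using lin_indepD[OF gs(1) _ that, of "\<lambda>i. c (length rs + i)"] w_eq_0 by (simp add: w_def)
  ultimately show "c i = 0"
    using i_less by (metis add_diff_inverse_nat length_append nat_add_left_cancel_less)
qed

lemma exists_orth_basis:
  assumes rs: "lin_indep N rs" and gs: "lin_indep N gs" "set gs \<subseteq> orth N (set rs)"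
  obtains hs where "lin_indep N (gs @ hs)" "orth N (set rs) = rat_span N (set (gs @ hs))"
    "length rs + length (gs @ hs) = N"
proof -
  obtain hs where hs: "set hs \<subseteq> orth N (set rs)" "lin_indep N (gs @ hs)"
    "orth N (set (gs @ hs)) \<subseteq> orth N (orth N (set rs))"
    by (rule lin_indep_extend[OF gs(1), of "orth N (set rs)"])
  have subset_orth: "set (gs @ hs) \<subseteq> orth N (set rs)" using gs(2) hs(1) by simp
  have span: "orth N (set rs) = rat_span N (set (gs @ hs))"
  proof
    show "orth N (set rs) \<subseteq> rat_span N (set (gs @ hs))"
      using orth_antimono[OF hs(3), of N] by (simp add: rat_span_def)
    show "rat_span N (set (gs @ hs)) \<subseteq> orth N (set rs)" by (rule rat_span_subset_orth[OF subset_orth])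
  qed
  have "\<not> length (rs @ gs @ hs) < N"
  proof
    assume "length (rs @ gs @ hs) < N"
    then obtain p where "nonzero_below N p" "p \<in> orth N (set (rs @ gs @ hs))" by (rule exists_orth)
    then show False using rat_span_orth_eq_0[of p N "set (gs @ hs)"] span by (auto simp: orth_Un)
  qed
  moreover have "length (rs @ gs @ hs) \<le> N"
    by (rule lin_indep_length_le[OF lin_indep_append_orth[OF rs hs(2) subset_orth]])
  ultimately show thesis using that[OF hs(2) span] by simp
qed

lemma orth_eq_rat_span:
  assumes "lin_indep N rs" "lin_indep N gs" "set gs \<subseteq> orth N (set rs)" "N \<le> length rs + length gs"
  shows "orth N (set rs) = rat_span N (set gs)"
proof -
  obtain hs where hs: "orth N (set rs) = rat_span N (set (gs @ hs))" "length rs + length (gs @ hs) = N"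
    by (rule exists_orth_basis[OF assms(1-3)])
  moreover have "length hs = 0" using hs(2) assms(4) by (simp del: length_0_conv)
  ultimately show ?thesis by simp
qed

lemma lin_indep_snoc_iff:
  assumes "lin_indep N gs"
  shows "lin_indep N (gs @ [p]) \<longleftrightarrow> p \<notin> rat_span N (set gs)"
proof
  assume "p \<notin> rat_span N (set gs)"
  then obtain q where "q \<in> orth N (set gs)" "dotp N p q \<noteq> 0"
    by (auto simp: rat_span_def orth_def dotp_commute)
  then show "lin_indep N (gs @ [p])" by (rule lin_indep_snocI[OF assms])
next
  assume snoc: "lin_indep N (gs @ [p])"
  show "p \<notin> rat_span N (set gs)"
  proof
    assume p_span: "p \<in> rat_span N (set gs)"
    obtain hs where hs: "lin_indep N hs" "orth N (set gs) = rat_span N (set hs)" "length gs + length hs = N"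
      using exists_orth_basis[OF assms, of "[]"] by auto
    have "set hs \<subseteq> orth N (set gs)" using hs(2) subset_rat_span by simp
    then have "set hs \<subseteq> orth N (set (gs @ [p]))"
      using p_span by (auto simp: rat_span_def orth_def dotp_commute subset_iff)
    from lin_indep_length_le[OF lin_indep_append_orth[OF snoc hs(1) this]] show False using hs(3) by simp
  qed
qed

lemma length_add_eq_of_orth_eq_rat_span:
  assumes rs: "lin_indep N rs" and gs: "lin_indep N gs" and span: "orth N (set rs) = rat_span N (set gs)"
  shows "length rs + length gs = N"
proof -
  have subset_orth: "set gs \<subseteq> orth N (set rs)" using subset_rat_span span by blast
  obtain hs where hs: "lin_indep N (gs @ hs)" "orth N (set rs) = rat_span N (set (gs @ hs))"
    "length rs + length (gs @ hs) = N"
    by (rule exists_orth_basis[OF rs gs subset_orth])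
  have "hs = []"
  proof (cases hs)
    case (Cons h hs')
    then have "lin_indep N (gs @ [h])" using lin_indep_appendD[of N "gs @ [h]" hs'] hs(1) by simp
    moreover have "h \<in> rat_span N (set gs)"
      using subset_rat_span[of "set (gs @ hs)" N] Cons span hs(2) by auto
    ultimately show ?thesis using lin_indep_snoc_iff[OF gs] by blast
  qed
  then show ?thesis using hs(3) by simp
qed

lemma lin_indep_of_spanning:
  assumes gs: "lin_indep N gs" "set gs \<subseteq> rat_span N (set hs)" and len: "length hs \<le> length gs"
  shows "lin_indep N hs"
proof -
  obtain os where os: "lin_indep N os" "orth N (set gs) = rat_span N (set os)" "length gs + length os = N"
    using exists_orth_basis[OF gs(1), of "[]"] by auto
  have orth_trivial: "\<not> nonzero_below N p" if "p \<in> orth N (set (hs @ os))" for p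
  proof -
    have "p \<in> orth N (set gs)" using that orth_antimono[OF gs(2), of N] by (auto simp: orth_Un)
    then show ?thesis using rat_span_orth_eq_0[of p N "set os"] that os(2) by (simp add: orth_Un)
  qed
  then have "\<not> length (hs @ os) < N" using exists_orth[of "hs @ os" N] by blast
  then have "length (hs @ os) = N" using os(3) len by simp
  then have "lin_indep N (hs @ os)" using orth_trivial by (simp add: lin_indep_iff_det det_rows_mat_eq_0_iff)
  then show ?thesis by (rule lin_indep_appendD)
qed

lemma lin_indep_length_le_spanning:
  assumes gs: "lin_indep N gs" "set gs \<subseteq> rat_span N (set hs)"
  shows "length gs \<le> length hs"
proof (rule ccontr)
  let ?zero = "\<lambda>_. 0 :: int"
  assume "\<not> length gs \<le> length hs"
  moreover have "set gs \<subseteq> rat_span N (set (hs @ [?zero]))"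
    using gs(2) rat_span_mono[of "set hs" "set (hs @ [?zero])" N] by auto
  ultimately have "lin_indep N (hs @ [?zero])" by (intro lin_indep_of_spanning[OF gs(1)]) auto
  moreover have "?zero \<in> rat_span N (set hs)"
    unfolding rat_span_def by (rule zero_in_orth) (simp add: nonzero_below_def)
  ultimately show False using lin_indep_snoc_iff[of N hs ?zero] lin_indep_appendD by blast
qed

lemma rat_span_eq_of_length:
  assumes gs: "lin_indep N gs" "set gs \<subseteq> rat_span N (set hs)" and len: "length hs \<le> length gs"
  shows "rat_span N (set gs) = rat_span N (set hs)"
proof (rule antisym[OF rat_span_minimal[OF gs(2)] rat_span_minimal])
  show "set hs \<subseteq> rat_span N (set gs)"
  proof
    fix h assume h_in: "h \<in> set hs"
    show "h \<in> rat_span N (set gs)"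
    proof (rule ccontr)
      assume "h \<notin> rat_span N (set gs)"
      then have "lin_indep N (gs @ [h])" by (simp add: lin_indep_snoc_iff[OF gs(1)])
      moreover have "set (gs @ [h]) \<subseteq> rat_span N (set hs)" using gs(2) h_in rat_span_base by auto
      ultimately show False using lin_indep_length_le_spanning len by fastforce
    qed
  qed
qed

lemma exchange_in_basis:
  assumes vs: "lin_indep N vs" and w_span: "w \<in> rat_span N (set vs)" "nonzero_below N w"
  obtains ts where "set ts \<subseteq> set vs" "length vs = Suc (length ts)" "lin_indep N (w # ts)"
    "rat_span N (set (w # ts)) = rat_span N (set vs)"
proof -
  have "lin_indep N [w]" using w_span(2) by (simp add: lin_indep_singleton)
  then obtain ts where ts: "set ts \<subseteq> set vs" "lin_indep N ([w] @ ts)"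
    "orth N (set ([w] @ ts)) \<subseteq> orth N (set vs)"
    by (rule lin_indep_extend[of N "[w]" "set vs"])
  have subset_span: "set (w # ts) \<subseteq> rat_span N (set vs)" using w_span(1) ts(1) rat_span_base by auto
  have "set vs \<subseteq> rat_span N (set (w # ts))"
    using subset_rat_span[of "set vs" N] orth_antimono[OF ts(3)] unfolding rat_span_def by simp blast
  then have "length vs \<le> length (w # ts)" by (rule lin_indep_length_le_spanning[OF vs])
  moreover have "length (w # ts) \<le> length vs"
    by (rule lin_indep_length_le_spanning[OF _ subset_span]) (use ts(2) in simp)
  moreover have "rat_span N (set (w # ts)) = rat_span N (set vs)"
    by (rule rat_span_eq_of_length[OF _ subset_span]) (use ts(2) calculation in simp_all)
  ultimately show thesis using that[of ts] ts(1,2) by simp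
qed

lemma lin_indep_perm: "lin_indep N gs \<Longrightarrow> set gs = set hs \<Longrightarrow> length gs = length hs \<Longrightarrow> lin_indep N hs"
  using lin_indep_of_spanning[of N gs hs] subset_rat_span[of "set hs" N] by simp

lemma lincomb_subset:
  assumes "set ts \<subseteq> set gs"
  obtains d where "lincomb ts c = lincomb gs d"
  using assms
proof (induction ts arbitrary: c thesis)
  case Nil
  have "lincomb gs (\<lambda>_. 0) = lincomb [] c" by (simp add: lincomb_def)
  then show ?case using Nil(1) by metis
next
  case (Cons g ts)
  obtain d where d: "lincomb ts (\<lambda>i. c (Suc i)) = lincomb gs d" using Cons.IH Cons.prems(2) by auto
  obtain k where k_less: "k < length gs" "gs ! k = g" using Cons.prems(2) by (auto simp: in_set_conv_nth)
  have "lincomb gs (\<lambda>i. (if i = k then c 0 else 0) + d i) j = c 0 * g j + lincomb gs d j" for j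
    using k_less by (simp add: lincomb_def distrib_right sum.distrib if_distrib[of "\<lambda>x. x * _"] cong: if_cong)
  then show ?case using Cons.prems(1) d by (metis (no_types, lifting) ext lincomb_Cons)
qed

lemma rat_span_set_iff:
  "p \<in> rat_span N (set gs) \<longleftrightarrow> (\<exists>a c. a \<noteq> 0 \<and> (\<forall>j<N. a * p j = lincomb gs c j))"
proof
  assume p_span: "p \<in> rat_span N (set gs)"
  obtain ts where ts: "set ts \<subseteq> set gs" "lin_indep N ts" "orth N (set ts) \<subseteq> orth N (set gs)"
    using lin_indep_extend[of N "[]" "set gs"] by auto
  have "p \<in> rat_span N (set ts)" using p_span orth_antimono[OF ts(3), of N] by (auto simp: rat_span_def)
  then have "\<not> lin_indep N (ts @ [p])" by (simp add: lin_indep_snoc_iff[OF ts(2)])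
  then obtain c i where rel: "\<And>j. j < N \<Longrightarrow> lincomb (ts @ [p]) c j = 0"
    and i_coeff: "i < length (ts @ [p])" "c i \<noteq> 0"
    unfolding lin_indep_def by blast
  have "c (length ts) \<noteq> 0"
  proof
    assume last: "c (length ts) = 0"
    then have "lincomb ts c j = 0" if "j < N" for j using rel[OF that] by (simp add: lincomb_append)
    then show False using lin_indepD[OF ts(2), of c i] i_coeff last by (auto simp: less_Suc_eq)
  qed
  moreover have "- c (length ts) * p j = lincomb ts c j" if "j < N" for j
    using rel[OF that] by (simp add: lincomb_append)
  ultimately show "\<exists>a c. a \<noteq> 0 \<and> (\<forall>j<N. a * p j = lincomb gs c j)"
    using lincomb_subset[OF ts(1), of c] by (metis neg_equal_0_iff_equal)
qed (use rat_spanI[OF _ _ subset_rat_span] in blast)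

lemma rat_span_singleton_iff: "p \<in> rat_span N {g} \<longleftrightarrow> (\<exists>a b. a \<noteq> 0 \<and> (\<forall>j<N. a * p j = b * g j))"
proof
  assume "p \<in> rat_span N {g}"
  then obtain a c where "a \<noteq> 0" "\<forall>j<N. a * p j = c 0 * g j"
    using rat_span_set_iff[of p N "[g]"] by auto
  then show "\<exists>a b. a \<noteq> 0 \<and> (\<forall>j<N. a * p j = b * g j)" by blast
next
  assume "\<exists>a b. a \<noteq> 0 \<and> (\<forall>j<N. a * p j = b * g j)"
  then obtain a b where "a \<noteq> 0" "\<forall>j<N. a * p j = b * g j" by blast
  then show "p \<in> rat_span N {g}" by (intro rat_spanI[of a N p "[g]" "\<lambda>_. b"]) (auto intro: rat_span_base)
qed

lemma lin_indep_pair_iff: "lin_indep N [p, q] \<longleftrightarrow> nonzero_below N p \<and> q \<notin> rat_span N {p}"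
  using lin_indep_appendD[of N "[p]" "[q]"] lin_indep_snoc_iff[of N "[p]" q]
  by (auto simp: lin_indep_singleton)

lemma abs_det_rows_mat_ge_1:
  assumes "length rs = N" "\<And>p. p \<in> orth N (set rs) \<Longrightarrow> \<not> nonzero_below N p"
  shows "1 \<le> \<bar>real_of_int (det (rows_mat N rs))\<bar>"
proof -
  have "det (rows_mat N rs) \<noteq> 0" using assms by (auto simp: det_rows_mat_eq_0_iff)
  then have "1 \<le> \<bar>det (rows_mat N rs)\<bar>" by linarith
  then show ?thesis by linarith
qed

section \<open>Shifts and multiples\<close>

text \<open>
  A vector is also read as the polynomial with these coefficients; \<open>tmult i\<close> is then the multiplication
  by \<open>T\<^sup>i\<close>.
\<close>

definition shift :: "nat \<Rightarrow> (nat \<Rightarrow> int) \<Rightarrow> nat \<Rightarrow> int" where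
  "shift k x = (\<lambda>j. x (k + j))"

definition tmult :: "nat \<Rightarrow> (nat \<Rightarrow> int) \<Rightarrow> nat \<Rightarrow> int" where
  "tmult i p = (\<lambda>j. if j < i then 0 else p (j - i))"

definition tmults :: "nat \<Rightarrow> (nat \<Rightarrow> int) \<Rightarrow> (nat \<Rightarrow> int) list" where
  "tmults q p = map (\<lambda>i. tmult i p) [0..<q]"

definition supp_below :: "nat \<Rightarrow> (nat \<Rightarrow> int) \<Rightarrow> bool" where
  "supp_below N p \<longleftrightarrow> (\<forall>j\<ge>N. p j = 0)"

definition trunc :: "nat \<Rightarrow> (nat \<Rightarrow> int) \<Rightarrow> nat \<Rightarrow> int" where
  "trunc N p = (\<lambda>j. if j < N then p j else 0)"

definition primitive :: "(nat \<Rightarrow> int) \<Rightarrow> bool" where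
  "primitive p \<longleftrightarrow> Gcd (range p) = 1"

lemma shift_0 [simp]: "shift 0 x = x"
  by (simp add: shift_def)

lemma shift_shift [simp]: "shift i (shift k x) = shift (k + i) x"
  by (simp add: shift_def ac_simps)

lemma tmult_0 [simp]: "tmult 0 p = p"
  by (simp add: tmult_def)

lemma length_tmults [simp]: "length (tmults q p) = q"
  by (simp add: tmults_def)

lemma nth_tmults [simp]: "i < q \<Longrightarrow> tmults q p ! i = tmult i p"
  by (simp add: tmults_def)

lemma set_tmults: "set (tmults q p) = (\<lambda>i. tmult i p) ` {..<q}"
  by (simp add: tmults_def lessThan_atLeast0)

lemma tmults_Suc_0 [simp]: "tmults (Suc 0) p = [p]"
  by (simp add: tmults_def)

lemma tmults_2: "tmults 2 p = [p, tmult (Suc 0) p]"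
  by (simp add: tmults_def eval_nat_numeral)

lemma lincomb_tmults: "lincomb (tmults q p) c j = (\<Sum>i<q. c i * tmult i p j)"
  by (simp add: lincomb_def)

lemma supp_below_trunc [simp]: "supp_below N (trunc N p)"
  by (simp add: supp_below_def trunc_def)

lemma trunc_in_orth_iff [simp]: "trunc N p \<in> orth N A \<longleftrightarrow> p \<in> orth N A"
  by (rule orth_cong) (simp add: trunc_def)

lemma trunc_in_rat_span_iff [simp]: "trunc N p \<in> rat_span N A \<longleftrightarrow> p \<in> rat_span N A"
  by (simp add: rat_span_def)

lemma dotp_tmult:
  assumes "supp_below N p" "i + N \<le> N'"
  shows "dotp N' x (tmult i p) = dotp N (shift i x) p"
proof -
  have "dotp N' x (tmult i p) = (\<Sum>j<N'. if j < i then 0 else x j * p (j - i))"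
    unfolding dotp_def by (intro sum.cong) (auto simp: tmult_def)
  also have "\<dots> = (\<Sum>j\<in>{i..<i + N}. x j * p (j - i))"
    using assms by (intro sum.mono_neutral_cong_right) (auto simp: supp_below_def)
  also have "\<dots> = (\<Sum>j<N. x (i + j) * p j)"
    using sum.shift_bounds_nat_ivl[of "\<lambda>j. x j * p (j - i)" 0 i N] by (simp add: ac_simps lessThan_atLeast0)
  finally show ?thesis by (simp add: dotp_def shift_def)
qed

lemma lowest_coeff:
  fixes p :: "nat \<Rightarrow> int"
  assumes "nonzero_below N p"
  obtains l where "l < N" "p l \<noteq> 0" "\<And>j. j < l \<Longrightarrow> p j = 0"
proof -
  obtain j where j_coeff: "j < N" "p j \<noteq> 0" using assms by (auto simp: nonzero_below_def)
  define l where "l = (LEAST j. p j \<noteq> 0)"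
  have "p l \<noteq> 0" "l \<le> j" unfolding l_def using j_coeff(2) by (rule LeastI, intro Least_le)
  moreover have "p j = 0" if "j < l" for j using not_less_Least[of j "\<lambda>j. p j \<noteq> 0"] that by (auto simp: l_def)
  ultimately show thesis using j_coeff(1) by (intro that[of l]) auto
qed

lemma lin_indep_tmults:
  assumes "supp_below (Suc d) p" "nonzero_below (Suc d) p"
  shows "lin_indep (d + q) (tmults q p)"
proof (rule ccontr)
  assume "\<not> lin_indep (d + q) (tmults q p)"
  then obtain c where rel: "\<And>j. j < d + q \<Longrightarrow> (\<Sum>i<q. c i * tmult i p j) = 0" and "nonzero_below q c"
    by (auto simp: lin_indep_def lincomb_tmults nonzero_below_def)
  obtain i where i_lowest: "i < q" "c i \<noteq> 0" "\<And>k. k < i \<Longrightarrow> c k = 0"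
    using lowest_coeff[OF \<open>nonzero_below q c\<close>] by blast
  obtain l where l_lowest: "l < Suc d" "p l \<noteq> 0" "\<And>j. j < l \<Longrightarrow> p j = 0"
    using lowest_coeff[OF assms(2)] by blast
  have "c k * tmult k p (l + i) = 0" if "k \<noteq> i" for k
    using that i_lowest(3)[of k] l_lowest(3)[of "l + i - k"] by (cases "k < i") (auto simp: tmult_def)
  then have "(\<Sum>k<q. c k * tmult k p (l + i)) = (\<Sum>k\<in>{i}. c k * tmult k p (l + i))"
    using i_lowest(1) by (intro sum.mono_neutral_right) auto
  also have "\<dots> = c i * p l" by (simp add: tmult_def)
  finally show False using rel[of "l + i"] i_lowest l_lowest by simp
qed

lemma primitive_nonzero:
  assumes "primitive p" "supp_below N p"
  shows "nonzero_below N p"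
proof (rule ccontr)
  assume "\<not> nonzero_below N p"
  then have "p = (\<lambda>_. 0)" using assms(2) by (auto simp: nonzero_below_def supp_below_def not_le[symmetric])
  then show False using assms(1) by (simp add: primitive_def)
qed

lemma primitive_part:
  assumes "nonzero_below N p"
  obtains g p' where "g \<noteq> 0" "primitive p'" "supp_below N p'" "trunc N p = (\<lambda>j. g * p' j)"
proof -
  define g where "g = Gcd (range (trunc N p))"
  define p' where "p' = (\<lambda>j. trunc N p j div g)"
  have "\<exists>j. trunc N p j \<noteq> 0" using assms by (auto simp: nonzero_below_def trunc_def)
  then have g_nonzero: "g \<noteq> 0" by (auto simp: g_def)
  have trunc_eq: "trunc N p = (\<lambda>j. g * p' j)" by (auto simp: p'_def g_def)
  have "g = Gcd ((*) g ` range p')" by (subst g_def) (simp add: trunc_eq image_image)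
  also have "\<dots> = g * Gcd (range p')" by (simp add: Gcd_mult g_def)
  finally have "primitive p'" using g_nonzero by (simp add: primitive_def)
  moreover have "supp_below N p'" by (simp add: supp_below_def p'_def trunc_def)
  ultimately show thesis using that g_nonzero trunc_eq by blast
qed

section \<open>Heights and Toeplitz minors\<close>

definition hgt :: "nat \<Rightarrow> (nat \<Rightarrow> int) \<Rightarrow> real" where
  "hgt N p = (\<Sum>j<N. \<bar>real_of_int (p j)\<bar>)"

definition toeplitz_det :: "nat \<Rightarrow> (nat \<Rightarrow> int) \<Rightarrow> nat \<Rightarrow> int" where
  "toeplitz_det q p h = det (mat q q (\<lambda>(i, j). tmult i p (h + j)))"

definition unit_row :: "nat \<Rightarrow> nat \<Rightarrow> int" where
  "unit_row h = (\<lambda>j. if j = h then 1 else 0)"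

definition unit_rows :: "nat \<Rightarrow> nat \<Rightarrow> (nat \<Rightarrow> int) list" where
  "unit_rows h q = map unit_row [h..<h + q]"

definition height_const :: "nat \<Rightarrow> nat \<Rightarrow> real" where
  "height_const d q = 2 * ((real d + 1) * (2 * fact q) ^ d\<^sup>2) ^ q"

lemma length_unit_rows [simp]: "length (unit_rows h q) = q"
  by (simp add: unit_rows_def)

lemma nth_unit_rows [simp]: "i < q \<Longrightarrow> unit_rows h q ! i = unit_row (h + i)"
  by (simp add: unit_rows_def)

lemma sum_unit_row: "h < N \<Longrightarrow> (\<Sum>j<N. of_int (unit_row h j) * f j) = (f h :: 'a::ring_1)"
  by (simp add: unit_row_def sum.delta if_distrib[of "\<lambda>x. of_int x * _"] cong: if_cong)

lemma dotp_unit_row: "h < N \<Longrightarrow> dotp N (unit_row h) p = p h"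
  using sum_unit_row[of h N p] by (simp add: dotp_def)

lemma abs_le_hgt: "j < N \<Longrightarrow> \<bar>real_of_int (p j)\<bar> \<le> hgt N p"
  unfolding hgt_def by (rule member_le_sum) auto

lemma hgt_nonneg [simp]: "0 \<le> hgt N p"
  by (simp add: hgt_def sum_nonneg)

lemma hgt_ge_1:
  assumes "nonzero_below N p"
  shows "1 \<le> hgt N p"
proof -
  obtain j where j_coeff: "j < N" "p j \<noteq> 0" using assms by (auto simp: nonzero_below_def)
  then have "1 \<le> \<bar>real_of_int (p j)\<bar>"
    by (metis of_int_abs of_int_1_le_iff zero_less_abs_iff int_one_le_iff_zero_less)
  then show ?thesis using abs_le_hgt[OF j_coeff(1), of p] by linarith
qed

lemma hgt_pos: "primitive p \<Longrightarrow> supp_below N p \<Longrightarrow> 0 < hgt N p"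
  using hgt_ge_1[OF primitive_nonzero, of p N] by linarith

lemma abs_tmult_le_hgt:
  assumes "supp_below N p"
  shows "\<bar>real_of_int (tmult i p j)\<bar> \<le> hgt N p"
proof (cases "j < i \<or> N \<le> j - i")
  case True
  then have "tmult i p j = 0" using assms by (auto simp: tmult_def supp_below_def)
  then show ?thesis by simp
qed (simp add: tmult_def abs_le_hgt)

lemma height_const_ge_1: "1 \<le> height_const d q"
proof -
  have "(1::real) \<le> (2 * fact q) ^ d\<^sup>2"
    by (intro one_le_power) (metis fact_ge_1 mult_2 add_increasing2 zero_le_one order_trans)
  then have "1 \<le> ((real d + 1) * (2 * fact q) ^ d\<^sup>2) ^ q" by (intro one_le_power mult_ge1_I) auto
  then show ?thesis by (simp add: height_const_def)
qed

lemma height_const_mono: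
  assumes "d \<le> d'" "q \<le> q'"
  shows "height_const d q \<le> height_const d' q'"
proof -
  have fact_ge: "(1::real) \<le> 2 * fact k" for k :: nat
    using fact_ge_1[of k, where 'a = real] by linarith
  have "(2 * fact q :: real) ^ d\<^sup>2 \<le> (2 * fact q') ^ d'\<^sup>2"
    using assms fact_ge[of q] fact_ge[of q']
    by (intro order.trans[OF power_mono power_increasing] mult_left_mono fact_mono power_mono) auto
  then have base_le: "(real d + 1) * (2 * fact q) ^ d\<^sup>2 \<le> (real d' + 1) * (2 * fact q') ^ d'\<^sup>2"
    using assms by (intro mult_mono) auto
  have "1 \<le> (real d' + 1) * (2 * fact q') ^ d'\<^sup>2"
    using fact_ge by (intro mult_ge1_I one_le_power) auto
  then show ?thesis
    unfolding height_const_def using base_le assms(2)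
    by (intro mult_left_mono order.trans[OF power_mono power_increasing]) auto
qed

lemma permutes_descent:
  fixes q :: nat
  assumes "\<sigma> permutes {0..<q}" "\<sigma> \<noteq> id"
  obtains i where "i < q" "\<sigma> i < i"
proof -
  have "\<not> (\<forall>i\<in>{0..<q}. i \<le> \<sigma> i)" using permutes_natset_ge[OF assms(1)] assms(2) by blast
  then show thesis using that by force
qed

lemma toeplitz_det_Leibniz:
  "toeplitz_det q p h = p h ^ q + (\<Sum>\<sigma> | \<sigma> permutes {0..<q} \<and> \<sigma> \<noteq> id.
     signof \<sigma> * (\<Prod>i = 0..<q. tmult i p (h + \<sigma> i)))"
proof -
  let ?S = "{\<sigma>. \<sigma> permutes {0..<q}}"
  let ?f = "\<lambda>\<sigma>. signof \<sigma> * (\<Prod>i = 0..<q. tmult i p (h + \<sigma> i))"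
  have "toeplitz_det q p h = (\<Sum>\<sigma>\<in>?S. signof \<sigma> * (\<Prod>i = 0..<q. mat q q (\<lambda>(i, j). tmult i p (h + j)) $$ (i, \<sigma> i)))"
    unfolding toeplitz_det_def by (subst det_def'[of _ q]) auto
  also have "\<dots> = (\<Sum>\<sigma>\<in>?S. ?f \<sigma>)"
  proof (rule sum.cong[OF refl])
    fix \<sigma> assume "\<sigma> \<in> ?S"
    then have "\<sigma> i < q" if "i < q" for i
      using permutes_in_image[of \<sigma> "{0..<q}" i] that by auto
    then show "signof \<sigma> * (\<Prod>i = 0..<q. mat q q (\<lambda>(i, j). tmult i p (h + j)) $$ (i, \<sigma> i)) = ?f \<sigma>"
      by (auto intro!: prod.cong)
  qed
  also have "\<dots> = ?f id + (\<Sum>\<sigma>\<in>?S - {id}. ?f \<sigma>)"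
    by (intro sum.remove) (auto simp: finite_permutations permutes_id)
  also have "?f id = p h ^ q" by (simp add: tmult_def)
  also have "?S - {id} = {\<sigma>. \<sigma> permutes {0..<q} \<and> \<sigma> \<noteq> id}" by auto
  finally show ?thesis .
qed

lemma toeplitz_det_not_dvd:
  assumes "Factorial_Ring.prime \<pi>" "\<not> \<pi> dvd p h" "\<And>j. j < h \<Longrightarrow> \<pi> dvd p j"
  shows "\<not> \<pi> dvd toeplitz_det q p h"
proof -
  have "\<pi> dvd (\<Sum>\<sigma> | \<sigma> permutes {0..<q} \<and> \<sigma> \<noteq> id. signof \<sigma> * (\<Prod>i = 0..<q. tmult i p (h + \<sigma> i)))"
  proof (intro dvd_sum dvd_mult)
    fix \<sigma> assume "\<sigma> \<in> {\<sigma>. \<sigma> permutes {0..<q} \<and> \<sigma> \<noteq> id}"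
    then obtain i where descent: "i < q" "\<sigma> i < i" using permutes_descent by blast
    then have "\<pi> dvd tmult i p (h + \<sigma> i)" using assms(3) by (auto simp: tmult_def)
    also have "\<dots> dvd (\<Prod>i = 0..<q. tmult i p (h + \<sigma> i))" using descent(1) by (intro dvd_prodI) auto
    finally show "\<pi> dvd (\<Prod>i = 0..<q. tmult i p (h + \<sigma> i))" .
  qed
  moreover have "\<not> \<pi> dvd p h ^ q" using assms(1,2) prime_dvd_power by blast
  ultimately show ?thesis unfolding toeplitz_det_Leibniz by (simp add: dvd_add_left_iff)
qed

lemma Gcd_toeplitz_det:
  assumes "primitive p" "supp_below (Suc d) p"
  shows "Gcd (toeplitz_det q p ` {..d}) = 1"
proof (rule ccontr)
  assume "Gcd (toeplitz_det q p ` {..d}) \<noteq> 1"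
  then have "\<not> is_unit (Gcd (toeplitz_det q p ` {..d}))" by (metis is_unit_normalize normalize_Gcd)
  then obtain \<pi> where \<pi>_prime: "Factorial_Ring.prime \<pi>" "\<pi> dvd Gcd (toeplitz_det q p ` {..d})"
    using prime_divisor_exists[of "Gcd (toeplitz_det q p ` {..d})"] two_is_prime_nat
    by (metis dvd_0_right prime_int_numeral_eq)
  have "\<not> \<pi> dvd Gcd (range p)" using assms(1) \<pi>_prime(1) by (auto simp: primitive_def)
  then have "\<exists>j. \<not> \<pi> dvd p j" using Gcd_greatest[of "range p" \<pi>] by blast
  then obtain l where l: "\<not> \<pi> dvd p l" "\<And>j. j < l \<Longrightarrow> \<pi> dvd p j"
    using exists_least_iff[of "\<lambda>j. \<not> \<pi> dvd p j"] by auto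
  then have "l \<le> d" using assms(2) by (metis dvd_0_right not_less_eq_eq supp_below_def)
  then have "\<pi> dvd toeplitz_det q p l" using \<pi>_prime(2) by (meson Gcd_dvd atMost_iff dvd_trans image_eqI)
  then show False using toeplitz_det_not_dvd[of \<pi> p l q] \<pi>_prime(1) l by blast
qed

text \<open>
  If \<open>\<bar>p j\<bar> A\<^bsup>j\<^sup>2\<^esup>\<close> is maximal at \<open>j = h\<close>, then every summand of the Toeplitz determinant at \<open>h\<close>
  except \<open>p h ^ q\<close> loses a factor \<open>A\<close>, since the squares of the displacements of a permutation do not
  cancel.
\<close>

lemma abs_toeplitz_summand_le:
  fixes A :: real
  assumes A_ge_1: "1 \<le> A"
    and maximal: "\<And>j. \<bar>real_of_int (p j)\<bar> \<le> \<bar>real_of_int (p h)\<bar> * A powr (real h ^ 2 - real j ^ 2)"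
    and \<sigma>_permutes: "\<sigma> permutes {0..<q}" "\<sigma> \<noteq> id"
  shows "\<bar>real_of_int (signof \<sigma> * (\<Prod>i = 0..<q. tmult i p (h + \<sigma> i)))\<bar> \<le> \<bar>real_of_int (p h)\<bar> ^ q / A"
proof -
  define \<Delta> where "\<Delta> = (\<lambda>i. real (\<sigma> i) - real i)"
  have "\<bar>real_of_int (tmult i p (h + \<sigma> i))\<bar> \<le> \<bar>real_of_int (p h)\<bar> * A powr (real h ^ 2 - (real h + \<Delta> i) ^ 2)"
    for i
  proof (cases "h + \<sigma> i < i")
    case False
    then have shifted: "real (h + \<sigma> i - i) = real h + \<Delta> i" by (simp add: \<Delta>_def of_nat_diff)
    show ?thesis
      using maximal[of "h + \<sigma> i - i", unfolded shifted] False unfolding tmult_def by (simp only: if_False)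
  qed (use A_ge_1 in \<open>simp add: tmult_def\<close>)
  then have "(\<Prod>i = 0..<q. \<bar>real_of_int (tmult i p (h + \<sigma> i))\<bar>)
      \<le> (\<Prod>i = 0..<q. \<bar>real_of_int (p h)\<bar> * A powr (real h ^ 2 - (real h + \<Delta> i) ^ 2))"
    by (intro prod_mono) auto
  also have "\<dots> = \<bar>real_of_int (p h)\<bar> ^ q * A powr (\<Sum>i = 0..<q. real h ^ 2 - (real h + \<Delta> i) ^ 2)"
    using A_ge_1 by (simp add: prod.distrib powr_sum)
  also have "\<dots> = \<bar>real_of_int (p h)\<bar> ^ q * A powr (- 2 * real h * (\<Sum>i = 0..<q. \<Delta> i) - (\<Sum>i = 0..<q. \<Delta> i ^ 2))"
    by (simp add: power2_eq_square ring_distribs sum_subtractf sum.distrib sum_distrib_left sum_negf mult_ac)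
  also have "(\<Sum>i = 0..<q. \<Delta> i) = 0"
    using sum.permute[OF \<sigma>_permutes(1), of real] by (simp add: \<Delta>_def sum_subtractf o_def)
  also have "A powr (- 2 * real h * 0 - (\<Sum>i = 0..<q. \<Delta> i ^ 2)) \<le> A powr (-1)"
  proof (rule powr_mono)
    obtain i where descent: "i < q" "\<sigma> i < i" using permutes_descent[OF \<sigma>_permutes] .
    then have "1 \<le> \<bar>\<Delta> i\<bar>" by (simp add: \<Delta>_def)
    then have "1 \<le> \<Delta> i ^ 2" by (metis abs_le_square_iff abs_one one_power2)
    also have "\<dots> \<le> (\<Sum>i = 0..<q. \<Delta> i ^ 2)" using descent by (intro member_le_sum) auto
    finally show "- 2 * real h * 0 - (\<Sum>i = 0..<q. \<Delta> i ^ 2) \<le> - 1" by simp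
  qed (use A_ge_1 in simp)
  finally have "(\<Prod>i = 0..<q. \<bar>real_of_int (tmult i p (h + \<sigma> i))\<bar>) \<le> \<bar>real_of_int (p h)\<bar> ^ q * A powr (-1)"
    by (simp add: mult_left_mono)
  moreover have "A powr (-1) = 1 / A" using A_ge_1 by (simp add: powr_minus_divide)
  moreover have "\<bar>real_of_int (signof \<sigma>)\<bar> = 1" by (simp add: sign_def)
  ultimately show ?thesis by (simp add: abs_mult abs_prod)
qed

lemma power_le_abs_toeplitz_det:
  fixes A :: real
  assumes A_ge: "2 * fact q \<le> A"
    and maximal: "\<And>j. \<bar>real_of_int (p j)\<bar> \<le> \<bar>real_of_int (p h)\<bar> * A powr (real h ^ 2 - real j ^ 2)"
  shows "\<bar>real_of_int (p h)\<bar> ^ q \<le> 2 * \<bar>real_of_int (toeplitz_det q p h)\<bar>"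
proof -
  let ?P = "{\<sigma>. \<sigma> permutes {0..<q} \<and> \<sigma> \<noteq> id}"
  define rest where "rest = (\<Sum>\<sigma>\<in>?P. signof \<sigma> * (\<Prod>i = 0..<q. tmult i p (h + \<sigma> i)))"
  have A_ge_1: "1 \<le> A" using A_ge fact_ge_1[of q, where 'a = real] by linarith
  have "card ?P \<le> card {\<sigma>. \<sigma> permutes {0..<q}}" by (intro card_mono) (auto simp: finite_permutations)
  also have "\<dots> = fact q" by (rule card_permutations) auto
  finally have card: "real (card ?P) \<le> fact q" by (metis of_nat_fact of_nat_le_iff)
  have "\<bar>real_of_int rest\<bar> \<le> (\<Sum>\<sigma>\<in>?P. \<bar>real_of_int (p h)\<bar> ^ q / A)"
    unfolding rest_def of_int_sum
    by (rule order.trans[OF sum_abs], intro sum_mono) (use abs_toeplitz_summand_le[OF A_ge_1 maximal] in auto)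
  also have "\<dots> = real (card ?P) * (\<bar>real_of_int (p h)\<bar> ^ q / A)" by simp
  also have "\<dots> \<le> A / 2 * (\<bar>real_of_int (p h)\<bar> ^ q / A)"
    using card A_ge A_ge_1 by (intro mult_right_mono) auto
  also have "\<dots> = \<bar>real_of_int (p h)\<bar> ^ q / 2" using A_ge_1 by simp
  finally have small: "\<bar>real_of_int rest\<bar> \<le> \<bar>real_of_int (p h)\<bar> ^ q / 2" .
  have "real_of_int (toeplitz_det q p h) = real_of_int (p h) ^ q + real_of_int rest"
    unfolding toeplitz_det_Leibniz rest_def by simp
  moreover have "\<bar>real_of_int (p h) ^ q\<bar> = \<bar>real_of_int (p h)\<bar> ^ q" by (simp add: power_abs)
  ultimately show ?thesis using small by linarith
qed

lemma exists_weighted_max: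
  fixes A :: real
  assumes A_ge_1: "1 \<le> A" and p_supp: "supp_below (Suc d) p"
  obtains h where "h \<le> d" "\<And>j. \<bar>real_of_int (p j)\<bar> \<le> \<bar>real_of_int (p h)\<bar> * A powr (real h ^ 2 - real j ^ 2)"
proof -
  define g where "g = (\<lambda>j. \<bar>real_of_int (p j)\<bar> * A powr (real j ^ 2))"
  have "Max (g ` {..d}) \<in> g ` {..d}" by (rule Max_in) auto
  then obtain h where h_le: "h \<le> d" "g h = Max (g ` {..d})" by (metis atMost_iff imageE)
  have "\<bar>real_of_int (p j)\<bar> \<le> \<bar>real_of_int (p h)\<bar> * A powr (real h ^ 2 - real j ^ 2)" for j
  proof (cases "j \<le> d")
    case True
    then have "g j \<le> g h" using h_le(2) by simp
    then show ?thesis using A_ge_1 by (simp add: g_def powr_diff field_simps)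
  next
    case False
    then have "p j = 0" using p_supp by (simp add: supp_below_def)
    then show ?thesis using A_ge_1 by simp
  qed
  then show thesis using that h_le(1) by blast
qed

lemma hgt_power_le_toeplitz_det:
  assumes "supp_below (Suc d) p"
  obtains h where "h \<le> d" "hgt (Suc d) p ^ q \<le> height_const d q * \<bar>real_of_int (toeplitz_det q p h)\<bar>"
proof -
  define A :: real where "A = 2 * fact q"
  have A_ge_1: "1 \<le> A" using fact_ge_1[of q, where 'a = real] unfolding A_def by linarith
  obtain h where h_le: "h \<le> d"
    and maximal: "\<And>j. \<bar>real_of_int (p j)\<bar> \<le> \<bar>real_of_int (p h)\<bar> * A powr (real h ^ 2 - real j ^ 2)"
    using exists_weighted_max[OF A_ge_1 assms] by blast
  have "\<bar>real_of_int (p j)\<bar> \<le> \<bar>real_of_int (p h)\<bar> * A ^ d\<^sup>2" for j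
  proof -
    have "real h ^ 2 \<le> real d ^ 2" using h_le by simp
    then have "real h ^ 2 - real j ^ 2 \<le> real d ^ 2" using zero_le_power2[of "real j"] by linarith
    then have "real h ^ 2 - real j ^ 2 \<le> real (d\<^sup>2)" by simp
    then have "A powr (real h ^ 2 - real j ^ 2) \<le> A powr real (d\<^sup>2)" using A_ge_1 by (rule powr_mono)
    also have "\<dots> = A ^ d\<^sup>2" using A_ge_1 by (intro powr_realpow) simp
    finally show ?thesis using maximal[of j] by (meson abs_ge_zero mult_left_mono order_trans)
  qed
  then have "hgt (Suc d) p \<le> (\<Sum>j<Suc d. \<bar>real_of_int (p h)\<bar> * A ^ d\<^sup>2)"
    unfolding hgt_def by (rule sum_mono)
  also have "\<dots> = \<bar>real_of_int (p h)\<bar> * ((real d + 1) * A ^ d\<^sup>2)" by (simp add: algebra_simps)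
  finally have "hgt (Suc d) p ^ q \<le> (\<bar>real_of_int (p h)\<bar> * ((real d + 1) * A ^ d\<^sup>2)) ^ q"
    by (rule power_mono) simp
  also have "\<dots> = \<bar>real_of_int (p h)\<bar> ^ q * ((real d + 1) * A ^ d\<^sup>2) ^ q" by (rule power_mult_distrib)
  also have "\<dots> \<le> (2 * \<bar>real_of_int (toeplitz_det q p h)\<bar>) * ((real d + 1) * A ^ d\<^sup>2) ^ q"
    using A_ge_1 by (intro mult_right_mono power_le_abs_toeplitz_det[OF _ maximal]) (auto simp: A_def)
  also have "\<dots> = height_const d q * \<bar>real_of_int (toeplitz_det q p h)\<bar>" by (simp add: height_const_def A_def)
  finally show thesis using that h_le by blast
qed

lemma det_rows_mat_mult:
  assumes "length rs = N" "length gs = N"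
  shows "det (rows_mat N rs) * det (rows_mat N gs) = det (mat N N (\<lambda>(i, c). dotp N (rs ! i) (gs ! c)))"
proof -
  have "rows_mat N rs * transpose_mat (rows_mat N gs) = mat N N (\<lambda>(i, c). dotp N (rs ! i) (gs ! c))"
    by (rule eq_matI) (auto simp: rows_mat_def scalar_prod_def dotp_def lessThan_atLeast0)
  then show ?thesis
    using det_mult[of "rows_mat N rs" N "transpose_mat (rows_mat N gs)"] det_transpose[of "rows_mat N gs" N]
    by simp
qed

lemma det_rows_mat_append_orth:
  assumes len: "length rs = d" "length us = q" "length xs = d" "length gs = q"
    and gs: "set gs \<subseteq> orth (d + q) (set rs)"
  shows "det (rows_mat (d + q) (rs @ us)) * det (rows_mat (d + q) (xs @ gs)) =
    det (mat d d (\<lambda>(i, c). dotp (d + q) (rs ! i) (xs ! c))) * det (mat q q (\<lambda>(i, c). dotp (d + q) (us ! i) (gs ! c)))"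
proof -
  let ?A = "mat d d (\<lambda>(i, c). dotp (d + q) (rs ! i) (xs ! c))"
  let ?C = "mat q d (\<lambda>(i, c). dotp (d + q) (us ! i) (xs ! c))"
  let ?D = "mat q q (\<lambda>(i, c). dotp (d + q) (us ! i) (gs ! c))"
  have "dotp (d + q) (rs ! i) (gs ! c) = 0" if "i < d" "c < q" for i c
    using gs len that by (intro orthD[of "gs ! c"]) auto
  then have "mat (d + q) (d + q) (\<lambda>(i, c). dotp (d + q) ((rs @ us) ! i) ((xs @ gs) ! c)) = four_block_mat ?A (0\<^sub>m d q) ?C ?D"
    by (intro eq_matI) (auto simp: nth_append len)
  moreover have "det (four_block_mat ?A (0\<^sub>m d q) ?C ?D) = det ?A * det ?D"
    by (rule det_four_block_mat_upper_right_zero[of _ d _ q]) auto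
  ultimately show ?thesis using det_rows_mat_mult[of "rs @ us" "d + q" "xs @ gs"] len by simp
qed

lemma det_unit_rows_proportional:
  assumes len: "length rs = d" and p_supp: "supp_below (Suc d) p" "nonzero_below (Suc d) p"
    and span: "orth (d + q) (set rs) = rat_span (d + q) (set (tmults q p))"
  obtains z w where "z \<noteq> 0" "w \<noteq> 0"
    "\<And>h. h \<le> d \<Longrightarrow> det (rows_mat (d + q) (rs @ unit_rows h q)) * z = w * toeplitz_det q p h"
proof -
  define gs where "gs = tmults q p"
  define gram where "gram = det (mat d d (\<lambda>(i, c). dotp (d + q) (rs ! i) (rs ! c)))"
  define z where "z = det (rows_mat (d + q) (rs @ gs))"
  have lgs: "length gs = q" by (simp add: gs_def)
  have subset_orth: "set gs \<subseteq> orth (d + q) (set rs)" using span subset_rat_span by (simp add: gs_def)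
  have "z \<noteq> 0"
    using rat_span_orth_eq_0[of _ "d + q" "set gs"] span len lgs
    by (auto simp: z_def gs_def det_rows_mat_eq_0_iff orth_Un)
  then have "gram \<noteq> 0"
    using det_rows_mat_append_orth[OF len lgs len lgs subset_orth] by (auto simp: gram_def z_def)
  moreover have "det (rows_mat (d + q) (rs @ unit_rows h q)) * z = gram * toeplitz_det q p h"
    if h_le: "h \<le> d" for h
  proof -
    let ?T = "mat q q (\<lambda>(i, j). tmult i p (h + j))"
    have "mat q q (\<lambda>(i, c). dotp (d + q) (unit_rows h q ! i) (gs ! c)) = transpose_mat ?T"
      using h_le by (intro eq_matI) (auto simp: gs_def dotp_unit_row)
    then show ?thesis
      using det_rows_mat_append_orth[OF len _ len lgs subset_orth, of "unit_rows h q"] det_transpose[of ?T q]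
      by (simp add: z_def gram_def toeplitz_det_def)
  qed
  ultimately show thesis using that \<open>z \<noteq> 0\<close> by blast
qed

text \<open>
  The minors of \<open>rs\<close> on \<open>q\<close> consecutive columns are proportional to the Toeplitz minors of \<open>p\<close>, and the
  latter are coprime, so each of them divides the corresponding minor of \<open>rs\<close>.
\<close>

lemma hgt_power_le_det:
  assumes p_primitive: "primitive p" "supp_below (Suc d) p" and len: "length rs = d"
    and span: "orth (d + q) (set rs) = rat_span (d + q) (set (tmults q p))"
  obtains h where "h \<le> d"
    "hgt (Suc d) p ^ q \<le> height_const d q * \<bar>real_of_int (det (rows_mat (d + q) (rs @ unit_rows h q)))\<bar>"
proof -
  let ?minor = "\<lambda>h. det (rows_mat (d + q) (rs @ unit_rows h q))"
  let ?T = "toeplitz_det q p"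
  obtain h where h_le: "h \<le> d" "hgt (Suc d) p ^ q \<le> height_const d q * \<bar>real_of_int (?T h)\<bar>"
    using hgt_power_le_toeplitz_det[OF p_primitive(2)] by blast
  have "0 < hgt (Suc d) p ^ q" using hgt_pos[OF p_primitive] by simp
  then have T_nonzero: "?T h \<noteq> 0" using h_le(2) by auto
  obtain z w where z_nonzero: "z \<noteq> 0" and w_nonzero: "w \<noteq> 0"
    and proportional: "\<And>h. h \<le> d \<Longrightarrow> ?minor h * z = w * ?T h"
    by (rule det_unit_rows_proportional[OF len p_primitive(2) primitive_nonzero[OF p_primitive] span]) blast
  have minor: "?minor h \<noteq> 0" using proportional[OF h_le(1)] w_nonzero T_nonzero by auto
  have "?minor h * ?T h' = ?minor h' * ?T h" if "h' \<le> d" for h'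
  proof -
    have "z * (?minor h * ?T h') = z * (?minor h' * ?T h)"
      using proportional[OF h_le(1)] proportional[OF that] by (metis mult.assoc mult.commute)
    then show ?thesis using z_nonzero by simp
  qed
  then have "?T h dvd Gcd ((*) (?minor h) ` (?T ` {..d}))" by (intro Gcd_greatest) auto
  then have "?T h dvd ?minor h" by (simp add: Gcd_mult Gcd_toeplitz_det[OF p_primitive])
  then have "\<bar>?T h\<bar> \<le> \<bar>?minor h\<bar>" using minor by (simp add: dvd_imp_le_int)
  then have "height_const d q * \<bar>real_of_int (?T h)\<bar> \<le> height_const d q * \<bar>real_of_int (?minor h)\<bar>"
    using height_const_ge_1[of d q] by (intro mult_left_mono) linarith+
  then show thesis using that h_le by (meson order_trans)
qed

section \<open>Determinants with rows close to a curve\<close>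

definition poly_value :: "nat \<Rightarrow> (nat \<Rightarrow> int) \<Rightarrow> real \<Rightarrow> real" where
  "poly_value N p \<xi> = (\<Sum>j<N. real_of_int (p j) * \<xi> ^ j)"

definition no_int_root :: "nat \<Rightarrow> real \<Rightarrow> bool" where
  "no_int_root n \<xi> \<longleftrightarrow> (\<forall>p. nonzero_below (n + 1) p \<longrightarrow> poly_value (n + 1) p \<xi> \<noteq> 0)"

definition near_curve :: "nat \<Rightarrow> real \<Rightarrow> (nat \<Rightarrow> int) \<Rightarrow> real \<Rightarrow> bool" where
  "near_curve n \<xi> x L \<longleftrightarrow> (\<forall>i\<le>n. \<bar>real_of_int (x i) - real_of_int (x 0) * \<xi> ^ i\<bar> \<le> L)"

definition near_row :: "nat \<Rightarrow> real \<Rightarrow> real \<Rightarrow> (nat \<Rightarrow> real) \<Rightarrow> real \<Rightarrow> bool" where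
  "near_row N \<xi> Q w e \<longleftrightarrow> 0 \<le> e \<and> \<bar>w 0\<bar> \<le> Q * e \<and> (\<forall>j<N. \<bar>w j - \<xi> ^ j * w 0\<bar> \<le> e)"

definition comb_shift :: "nat \<Rightarrow> (nat \<Rightarrow> int) \<Rightarrow> (nat \<Rightarrow> int) \<Rightarrow> nat \<Rightarrow> int" where
  "comb_shift R r v = (\<lambda>j. \<Sum>k<R. r k * v (k + j))"

definition generic_rows :: "nat \<Rightarrow> (nat \<Rightarrow> int) set" where
  "generic_rows R = unit_row ` {..<R} \<union> {\<lambda>k. unit_row i k + unit_row j k | i j. i < R \<and> j < R \<and> i \<noteq> j}"

definition gap :: "nat \<Rightarrow> real \<Rightarrow> real" where
  "gap n \<xi> = (MIN r\<in>generic_rows (n + 1). \<bar>poly_value (n + 1) r \<xi>\<bar>)"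

definition power_bound :: "nat \<Rightarrow> real \<Rightarrow> real" where
  "power_bound n \<xi> = (1 + \<bar>\<xi>\<bar>) ^ n"

definition row_const :: "nat \<Rightarrow> real \<Rightarrow> real" where
  "row_const n \<xi> = (real n + 1) * (1 + power_bound n \<xi>)\<^sup>2 * (1 + 1 / gap n \<xi>)"

definition det_const :: "nat \<Rightarrow> real \<Rightarrow> real" where
  "det_const n \<xi> = fact (n + 1) * row_const n \<xi> ^ (n + 1)"

lemma poly_value_eq_of_supp: "supp_below N p \<Longrightarrow> N \<le> N' \<Longrightarrow> poly_value N' p \<xi> = poly_value N p \<xi>"
  unfolding poly_value_def by (rule sum.mono_neutral_right) (auto simp: supp_below_def)

lemma poly_value_nonzero:
  assumes "no_int_root n \<xi>" "nonzero_below N p" "N \<le> n + 1"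
  shows "poly_value N p \<xi> \<noteq> 0"
proof -
  have "nonzero_below (n + 1) (trunc N p)" using assms(2,3) by (auto simp: nonzero_below_def trunc_def)
  then have "poly_value (n + 1) (trunc N p) \<xi> \<noteq> 0" using assms(1) by (simp add: no_int_root_def)
  moreover have "poly_value N (trunc N p) \<xi> = poly_value N p \<xi>" by (simp add: poly_value_def trunc_def)
  ultimately show ?thesis using poly_value_eq_of_supp[of N "trunc N p" "n + 1" \<xi>] assms(3) by simp
qed

lemma near_curve_mono: "near_curve n \<xi> x L \<Longrightarrow> L \<le> L' \<Longrightarrow> near_curve n \<xi> x L'"
  unfolding near_curve_def by (meson order_trans)

lemma near_curve_nonneg: "near_curve n \<xi> x L \<Longrightarrow> 0 \<le> L"
  unfolding near_curve_def by (elim allE[of _ 0]) auto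

lemma near_row_mono: "near_row N \<xi> Q w e \<Longrightarrow> e \<le> e' \<Longrightarrow> 0 \<le> Q \<Longrightarrow> near_row N \<xi> Q w e'"
  unfolding near_row_def by (meson mult_left_mono order_trans)

lemma power_bound_ge_1: "1 \<le> power_bound n \<xi>"
  unfolding power_bound_def by (rule one_le_power) auto

lemma abs_power_le_power_bound: "k \<le> n \<Longrightarrow> \<bar>\<xi> ^ k\<bar> \<le> power_bound n \<xi>"
  unfolding power_bound_def power_abs by (rule order.trans[OF power_mono power_increasing]) auto

lemma generic_rows_cases:
  assumes "r \<in> generic_rows R"
  obtains i where "i < R" "r = unit_row i"
  | i j where "i < R" "j < R" "i \<noteq> j" "r = (\<lambda>k. unit_row i k + unit_row j k)"
  using assms by (auto simp: generic_rows_def)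

lemma unit_row_in_generic_rows: "i < R \<Longrightarrow> unit_row i \<in> generic_rows R"
  by (simp add: generic_rows_def)

lemma generic_rows_mono: "R \<le> R' \<Longrightarrow> generic_rows R \<subseteq> generic_rows R'"
  by (force simp: generic_rows_def)

lemma generic_row_coeff_le: "r \<in> generic_rows R \<Longrightarrow> \<bar>r k\<bar> \<le> 1"
  by (erule generic_rows_cases) (auto simp: unit_row_def)

lemma supp_below_generic_row: "r \<in> generic_rows R \<Longrightarrow> supp_below R r"
  by (erule generic_rows_cases) (auto simp: unit_row_def supp_below_def)

lemma nonzero_below_generic_row: "r \<in> generic_rows R \<Longrightarrow> nonzero_below R r"
  unfolding nonzero_below_def by (erule generic_rows_cases) (auto simp: unit_row_def)

lemma finite_generic_rows: "finite (generic_rows R)"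
proof -
  have "generic_rows R \<subseteq> unit_row ` {..<R} \<union> (\<lambda>(i, j) k. unit_row i k + unit_row j k) ` ({..<R} \<times> {..<R})"
    by (auto simp: generic_rows_def image_iff)
  then show ?thesis by (rule finite_subset) simp
qed

lemma gap_le:
  assumes "r \<in> generic_rows R" "R \<le> n + 1"
  shows "gap n \<xi> \<le> \<bar>poly_value R r \<xi>\<bar>"
proof -
  have "r \<in> generic_rows (n + 1)" using assms generic_rows_mono by blast
  then have "gap n \<xi> \<le> \<bar>poly_value (n + 1) r \<xi>\<bar>" unfolding gap_def by (simp add: finite_generic_rows)
  then show ?thesis using poly_value_eq_of_supp[OF supp_below_generic_row[OF assms(1)] assms(2)] by simp
qed

lemma gap_attained: "\<exists>r\<in>generic_rows (n + 1). gap n \<xi> = \<bar>poly_value (n + 1) r \<xi>\<bar>"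
proof -
  have "unit_row 0 \<in> generic_rows (n + 1)" by (rule unit_row_in_generic_rows) simp
  then have "gap n \<xi> \<in> (\<lambda>r. \<bar>poly_value (n + 1) r \<xi>\<bar>) ` generic_rows (n + 1)"
    unfolding gap_def by (intro Min_in) (auto simp: finite_generic_rows)
  then show ?thesis by blast
qed

lemma gap_nonneg: "0 \<le> gap n \<xi>"
  using gap_attained[of n \<xi>] by auto

lemma gap_pos: "no_int_root n \<xi> \<Longrightarrow> 0 < gap n \<xi>"
  using gap_attained[of n \<xi>] nonzero_below_generic_row by (auto simp: no_int_root_def)

lemma row_const_ge:
  "(real n + 1) * (1 + power_bound n \<xi>) \<le> row_const n \<xi>"
  "(1 + power_bound n \<xi>) * (1 + power_bound n \<xi> / gap n \<xi> * (real n + 1)) \<le> row_const n \<xi>"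
proof -
  define \<beta> where "\<beta> = power_bound n \<xi>"
  define g where "g = 1 / gap n \<xi>"
  have \<beta>_bounds: "1 \<le> \<beta>" and g_nonneg: "0 \<le> g" using power_bound_ge_1 gap_nonneg by (auto simp: \<beta>_def g_def)
  have row_const_eq: "row_const n \<xi> = (real n + 1) * ((1 + \<beta>) * ((1 + \<beta>) * (1 + g)))"
    by (simp add: row_const_def \<beta>_def g_def power2_eq_square)
  have "1 * 1 \<le> (1 + \<beta>) * (1 + g)" using \<beta>_bounds g_nonneg by (intro mult_mono) auto
  then have "(1 + \<beta>) * 1 \<le> (1 + \<beta>) * ((1 + \<beta>) * (1 + g))" using \<beta>_bounds by (intro mult_left_mono) auto
  then show "(real n + 1) * (1 + power_bound n \<xi>) \<le> row_const n \<xi>"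
    unfolding row_const_eq \<beta>_def[symmetric] by (intro mult_left_mono) auto
  have "1 + \<beta> * g * (real n + 1) \<le> (real n + 1) * ((1 + \<beta>) * (1 + g))"
    using \<beta>_bounds g_nonneg by (simp add: algebra_simps)
  then have "(1 + \<beta>) * (1 + \<beta> * g * (real n + 1)) \<le> (1 + \<beta>) * ((real n + 1) * ((1 + \<beta>) * (1 + g)))"
    using \<beta>_bounds by (intro mult_left_mono) auto
  then show "(1 + power_bound n \<xi>) * (1 + power_bound n \<xi> / gap n \<xi> * (real n + 1)) \<le> row_const n \<xi>"
    unfolding row_const_eq by (simp add: \<beta>_def g_def mult_ac)
qed

lemma row_const_ge_power_bound: "1 + power_bound n \<xi> \<le> row_const n \<xi>"
proof -
  have "1 * (1 + power_bound n \<xi>) \<le> (real n + 1) * (1 + power_bound n \<xi>)"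
    using power_bound_ge_1[of n \<xi>] by (intro mult_right_mono) auto
  then show ?thesis using row_const_ge(1)[of n \<xi>] by simp
qed

lemma row_const_ge_1: "1 \<le> row_const n \<xi>"
  using row_const_ge_power_bound[of n \<xi>] power_bound_ge_1[of n \<xi>] by linarith

lemma row_const_le_det_const: "row_const n \<xi> \<le> det_const n \<xi>"
proof -
  have "row_const n \<xi> ^ 1 \<le> row_const n \<xi> ^ (n + 1)" by (intro power_increasing row_const_ge_1) simp
  also have "1 * \<dots> \<le> det_const n \<xi>"
    unfolding det_const_def using row_const_ge_1[of n \<xi>] by (intro mult_right_mono fact_ge_1) simp
  finally show ?thesis by simp
qed

lemma comb_shift_unit_row: "k < R \<Longrightarrow> comb_shift R (unit_row k) v = shift k v"
  using sum_unit_row[of k R "\<lambda>i. v (i + _)"] by (auto simp: comb_shift_def shift_def)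

lemma dotp_comb_shift: "dotp N (comb_shift R r v) p = (\<Sum>k<R. r k * dotp N (shift k v) p)"
proof -
  have "comb_shift R r v = (\<lambda>j. \<Sum>k<R. r k * shift k v j)" by (simp add: comb_shift_def shift_def)
  then show ?thesis by (simp add: dotp_sum_left)
qed

lemma abs_det_le:
  fixes B :: "real mat"
  assumes B_carrier: "B \<in> carrier_mat N N"
    and entry: "\<And>i j. i < N \<Longrightarrow> j < N \<Longrightarrow> \<bar>B $$ (i, j)\<bar> \<le> E i * F j"
  shows "\<bar>det B\<bar> \<le> fact N * (\<Prod>i<N. E i) * (\<Prod>j<N. F j)"
proof -
  have "\<bar>det B\<bar> \<le> (\<Sum>\<sigma> | \<sigma> permutes {0..<N}. \<bar>signof \<sigma> * (\<Prod>i = 0..<N. B $$ (i, \<sigma> i))\<bar>)"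
    unfolding det_def'[OF B_carrier] by (rule sum_abs)
  also have "\<dots> \<le> (\<Sum>\<sigma> | \<sigma> permutes {0..<N}. (\<Prod>i<N. E i) * (\<Prod>j<N. F j))"
  proof (rule sum_mono)
    fix \<sigma> assume "\<sigma> \<in> {\<sigma>. \<sigma> permutes {0..<N}}"
    then have \<sigma>_permutes: "\<sigma> permutes {0..<N}" by simp
    have "\<bar>signof \<sigma> * (\<Prod>i = 0..<N. B $$ (i, \<sigma> i))\<bar> = (\<Prod>i = 0..<N. \<bar>B $$ (i, \<sigma> i)\<bar>)"
      by (simp add: abs_mult abs_prod sign_def)
    also have "\<dots> \<le> (\<Prod>i = 0..<N. E i * F (\<sigma> i))"
      using entry permutes_in_image[OF \<sigma>_permutes] by (intro prod_mono) auto
    also have "\<dots> = (\<Prod>i = 0..<N. E i) * (\<Prod>i = 0..<N. F (\<sigma> i))"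
      by (rule prod.distrib)
    also have "(\<Prod>i = 0..<N. F (\<sigma> i)) = (\<Prod>i = 0..<N. F i)"
      using prod.permute[OF \<sigma>_permutes, of F] by (simp add: o_def)
    finally show "\<bar>signof \<sigma> * (\<Prod>i = 0..<N. B $$ (i, \<sigma> i))\<bar> \<le> (\<Prod>i<N. E i) * (\<Prod>j<N. F j)"
      by (simp add: lessThan_atLeast0)
  qed
  also have "\<dots> = fact N * (\<Prod>i<N. E i) * (\<Prod>j<N. F j)"
    by (simp add: card_permutations)
  finally show ?thesis .
qed

lemma det_row_operations:
  fixes A :: "'a::comm_ring_1 mat"
  assumes A_carrier: "A \<in> carrier_mat N N"
  shows "det (mat N N (\<lambda>(i, j). A $$ (i, j) + (\<Sum>l<i. e i l * A $$ (l, j)))) = det A"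
proof -
  define L where "L = mat N N (\<lambda>(i, l). if l = i then 1 else if l < i then e i l else 0)"
  have L_carrier: "L \<in> carrier_mat N N" by (simp add: L_def)
  have "det L = prod_list (diag_mat L)"
    by (rule det_lower_triangular[OF _ L_carrier]) (auto simp: L_def)
  also have "\<dots> = 1" by (auto simp: prod_list_diag_prod L_def intro!: prod.neutral)
  finally have "det (L * A) = det A" using det_mult[OF L_carrier A_carrier] by simp
  moreover have "L * A = mat N N (\<lambda>(i, j). A $$ (i, j) + (\<Sum>l<i. e i l * A $$ (l, j)))"
  proof (rule eq_matI; clarsimp)
    fix i j assume ij: "i < N" "j < N"
    have "(L * A) $$ (i, j) = (\<Sum>l = 0..<N. (if l = i then 1 else if l < i then e i l else 0) * A $$ (l, j))"
      using ij A_carrier by (auto simp: L_def scalar_prod_def intro!: sum.cong)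
    also have "\<dots> = (\<Sum>l \<in> {0..<Suc i}. (if l = i then 1 else if l < i then e i l else 0) * A $$ (l, j))"
      using ij by (intro sum.mono_neutral_right) auto
    finally show "(L * A) $$ (i, j) = A $$ (i, j) + (\<Sum>l<i. e i l * A $$ (l, j))"
      by (simp add: lessThan_atLeast0)
  qed (use A_carrier in \<open>auto simp: L_def\<close>)
  ultimately show ?thesis by simp
qed

lemma det_eliminate_first_column:
  fixes A :: "'a::comm_ring_1 mat"
  assumes A_carrier: "A \<in> carrier_mat N N"
  shows "det (mat N N (\<lambda>(i, j). if j = 0 then A $$ (i, 0) else A $$ (i, j) - c j * A $$ (i, 0))) = det A"
proof -
  let ?e = "\<lambda>j l. if l = 0 then - c j else 0"
  let ?M = "mat N N (\<lambda>(j, i). transpose_mat A $$ (j, i) + (\<Sum>l<j. ?e j l * transpose_mat A $$ (l, i)))"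
  have "mat N N (\<lambda>(i, j). if j = 0 then A $$ (i, 0) else A $$ (i, j) - c j * A $$ (i, 0)) = transpose_mat ?M"
    using A_carrier by (intro eq_matI) (auto simp: if_distrib[of "\<lambda>x. x * _"] cong: if_cong)
  moreover have "det ?M = det (transpose_mat A)" using A_carrier by (intro det_row_operations) simp
  ultimately show ?thesis using det_transpose[OF A_carrier] det_transpose[of ?M N] by simp
qed

text \<open>
  Rows close to multiples of \<open>(1, \<xi>, \<xi>\<^sup>2, \<dots>)\<close> contribute their distance to that line, apart from one
  row contributing its full size; \<open>Q\<close> bounds the quotient of the two.
\<close>

lemma abs_det_near_rows_le:
  fixes A :: "real mat"
  assumes A_carrier: "A \<in> carrier_mat N N" and N_bounds: "1 \<le> N"
    and near: "\<And>i. i < N \<Longrightarrow> near_row N \<xi> Q (\<lambda>j. A $$ (i, j)) (E i)"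
  shows "\<bar>det A\<bar> \<le> fact N * Q * (\<Prod>i<N. E i)"
proof -
  define B where "B = mat N N (\<lambda>(i, j). if j = 0 then A $$ (i, 0) else A $$ (i, j) - \<xi> ^ j * A $$ (i, 0))"
  have "\<bar>det B\<bar> \<le> fact N * (\<Prod>i<N. E i) * (\<Prod>j<N. if j = 0 then Q else 1)"
    by (rule abs_det_le) (use near in \<open>auto simp: B_def near_row_def mult.commute\<close>)
  moreover have "(\<Prod>j<N. if j = 0 then Q else 1) = Q" using N_bounds by (subst prod.delta) auto
  ultimately show ?thesis using det_eliminate_first_column[OF A_carrier] by (simp add: B_def mult_ac)
qed

lemma near_row_of_small:
  assumes small: "\<And>j. j < N \<Longrightarrow> \<bar>w j\<bar> \<le> e" and N_bounds: "1 \<le> N" "N \<le> n + 1" and Q_ge_1: "1 \<le> Q"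
  shows "near_row N \<xi> Q w ((1 + power_bound n \<xi>) * e)"
proof -
  define \<beta> where "\<beta> = power_bound n \<xi>"
  have \<beta>_bounds: "1 \<le> \<beta>" "\<And>j. j < N \<Longrightarrow> \<bar>\<xi> ^ j\<bar> \<le> \<beta>"
    using N_bounds power_bound_ge_1 abs_power_le_power_bound by (auto simp: \<beta>_def)
  have e_bounds: "0 \<le> e" "\<bar>w 0\<bar> \<le> e" using small[of 0] N_bounds by auto
  have "e \<le> (1 + \<beta>) * e" using \<beta>_bounds(1) e_bounds by (simp add: algebra_simps)
  also have "\<dots> \<le> Q * ((1 + \<beta>) * e)"
    using mult_right_mono[OF Q_ge_1, of "(1 + \<beta>) * e"] \<beta>_bounds(1) e_bounds by simp
  finally have "\<bar>w 0\<bar> \<le> Q * ((1 + \<beta>) * e)" using e_bounds by linarith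
  moreover have "\<bar>w j - \<xi> ^ j * w 0\<bar> \<le> (1 + \<beta>) * e" if j_less: "j < N" for j
  proof -
    have "\<bar>w j - \<xi> ^ j * w 0\<bar> \<le> \<bar>w j\<bar> + \<bar>\<xi> ^ j\<bar> * \<bar>w 0\<bar>" by (metis abs_mult abs_triangle_ineq4)
    also have "\<dots> \<le> e + \<beta> * e" using small \<beta>_bounds j_less e_bounds by (intro add_mono mult_mono) auto
    finally show ?thesis by (simp add: algebra_simps)
  qed
  ultimately show ?thesis using \<beta>_bounds(1) e_bounds by (simp add: near_row_def \<beta>_def)
qed

lemma near_row_unit_row:
  assumes "1 \<le> N" "N \<le> n + 1" "1 \<le> Q"
  shows "near_row N \<xi> Q (\<lambda>j. real_of_int (unit_row h j)) (row_const n \<xi>)"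
proof (rule near_row_mono)
  show "near_row N \<xi> Q (\<lambda>j. real_of_int (unit_row h j)) ((1 + power_bound n \<xi>) * 1)"
    by (rule near_row_of_small) (use assms in \<open>auto simp: unit_row_def\<close>)
qed (use assms row_const_ge_power_bound in auto)

lemma abs_sum_unit_coeffs_le:
  fixes f :: "nat \<Rightarrow> real"
  assumes "\<And>k. \<bar>r k\<bar> \<le> 1" "\<And>k. k < R \<Longrightarrow> \<bar>f k\<bar> \<le> B" "R \<le> n + 1" "0 \<le> B"
  shows "\<bar>\<Sum>k<R. real_of_int (r k) * f k\<bar> \<le> (real n + 1) * B"
proof -
  have "\<bar>real_of_int (r k) * f k\<bar> \<le> 1 * B" if "k < R" for k
    unfolding abs_mult
    using assms(1)[of k] assms(2)[OF that] by (intro mult_mono) (auto simp flip: of_int_abs)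
  then have "\<bar>\<Sum>k<R. real_of_int (r k) * f k\<bar> \<le> (\<Sum>k<R. B)"
    by (intro order.trans[OF sum_abs] sum_mono) simp
  also have "\<dots> \<le> (real n + 1) * B" using assms(3,4) by (simp add: mult_right_mono)
  finally show ?thesis .
qed

lemma near_curve_comb_shift_diff:
  assumes near: "near_curve n \<xi> v L" and R_le: "R + N \<le> n + 2" "r \<in> generic_rows R" and j_less: "j < N"
  shows "\<bar>real_of_int (comb_shift R r v j) - \<xi> ^ j * real_of_int (comb_shift R r v 0)\<bar>
    \<le> (real n + 1) * ((1 + power_bound n \<xi>) * L)"
proof -
  define \<beta> where "\<beta> = power_bound n \<xi>"
  define err where "err = (\<lambda>l. real_of_int (v l) - real_of_int (v 0) * \<xi> ^ l)"
  have err: "\<bar>err l\<bar> \<le> L" if "l \<le> n" for l using near that by (simp add: near_curve_def err_def)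
  have L_nonneg: "0 \<le> L" by (rule near_curve_nonneg[OF near])
  have \<beta>_bounds: "1 \<le> \<beta>" "\<bar>\<xi> ^ j\<bar> \<le> \<beta>"
    using power_bound_ge_1 abs_power_le_power_bound[of j n \<xi>] R_le(1) j_less nonzero_below_generic_row[OF R_le(2)]
    by (auto simp: \<beta>_def nonzero_below_def)
  have "real_of_int (comb_shift R r v j) - \<xi> ^ j * real_of_int (comb_shift R r v 0)
      = (\<Sum>k<R. real_of_int (r k) * (err (k + j) - \<xi> ^ j * err k))"
    unfolding comb_shift_def of_int_sum sum_distrib_left sum_subtractf[symmetric]
    by (intro sum.cong) (auto simp: err_def algebra_simps power_add)
  also have "\<bar>\<dots>\<bar> \<le> (real n + 1) * ((1 + \<beta>) * L)"
  proof (rule abs_sum_unit_coeffs_le)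
    fix k assume k_less: "k < R"
    have "\<bar>err (k + j) - \<xi> ^ j * err k\<bar> \<le> \<bar>err (k + j)\<bar> + \<bar>\<xi> ^ j\<bar> * \<bar>err k\<bar>"
      by (metis abs_mult abs_triangle_ineq4)
    also have "\<dots> \<le> L + \<beta> * L"
      using err \<beta>_bounds L_nonneg R_le(1) j_less k_less by (intro add_mono mult_mono) auto
    finally show "\<bar>err (k + j) - \<xi> ^ j * err k\<bar> \<le> (1 + \<beta>) * L" by (simp add: algebra_simps)
  qed (use generic_row_coeff_le[OF R_le(2)] R_le(1) j_less L_nonneg \<beta>_bounds in auto)
  finally show ?thesis by (simp add: \<beta>_def)
qed

lemma near_row_comb_shift:
  assumes near: "near_curve n \<xi> v L" and v0_le: "\<bar>real_of_int (v 0)\<bar> \<le> Q * L"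
    and R_le: "R + N \<le> n + 2" "r \<in> generic_rows R" and N_bounds: "1 \<le> N" and Q_ge_1: "1 \<le> Q"
  shows "near_row N \<xi> Q (\<lambda>j. real_of_int (comb_shift R r v j)) (row_const n \<xi> * L)"
proof -
  define \<beta> where "\<beta> = power_bound n \<xi>"
  have L_nonneg: "0 \<le> L" by (rule near_curve_nonneg[OF near])
  have "\<bar>\<Sum>k<R. real_of_int (r k) * real_of_int (v k)\<bar> \<le> (real n + 1) * (Q * ((1 + \<beta>) * L))"
  proof (rule abs_sum_unit_coeffs_le)
    fix k assume k_less: "k < R"
    have \<beta>_bounds: "1 \<le> \<beta>" "\<bar>\<xi> ^ k\<bar> \<le> \<beta>"
      using power_bound_ge_1 abs_power_le_power_bound[of k n \<xi>] k_less R_le(1) N_bounds by (auto simp: \<beta>_def)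
    have "\<bar>real_of_int (v k) - real_of_int (v 0) * \<xi> ^ k\<bar> \<le> L"
      using near k_less R_le(1) N_bounds by (simp add: near_curve_def)
    then have "\<bar>real_of_int (v k)\<bar> \<le> \<bar>real_of_int (v 0)\<bar> * \<bar>\<xi> ^ k\<bar> + L"
      unfolding abs_mult[symmetric] by linarith
    also have "\<dots> \<le> Q * L * \<beta> + 1 * L"
      using v0_le \<beta>_bounds L_nonneg Q_ge_1 by (intro add_mono mult_mono) auto
    also have "\<dots> \<le> Q * L * \<beta> + Q * L" using Q_ge_1 L_nonneg by (intro add_left_mono mult_right_mono)
    finally show "\<bar>real_of_int (v k)\<bar> \<le> Q * ((1 + \<beta>) * L)" by (simp add: algebra_simps)
  qed (use generic_row_coeff_le[OF R_le(2)] R_le(1) N_bounds L_nonneg Q_ge_1 power_bound_ge_1[of n \<xi>] in \<open>auto simp: \<beta>_def\<close>)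
  then have "\<bar>real_of_int (comb_shift R r v 0)\<bar> \<le> Q * ((real n + 1) * ((1 + \<beta>) * L))"
    by (simp add: comb_shift_def mult_ac)
  moreover have "0 \<le> (real n + 1) * ((1 + \<beta>) * L)"
    using L_nonneg power_bound_ge_1[of n \<xi>] by (simp add: \<beta>_def)
  ultimately have "near_row N \<xi> Q (\<lambda>j. real_of_int (comb_shift R r v j)) ((real n + 1) * ((1 + \<beta>) * L))"
    using near_curve_comb_shift_diff[OF near R_le] by (simp add: near_row_def \<beta>_def)
  then show ?thesis
  proof (rule near_row_mono)
    show "(real n + 1) * ((1 + \<beta>) * L) \<le> row_const n \<xi> * L"
      using mult_right_mono[OF row_const_ge(1) L_nonneg] by (simp add: \<beta>_def mult_ac)
  qed (use Q_ge_1 in simp)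
qed

lemma near_row_shift:
  assumes "near_curve n \<xi> v L" "\<bar>real_of_int (v 0)\<bar> \<le> Q * L" "k + N \<le> n + 1" "1 \<le> N" "1 \<le> Q"
  shows "near_row N \<xi> Q (\<lambda>j. real_of_int (shift k v j)) (row_const n \<xi> * L)"
  using near_row_comb_shift[OF assms(1,2), of "Suc k" N "unit_row k"] assms(3-)
  by (simp add: comb_shift_unit_row unit_row_in_generic_rows)

text \<open>Subtracting the right multiple of \<open>comb_shift R r y\<close> removes the component along the curve.\<close>

lemma abs_reduced_shift_le:
  assumes near: "near_curve n \<xi> y M" and R_le: "R + N \<le> n + 2" "r \<in> generic_rows R"
    and k_le: "k + N \<le> n + 1" and gap: "0 < gap n \<xi>" and j_less: "j < N"
  shows "\<bar>real_of_int (shift k y j) - \<xi> ^ k / poly_value R r \<xi> * real_of_int (comb_shift R r y j)\<bar>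
    \<le> (1 + power_bound n \<xi> / gap n \<xi> * (real n + 1)) * M"
proof -
  define \<beta> where "\<beta> = power_bound n \<xi>"
  define \<rho> where "\<rho> = poly_value R r \<xi>"
  define err where "err = (\<lambda>l. real_of_int (y l) - real_of_int (y 0) * \<xi> ^ l)"
  define \<sigma> where "\<sigma> = (\<Sum>l<R. real_of_int (r l) * err (l + j))"
  have err: "\<bar>err l\<bar> \<le> M" if "l \<le> n" for l using near that by (simp add: near_curve_def err_def)
  have M_nonneg: "0 \<le> M" by (rule near_curve_nonneg[OF near])
  have \<beta>_bounds: "1 \<le> \<beta>" "\<bar>\<xi> ^ k\<bar> \<le> \<beta>"
    using power_bound_ge_1 abs_power_le_power_bound[of k n \<xi>] k_le j_less by (auto simp: \<beta>_def)
  have \<rho>_ge: "gap n \<xi> \<le> \<bar>\<rho>\<bar>" unfolding \<rho>_def by (rule gap_le) (use R_le j_less in auto)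
  then have "\<rho> \<noteq> 0" using gap by auto
  have "real_of_int (comb_shift R r y j) = \<sigma> + real_of_int (y 0) * \<xi> ^ j * \<rho>"
    unfolding \<sigma>_def \<rho>_def poly_value_def comb_shift_def sum_distrib_left of_int_sum sum.distrib[symmetric]
    by (intro sum.cong) (auto simp: err_def power_add algebra_simps)
  moreover have "\<xi> ^ k / \<rho> * (real_of_int (y 0) * \<xi> ^ j * \<rho>) = real_of_int (y 0) * \<xi> ^ (k + j)"
    using \<open>\<rho> \<noteq> 0\<close> by (simp add: power_add)
  ultimately have cancel: "real_of_int (shift k y j) - \<xi> ^ k / \<rho> * real_of_int (comb_shift R r y j) =
      err (k + j) - \<xi> ^ k / \<rho> * \<sigma>"
    by (simp only: err_def shift_def distrib_left diff_diff_eq add.commute)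
  have "\<bar>\<sigma>\<bar> \<le> (real n + 1) * M"
    unfolding \<sigma>_def
    by (rule abs_sum_unit_coeffs_le) (use generic_row_coeff_le[OF R_le(2)] err R_le(1) j_less M_nonneg in auto)
  moreover have "\<bar>\<xi> ^ k / \<rho>\<bar> \<le> \<beta> / gap n \<xi>"
    unfolding abs_divide using \<beta>_bounds \<rho>_ge gap by (intro frac_le) auto
  ultimately have "\<bar>\<xi> ^ k / \<rho>\<bar> * \<bar>\<sigma>\<bar> \<le> \<beta> / gap n \<xi> * ((real n + 1) * M)"
    using \<beta>_bounds gap by (intro mult_mono) auto
  moreover have "\<bar>err (k + j)\<bar> \<le> M" using err k_le j_less by auto
  ultimately have "\<bar>err (k + j)\<bar> + \<bar>\<xi> ^ k / \<rho> * \<sigma>\<bar> \<le> M + \<beta> / gap n \<xi> * ((real n + 1) * M)"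
    unfolding abs_mult by (rule add_mono[rotated])
  also have "\<dots> = (1 + \<beta> / gap n \<xi> * (real n + 1)) * M" by (simp only: distrib_right mult.assoc mult_1)
  finally show ?thesis
    unfolding \<beta>_def \<rho>_def[symmetric] cancel by (rule order.trans[OF abs_triangle_ineq4])
qed

lemma near_row_reduced_shift:
  assumes near: "near_curve n \<xi> y M" and R_le: "R + N \<le> n + 2" "r \<in> generic_rows R"
    and N_bounds: "1 \<le> N" "k + N \<le> n + 1" and Q_ge_1: "1 \<le> Q" and gap: "0 < gap n \<xi>"
  shows "near_row N \<xi> Q (\<lambda>j. real_of_int (shift k y j) - \<xi> ^ k / poly_value R r \<xi> * real_of_int (comb_shift R r y j))
    (row_const n \<xi> * M)"
proof (rule near_row_mono)
  let ?C = "1 + power_bound n \<xi> / gap n \<xi> * (real n + 1)"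
  show "near_row N \<xi> Q (\<lambda>j. real_of_int (shift k y j) - \<xi> ^ k / poly_value R r \<xi> * real_of_int (comb_shift R r y j))
      ((1 + power_bound n \<xi>) * (?C * M))"
    by (rule near_row_of_small[OF abs_reduced_shift_le[OF near R_le N_bounds(2) gap] N_bounds(1) _ Q_ge_1])
      (use N_bounds(2) in auto)
  show "(1 + power_bound n \<xi>) * (?C * M) \<le> row_const n \<xi> * M"
    using mult_right_mono[OF row_const_ge(2) near_curve_nonneg[OF near]] by (simp add: mult.assoc)
qed (use Q_ge_1 in simp)

lemma fact_mult_power_le_det_const: "N \<le> n + 1 \<Longrightarrow> fact N * row_const n \<xi> ^ N \<le> det_const n \<xi>"
  unfolding det_const_def using row_const_ge_1[of n \<xi>] by (intro mult_mono power_increasing fact_mono) auto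

lemma abs_det_reduced_rows_le:
  fixes A :: "real mat"
  assumes A_carrier: "A \<in> carrier_mat N N" and N_bounds: "1 \<le> N" "N \<le> n + 1" and Q_nonneg: "0 \<le> Q"
    and gs: "length gs = N"
    and near: "\<And>i. i < N \<Longrightarrow> i < a \<or> b \<le> i \<Longrightarrow> near_row N \<xi> Q (\<lambda>j. A $$ (i, j)) (row_const n \<xi> * gs ! i)"
    and reduced: "\<And>i. a \<le> i \<Longrightarrow> i < b \<Longrightarrow> i < N \<Longrightarrow>
      near_row N \<xi> Q (\<lambda>j. A $$ (i, j) - (\<Sum>l<a. c i l * A $$ (l, j))) (row_const n \<xi> * gs ! i)"
  shows "\<bar>det A\<bar> \<le> det_const n \<xi> * (Q * prod_list gs)"
proof -
  define e where "e = (\<lambda>i l. if a \<le> i \<and> i < b \<and> l < a then - c i l else 0)"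
  define B where "B = mat N N (\<lambda>(i, j). A $$ (i, j) + (\<Sum>l<i. e i l * A $$ (l, j)))"
  have near_B: "near_row N \<xi> Q (\<lambda>j. B $$ (i, j)) (row_const n \<xi> * gs ! i)" if i_less: "i < N" for i
  proof (cases "a \<le> i \<and> i < b")
    case True
    then have "(\<Sum>l<i. e i l * A $$ (l, j)) = (\<Sum>l<a. - (c i l * A $$ (l, j)))" for j
      by (intro sum.mono_neutral_cong_right) (auto simp: e_def)
    then show ?thesis using reduced[of i] True i_less N_bounds by (simp add: near_row_def B_def sum_negf)
  next
    case False
    then have "e i = (\<lambda>l. 0)" by (auto simp: e_def)
    then show ?thesis using near[of i] False i_less N_bounds by (simp add: near_row_def B_def not_le not_less)
  qed
  then have "\<bar>det B\<bar> \<le> fact N * Q * (\<Prod>i<N. row_const n \<xi> * gs ! i)"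
    by (intro abs_det_near_rows_le[OF _ N_bounds(1)]) (simp_all add: B_def)
  also have "\<dots> = (fact N * row_const n \<xi> ^ N) * (Q * prod_list gs)"
    by (simp add: prod.distrib prod.list_conv_set_nth lessThan_atLeast0 gs)
  also have "\<dots> \<le> det_const n \<xi> * (Q * prod_list gs)"
  proof (rule mult_right_mono[OF fact_mult_power_le_det_const[OF N_bounds(2)]])
    have "0 \<le> gs ! i" if "i < N" for i
      using near_B[OF that] row_const_ge_1[of n \<xi>] by (auto simp: near_row_def zero_le_mult_iff)
    then show "0 \<le> Q * prod_list gs"
      using Q_nonneg gs by (auto simp: prod.list_conv_set_nth intro!: mult_nonneg_nonneg prod_nonneg)
  qed
  also have "det B = det A" unfolding B_def by (rule det_row_operations[OF A_carrier])
  finally show ?thesis .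
qed

lemma rat_span_real_coeffs:
  assumes "y \<in> rat_span N (set vs)"
  obtains c :: "nat \<Rightarrow> real"
    where "\<And>j. j < N \<Longrightarrow> real_of_int (y j) = (\<Sum>i<length vs. c i * real_of_int ((vs ! i) j))"
proof -
  obtain a b where a_nonzero: "a \<noteq> 0" and coeffs: "\<And>j. j < N \<Longrightarrow> a * y j = lincomb vs b j"
    using assms by (auto simp: rat_span_set_iff)
  have "real_of_int (y j) = (\<Sum>i<length vs. real_of_int (b i) / real_of_int a * real_of_int ((vs ! i) j))"
    if "j < N" for j
  proof -
    have "real_of_int a * real_of_int (y j) = (\<Sum>i<length vs. real_of_int (b i) * real_of_int ((vs ! i) j))"
      using coeffs[OF that]
      unfolding lincomb_def by (metis (mono_tags, lifting) of_int_mult of_int_sum sum.cong)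
    then show ?thesis using a_nonzero by (simp add: sum_divide_distrib[symmetric] field_simps)
  qed
  then show thesis using that[of "\<lambda>i. real_of_int (b i) / real_of_int a"] by blast
qed

lemma comb_shift_real_coeffs:
  assumes "\<And>l. l < n + 1 \<Longrightarrow> real_of_int (y l) = (\<Sum>i<a. c i * real_of_int ((vs ! i) l))" "R + j \<le> n + 1"
  shows "real_of_int (comb_shift R r y j) = (\<Sum>l<a. c l * real_of_int (comb_shift R r (vs ! l) j))"
proof -
  have "real_of_int (comb_shift R r y j) = (\<Sum>t<R. real_of_int (r t) * (\<Sum>l<a. c l * real_of_int ((vs ! l) (t + j))))"
    unfolding comb_shift_def using assms by simp
  also have "\<dots> = (\<Sum>l<a. c l * real_of_int (comb_shift R r (vs ! l) j))"
    unfolding comb_shift_def sum_distrib_left of_int_sum of_int_mult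
    by (subst sum.swap) (simp add: algebra_simps)
  finally show ?thesis .
qed

lemma near_row_cong:
  assumes "\<And>j. j < N \<Longrightarrow> w j = w' j" "1 \<le> N"
  shows "near_row N \<xi> Q w e \<longleftrightarrow> near_row N \<xi> Q w' e"
  using assms by (simp add: near_row_def)

lemma abs_det_rows_mat_near_le:
  assumes N_bounds: "1 \<le> N" "N \<le> n + 1" and Q_nonneg: "0 \<le> Q" and len: "length rs = N" "length gs = N"
    and near: "\<And>i. i < N \<Longrightarrow> i < a \<or> b \<le> i \<Longrightarrow> near_row N \<xi> Q (\<lambda>j. real_of_int ((rs ! i) j)) (row_const n \<xi> * gs ! i)"
    and reduced: "\<And>i. a \<le> i \<Longrightarrow> i < b \<Longrightarrow> i < N \<Longrightarrow>
      near_row N \<xi> Q (\<lambda>j. real_of_int ((rs ! i) j) - (\<Sum>l<a. c i l * real_of_int ((rs ! l) j))) (row_const n \<xi> * gs ! i)"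
  shows "\<bar>real_of_int (det (rows_mat N rs))\<bar> \<le> det_const n \<xi> * (Q * prod_list gs)"
proof -
  define A where "A = map_mat real_of_int (rows_mat N rs)"
  have A_carrier: "A \<in> carrier_mat N N" by (simp add: A_def)
  have entry: "A $$ (i, j) = real_of_int ((rs ! i) j)" if "i < N" "j < N" for i j
    using that by (simp add: A_def rows_mat_def)
  have "near_row N \<xi> Q (\<lambda>j. A $$ (i, j)) (row_const n \<xi> * gs ! i)" if "i < N" "i < a \<or> b \<le> i" for i
    by (rule near_row_cong[THEN iffD2, OF _ N_bounds(1) near[OF that]]) (simp add: entry that)
  moreover have "near_row N \<xi> Q (\<lambda>j. A $$ (i, j) - (\<Sum>l<a. c i l * A $$ (l, j))) (row_const n \<xi> * gs ! i)"
    if i_ge: "a \<le> i" "i < b" "i < N" for i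
    by (rule near_row_cong[THEN iffD2, OF _ N_bounds(1) reduced[OF i_ge]]) (use i_ge in \<open>simp add: entry\<close>)
  ultimately have "\<bar>det A\<bar> \<le> det_const n \<xi> * (Q * prod_list gs)"
    by (rule abs_det_reduced_rows_le[OF A_carrier N_bounds Q_nonneg len(2)])
  then show ?thesis by (simp add: A_def of_int_hom.hom_det)
qed

lemma near_row_shift_mod_comb_shifts:
  assumes y_span: "y \<in> rat_span (n + 1) (set vs)" "near_curve n \<xi> y M"
    and R_le: "R + N \<le> n + 2" "r \<in> generic_rows R"
    and N_bounds: "1 \<le> N" and Q_ge_1: "1 \<le> Q" and gap: "0 < gap n \<xi>"
  obtains c where "\<And>k. k + N \<le> n + 1 \<Longrightarrow> near_row N \<xi> Q (\<lambda>j. real_of_int (shift k y j) -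
      (\<Sum>l<length vs. c k l * real_of_int (comb_shift R r (vs ! l) j))) (row_const n \<xi> * M)"
proof -
  obtain c where y_eq: "\<And>l. l < n + 1 \<Longrightarrow> real_of_int (y l) = (\<Sum>i<length vs. c i * real_of_int ((vs ! i) l))"
    using rat_span_real_coeffs[OF y_span(1)] by blast
  have shift_eq: "real_of_int (shift k y j) - (\<Sum>l<length vs. \<xi> ^ k / poly_value R r \<xi> * c l * real_of_int (comb_shift R r (vs ! l) j)) =
      real_of_int (shift k y j) - \<xi> ^ k / poly_value R r \<xi> * real_of_int (comb_shift R r y j)" if "j < N" for k j
    using comb_shift_real_coeffs[OF y_eq, where R = R and j = j and r = r] R_le(1) that
    by (simp add: sum_distrib_left mult.assoc)
  show thesis
    by (rule that, rule near_row_cong[THEN iffD2, OF shift_eq N_bounds], assumption)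
      (rule near_row_reduced_shift[OF y_span(2) R_le N_bounds _ Q_ge_1 gap])
qed

abbreviation near_points :: "nat \<Rightarrow> real \<Rightarrow> real \<Rightarrow> (nat \<Rightarrow> int) list \<Rightarrow> real list \<Rightarrow> bool" where
  "near_points n \<xi> Q \<equiv> list_all2 (\<lambda>v e. near_curve n \<xi> v e \<and> \<bar>real_of_int (v 0)\<bar> \<le> Q * e)"

abbreviation near_rows :: "nat \<Rightarrow> nat \<Rightarrow> real \<Rightarrow> real \<Rightarrow> (nat \<Rightarrow> int) list \<Rightarrow> real list \<Rightarrow> bool" where
  "near_rows n N \<xi> Q \<equiv> list_all2 (\<lambda>w e. near_row N \<xi> Q (\<lambda>j. real_of_int (w j)) (row_const n \<xi> * e))"

lemma abs_det_point_rows_le: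
  assumes N_bounds: "1 \<le> N" "N \<le> n + 1" and R_le: "R + N \<le> n + 2" "r \<in> generic_rows R"
    and Q_ge_1: "1 \<le> Q" and gap: "0 < gap n \<xi>"
    and vs: "near_points n \<xi> Q vs es"
    and y_span: "y \<in> rat_span (n + 1) (set vs)" "near_curve n \<xi> y M" and ks: "\<And>k. k \<in> set ks \<Longrightarrow> k + N \<le> n + 1"
    and ws: "near_rows n N \<xi> Q ws fs"
    and len: "length vs + length ks + length ws = N"
  shows "\<bar>real_of_int (det (rows_mat N (map (comb_shift R r) vs @ map (\<lambda>k. shift k y) ks @ ws)))\<bar>
    \<le> det_const n \<xi> * (Q * (prod_list es * M ^ length ks * prod_list fs))"
proof -
  define rs where "rs = map (comb_shift R r) vs @ map (\<lambda>k. shift k y) ks @ ws"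
  define gs where "gs = es @ replicate (length ks) M @ fs"
  define a b where "a = length vs" and "b = length vs + length ks"
  have len_es: "length es = a" "length fs = length ws"
    using vs ws by (auto simp: a_def dest: list_all2_lengthD)
  have len_rs: "length rs = N" "length gs = N" using len len_es by (simp_all add: rs_def gs_def a_def)
  have rs_comb: "rs ! i = comb_shift R r (vs ! i)" "gs ! i = es ! i" if "i < a" for i
    using that len_es by (auto simp: rs_def gs_def nth_append a_def)
  have rs_shift: "rs ! i = shift (ks ! (i - a)) y" "gs ! i = M" "ks ! (i - a) + N \<le> n + 1"
    if "a \<le> i" "i < b" for i
    using that ks len_es by (auto simp: rs_def gs_def nth_append a_def b_def)
  have rs_last: "rs ! i = ws ! (i - b)" "gs ! i = fs ! (i - b)" "i - b < length ws" if "b \<le> i" "i < N" for i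
    using that len len_es by (auto simp: rs_def gs_def nth_append a_def b_def)
  obtain c where near_mod: "\<And>k. k + N \<le> n + 1 \<Longrightarrow> near_row N \<xi> Q (\<lambda>j. real_of_int (shift k y j) -
      (\<Sum>l<length vs. c k l * real_of_int (comb_shift R r (vs ! l) j))) (row_const n \<xi> * M)"
    by (rule near_row_shift_mod_comb_shifts[OF y_span R_le N_bounds(1) Q_ge_1 gap]) blast
  have "\<bar>real_of_int (det (rows_mat N rs))\<bar> \<le> det_const n \<xi> * (Q * prod_list gs)"
  proof (rule abs_det_rows_mat_near_le[OF N_bounds _ len_rs])
    fix i assume i_less: "i < N" "i < a \<or> b \<le> i"
    from i_less(2) show "near_row N \<xi> Q (\<lambda>j. real_of_int ((rs ! i) j)) (row_const n \<xi> * gs ! i)"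
    proof
      assume "i < a"
      then show ?thesis
        using near_row_comb_shift[OF _ _ R_le N_bounds(1) Q_ge_1] list_all2_nthD[OF vs, of i]
        by (simp add: rs_comb a_def)
    next
      assume "b \<le> i"
      then show ?thesis using list_all2_nthD[OF ws, of "i - b"] i_less(1) by (simp add: rs_last)
    qed
  next
    show "near_row N \<xi> Q (\<lambda>j. real_of_int ((rs ! i) j) - (\<Sum>l<a. c (ks ! (i - a)) l * real_of_int ((rs ! l) j)))
      (row_const n \<xi> * gs ! i)" if i_ge: "a \<le> i" "i < b" for i
      using near_mod[OF rs_shift(3)[OF i_ge]] by (simp add: rs_shift[OF i_ge] rs_comb a_def)
  qed (use Q_ge_1 in simp)
  then show ?thesis by (simp add: rs_def gs_def)
qed

section \<open>Annihilators of points\<close>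

text \<open>A point has the coordinates \<open>x 0, \<dots>, x n\<close>, hence \<open>n + 2 - N\<close> blocks of \<open>N\<close> consecutive ones.\<close>

definition shift_rows :: "nat \<Rightarrow> nat \<Rightarrow> (nat \<Rightarrow> int) \<Rightarrow> (nat \<Rightarrow> int) list" where
  "shift_rows n N x = map (\<lambda>k. shift k x) [0..<n + 2 - N]"

definition ann :: "nat \<Rightarrow> nat \<Rightarrow> (nat \<Rightarrow> int) \<Rightarrow> (nat \<Rightarrow> int) set" where
  "ann n N x = orth N (set (shift_rows n N x))"

definition full_rank :: "nat \<Rightarrow> nat \<Rightarrow> (nat \<Rightarrow> int) \<Rightarrow> bool" where
  "full_rank n m x \<longleftrightarrow> (\<forall>p \<in> ann n (m + 1) x. \<not> nonzero_below (m + 1) p)"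

lemma length_shift_rows [simp]: "length (shift_rows n N x) = n + 2 - N"
  by (simp add: shift_rows_def)

lemma nth_shift_rows [simp]: "i < n + 2 - N \<Longrightarrow> shift_rows n N x ! i = shift i x"
  by (simp add: shift_rows_def)

lemma shift_in_shift_rows: "k + N \<le> n + 1 \<Longrightarrow> shift k x \<in> set (shift_rows n N x)"
  by (auto simp: shift_rows_def)

lemma ann_iff: "p \<in> ann n N x \<longleftrightarrow> (\<forall>k. k + N \<le> n + 1 \<longrightarrow> dotp N (shift k x) p = 0)"
  by (auto simp: ann_def orth_def shift_rows_def)

lemma annD: "p \<in> ann n N x \<Longrightarrow> k + N \<le> n + 1 \<Longrightarrow> dotp N (shift k x) p = 0"
  by (simp add: ann_iff)

lemma trunc_in_ann_iff [simp]: "trunc N p \<in> ann n N x \<longleftrightarrow> p \<in> ann n N x"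
  by (simp add: ann_def)

lemma ann_scale_iff: "a \<noteq> 0 \<Longrightarrow> (\<lambda>j. a * p j) \<in> ann n N x \<longleftrightarrow> p \<in> ann n N x"
  unfolding ann_def by (rule orth_scale_iff)

lemma rat_span_subset_ann: "A \<subseteq> ann n N x \<Longrightarrow> rat_span N A \<subseteq> ann n N x"
  unfolding ann_def by (rule rat_span_subset_orth)

lemma zero_in_ann: "\<not> nonzero_below N p \<Longrightarrow> p \<in> ann n N x"
  unfolding ann_def by (rule zero_in_orth)

lemma tmult_in_ann: "p \<in> ann n N x \<Longrightarrow> supp_below N p \<Longrightarrow> i + N \<le> N' \<Longrightarrow> tmult i p \<in> ann n N' x"
  by (simp add: ann_iff dotp_tmult)

lemma in_ann_mono: "p \<in> ann n N x \<Longrightarrow> supp_below N p \<Longrightarrow> N \<le> N' \<Longrightarrow> p \<in> ann n N' x"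
  using tmult_in_ann[of p n N x 0 N'] by simp

lemma in_ann_of_Suc:
  assumes p_supp: "supp_below N p" and N_le: "N \<le> n"
    and ann: "p \<in> ann n (Suc N) x" "tmult (Suc 0) p \<in> ann n (Suc N) x"
  shows "p \<in> ann n N x"
  unfolding ann_iff
proof (intro allI impI)
  fix k assume k_le: "k + N \<le> n + 1"
  show "dotp N (shift k x) p = 0"
  proof (cases "k + Suc N \<le> n + 1")
    case True
    then show ?thesis using annD[OF ann(1) True] dotp_tmult[OF p_supp, of 0 "Suc N"] by simp
  next
    case False
    then have "k = Suc (k - 1)" "k - 1 + Suc N \<le> n + 1" using k_le N_le by auto
    then show ?thesis using annD[OF ann(2), of "k - 1"] dotp_tmult[OF p_supp, of "Suc 0" "Suc N"] by simp
  qed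
qed

lemma full_rank_antimono:
  assumes "full_rank n m x" "N \<le> m + 1" "p \<in> ann n N x"
  shows "\<not> nonzero_below N p"
proof
  assume "nonzero_below N p"
  then obtain j where "j < N" "p j \<noteq> 0" by (auto simp: nonzero_below_def)
  then have "nonzero_below (m + 1) (trunc N p)"
    using assms(2) unfolding nonzero_below_def by (intro exI[of _ j]) (simp add: trunc_def)
  moreover have "trunc N p \<in> ann n (m + 1) x"
    using in_ann_mono[of "trunc N p" n N x "m + 1"] assms(2,3) by simp
  ultimately show False using assms(1) by (auto simp: full_rank_def)
qed

lemma lin_indep_shift_rows:
  assumes "1 \<le> N" "N \<le> n + 1" and no_ann: "\<And>p. p \<in> ann n (n + 2 - N) x \<Longrightarrow> \<not> nonzero_below (n + 2 - N) p"
  shows "lin_indep N (shift_rows n N x)"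
  unfolding lin_indep_iff_columns
proof
  fix c assume c_orth: "c \<in> orth (length (shift_rows n N x)) (set (columns N (shift_rows n N x)))"
  have "c \<in> ann n (n + 2 - N) x"
    unfolding ann_iff
  proof (intro allI impI)
    fix k assume "k + (n + 2 - N) \<le> n + 1"
    then have "k < N" using assms(1,2) by arith
    then have "lincomb (shift_rows n N x) c k = 0" using c_orth unfolding orth_columns_iff by blast
    moreover have "lincomb (shift_rows n N x) c k = (\<Sum>i<n + 2 - N. c i * shift i x k)"
      by (simp add: lincomb_def)
    ultimately show "dotp (n + 2 - N) (shift k x) c = 0"
      by (simp add: dotp_def shift_def mult.commute add.commute)
  qed
  then show "\<not> nonzero_below (length (shift_rows n N x)) c" using no_ann by simp
qed

lemma full_rank_lin_indep:
  assumes "full_rank n m x" "1 \<le> N" "N \<le> n + 1" "n + 2 - N \<le> m + 1"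
  shows "lin_indep N (shift_rows n N x)"
  by (rule lin_indep_shift_rows[OF assms(2,3) full_rank_antimono[OF assms(1,4)]])

lemma exists_primitive_ann:
  assumes "n + 2 < 2 * N"
  obtains P where "primitive P" "supp_below N P" "P \<in> ann n N x"
proof -
  have "length (shift_rows n N x) < N" using assms by simp
  then obtain p where p_ann: "nonzero_below N p" "p \<in> ann n N x" unfolding ann_def by (rule exists_orth)
  obtain g P where P_primitive: "g \<noteq> 0" "primitive P" "supp_below N P" "trunc N p = (\<lambda>j. g * P j)"
    by (rule primitive_part[OF p_ann(1)])
  have "(\<lambda>j. g * P j) \<in> ann n N x"
    using p_ann(2) trunc_in_ann_iff unfolding P_primitive(4)[symmetric] by blast
  then show thesis using that P_primitive(1-3) ann_scale_iff by blast
qed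

lemma dotp_comb_shift_adjoint:
  assumes "R + N \<le> n + 2"
  shows "dotp N (comb_shift R r x) q = dotp (n + 1) x (\<lambda>j. \<Sum>k<R. r k * tmult k (trunc N q) j)"
proof -
  have "dotp N (shift k x) q = dotp (n + 1) x (tmult k (trunc N q))" if "k < R" for k
  proof -
    have "dotp N (shift k x) q = dotp N (shift k x) (trunc N q)" by (rule dotp_cong) (simp_all add: trunc_def)
    then show ?thesis using dotp_tmult[OF supp_below_trunc, of k N "n + 1" x q] assms that by simp
  qed
  then show ?thesis by (simp add: dotp_comb_shift dotp_sum_right)
qed

lemma comb_shift_in_rat_span:
  assumes z_span: "z \<in> rat_span (n + 1) A" and R_le: "R + N \<le> n + 2"
  shows "comb_shift R r z \<in> rat_span N (comb_shift R r ` A)"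
proof -
  have "dotp N (comb_shift R r z) q = 0" if "q \<in> orth N (comb_shift R r ` A)" for q
  proof -
    have "(\<lambda>j. \<Sum>k<R. r k * tmult k (trunc N q) j) \<in> orth (n + 1) A"
      using that by (simp add: orth_def dotp_comb_shift_adjoint[OF R_le])
    then show ?thesis
      using z_span
      unfolding dotp_comb_shift_adjoint[OF R_le] rat_span_def by (subst dotp_commute) (rule orthD)
  qed
  then show ?thesis by (simp add: rat_span_def orth_def dotp_commute[of N _ "comb_shift R r z"])
qed

lemma shift_in_rat_span:
  "z \<in> rat_span (n + 1) A \<Longrightarrow> k + N \<le> n + 1 \<Longrightarrow> shift k z \<in> rat_span N (shift k ` A)"
  using comb_shift_in_rat_span[of z n A "Suc k" N "unit_row k"] by (simp add: comb_shift_unit_row)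

lemma in_ann_of_rat_span:
  assumes z_span: "z \<in> rat_span (n + 1) A" and p_ann: "\<And>x. x \<in> A \<Longrightarrow> p \<in> ann n N x"
  shows "p \<in> ann n N z"
  unfolding ann_iff
proof (intro allI impI)
  fix k assume k_le: "k + N \<le> n + 1"
  have "p \<in> orth N (shift k ` A)" using p_ann k_le by (auto simp: orth_def ann_iff)
  then show "dotp N (shift k z) p = 0"
    using shift_in_rat_span[OF z_span k_le] by (simp add: rat_span_def orth_def dotp_commute)
qed

section \<open>Points with common annihilators\<close>

lemma recurrence_proportional:
  fixes f g :: "nat \<Rightarrow> int"
  assumes cd_nonzero: "c \<noteq> 0 \<or> d \<noteq> 0"
    and f_recurrence: "\<And>k. Suc k < N \<Longrightarrow> c * f k + d * f (Suc k) = 0"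
    and g_recurrence: "\<And>k. Suc k < N \<Longrightarrow> c * g k + d * g (Suc k) = 0"
  obtains s t where "s \<noteq> 0 \<or> t \<noteq> 0" "\<And>k. k < N \<Longrightarrow> s * f k + t * g k = 0"
proof (cases N)
  case 0
  then show ?thesis using that[of 1 0] by simp
next
  case (Suc q)
  define p :: "nat \<Rightarrow> int" where "p = (\<lambda>j. if j = 0 then c else if j = 1 then d else 0)"
  have p_supp: "supp_below 2 p" "nonzero_below 2 p"
    using cd_nonzero by (auto simp: p_def supp_below_def nonzero_below_def less_2_cases_iff)
  have "h \<in> orth N (set (tmults q p))" if "\<And>k. Suc k < N \<Longrightarrow> c * h k + d * h (Suc k) = 0" for h
  proof -
    have "dotp N (tmult k p) h = c * h k + d * h (Suc k)" if "k < q" for k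
    proof -
      have "dotp N (tmult k p) h = dotp 2 (shift k h) p"
        unfolding dotp_commute[of N "tmult k p"] by (rule dotp_tmult[OF p_supp(1)]) (use that Suc in simp)
      then show ?thesis by (simp add: dotp_def shift_def p_def numeral_2_eq_2 mult.commute)
    qed
    then show ?thesis using that Suc by (auto simp: orth_def set_tmults)
  qed
  then have "set [f, g] \<subseteq> orth N (set (tmults q p))" using f_recurrence g_recurrence by simp
  moreover have "lin_indep N (tmults q p)"
    using lin_indep_tmults[of 1 p q] p_supp Suc by (simp add: numeral_2_eq_2)
  ultimately have "\<not> lin_indep N [f, g]"
    using lin_indep_append_orth[of N "tmults q p" "[f, g]"] lin_indep_length_le Suc by fastforce
  then obtain e where "\<And>k. k < N \<Longrightarrow> lincomb [f, g] e k = 0" "e 0 \<noteq> 0 \<or> e 1 \<noteq> 0"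
    by (auto simp: lin_indep_def less_Suc_eq)
  then show ?thesis using that[of "e 0" "e 1"] by simp
qed

lemma exists_ann_combination:
  assumes P_ann: "supp_below N P" and coeffs_nonzero: "\<alpha> \<noteq> 0 \<or> \<beta> \<noteq> 0"
    and multiple_ann: "\<And>x. x \<in> {u, v} \<Longrightarrow> (\<lambda>j. \<alpha> * P j + \<beta> * tmult (Suc 0) P j) \<in> ann n (Suc N) x"
  obtains s t where "s \<noteq> 0 \<or> t \<noteq> 0" "P \<in> ann n N (\<lambda>j. s * u j + t * v j)"
proof -
  define f where "f = (\<lambda>x k. dotp N (shift k x) P)"
  have rec: "\<alpha> * f x k + \<beta> * f x (Suc k) = 0" if "x \<in> {u, v}" "Suc k < n + 2 - N" for x k
    using annD[OF multiple_ann[OF that(1)], of k] that(2) dotp_tmult[OF P_ann, of 0 "Suc N"] dotp_tmult[OF P_ann, of "Suc 0" "Suc N"]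
    by (simp add: dotp_add_right f_def)
  obtain s t where st_nonzero: "s \<noteq> 0 \<or> t \<noteq> 0" "\<And>k. k < n + 2 - N \<Longrightarrow> s * f u k + t * f v k = 0"
    using recurrence_proportional[OF coeffs_nonzero, of "n + 2 - N" "f u" "f v"] rec by blast
  have "shift k (\<lambda>j. s * u j + t * v j) = (\<lambda>j. s * shift k u j + t * shift k v j)" for k
    by (simp add: shift_def)
  then have "P \<in> ann n N (\<lambda>j. s * u j + t * v j)"
    using st_nonzero(2) by (simp add: ann_iff dotp_add_left f_def)
  then show thesis using that st_nonzero(1) by blast
qed

lemma shift_invariant_matrix_is_scalar:
  fixes C :: "nat \<Rightarrow> nat \<Rightarrow> int"
  assumes first: "\<And>k. Suc k < s \<Longrightarrow> C (Suc k) 0 = 0" and last: "\<And>k. Suc k < s \<Longrightarrow> C k (s - 1) = 0"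
    and shifted: "\<And>k i. Suc k < s \<Longrightarrow> Suc i < s \<Longrightarrow> C (Suc k) (Suc i) = C k i"
    and ki: "k < s" "i < s"
  shows "C k i = (if i = k then C 0 0 else 0)"
proof -
  have diagonal: "C (k + t) (i + t) = C k i" if "k + t < s" "i + t < s" for k i t
    using that by (induction t) (simp_all add: shifted)
  consider (on) "i = k" | (below) "i < k" | (above) "k < i" by linarith
  then show ?thesis
  proof cases
    case on
    then show ?thesis using diagonal[of 0 k 0] ki by simp
  next
    case below
    then have "C k i = C (k - i) 0" using diagonal[of "k - i" i 0] ki by simp
    then show ?thesis using first[of "k - i - 1"] below ki by (simp add: Suc_diff_Suc)
  next
    case above
    define t where "t = s - 1 - i"
    have "C k i = C (k + t) (s - 1)" using diagonal[of k t i] above ki by (simp add: t_def)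
    then show ?thesis using last[of "k + t"] above ki by (simp add: t_def)
  qed
qed

lemma common_denominator:
  fixes u :: "nat \<Rightarrow> nat \<Rightarrow> int"
  assumes "\<And>k. k < s \<Longrightarrow> u k \<in> rat_span N (set gs)"
  obtains A C where "A \<noteq> 0" "\<And>k j. k < s \<Longrightarrow> j < N \<Longrightarrow> A * u k j = lincomb gs (C k) j"
proof -
  obtain a c where a_nonzero: "\<And>k. k < s \<Longrightarrow> a k \<noteq> 0"
    and coeffs: "\<And>k j. k < s \<Longrightarrow> j < N \<Longrightarrow> a k * u k j = lincomb gs (c k) j"
    using assms unfolding rat_span_set_iff by metis
  define A where "A = (\<Prod>k<s. a k)"
  have "A * u k j = lincomb gs (\<lambda>i. (A div a k) * c k i) j" if "k < s" "j < N" for k j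
  proof -
    have "a k dvd A" unfolding A_def using that by (intro dvd_prodI) auto
    then have "A * u k j = (A div a k) * (a k * u k j)" by (metis dvd_div_mult_self mult.assoc)
    then show ?thesis using coeffs[OF that] by (simp add: lincomb_def sum_distrib_left mult.assoc)
  qed
  moreover have "A \<noteq> 0" using a_nonzero by (simp add: A_def)
  ultimately show thesis using that[of A "\<lambda>k i. (A div a k) * c k i"] by blast
qed

text \<open>Comparing overlapping shifts makes the coefficient matrix invariant under diagonal translation.\<close>

lemma shift_coeffs_scalar:
  fixes C :: "nat \<Rightarrow> nat \<Rightarrow> int"
  assumes N_add_s: "N + s = n + 1" and indep_x: "lin_indep N (shift_rows n N x)"
    and coeffs: "\<And>k j. k < s \<Longrightarrow> j < Suc N \<Longrightarrow> A * u (k + j) = (\<Sum>i<s. C k i * x (i + j))"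
    and ki: "k < s" "i < s"
  shows "C k i = (if i = k then C 0 0 else 0)"
proof -
  have overlap: "(if i = 0 then 0 else C k (i - 1)) = (if i < s then C (Suc k) i else 0)"
    if k: "Suc k < s" and i_less: "i < Suc s" for k i
  proof -
    define e where "e = (\<lambda>i. (if i = 0 then 0 else C k (i - 1)) - (if i < s then C (Suc k) i else 0))"
    have "lincomb (shift_rows n N x) e j = 0" if j_less: "j < N" for j
    proof -
      have "(\<Sum>i<Suc s. (if i = 0 then 0 else C k (i - 1)) * x (i + j)) = (\<Sum>i<s. C k i * x (i + Suc j))"
        by (subst sum.lessThan_Suc_shift) simp
      also have "\<dots> = (\<Sum>i<s. C (Suc k) i * x (i + j))"
        using coeffs[of k "Suc j"] coeffs[of "Suc k" j] k j_less by simp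
      also have "\<dots> = (\<Sum>i<Suc s. (if i < s then C (Suc k) i else 0) * x (i + j))" by simp
      finally have "(\<Sum>i<Suc s. e i * x (i + j)) = 0" by (simp add: e_def left_diff_distrib sum_subtractf)
      moreover have "n + 2 - N = Suc s" using N_add_s by simp
      ultimately show ?thesis by (simp add: lincomb_def shift_def)
    qed
    then have "e i = 0" using lin_indepD[OF indep_x, of e i] i_less N_add_s by simp
    then show ?thesis by (simp add: e_def)
  qed
  show ?thesis
  proof (rule shift_invariant_matrix_is_scalar[OF _ _ _ ki])
    show "C (Suc k) 0 = 0" if "Suc k < s" for k using overlap[OF that, of 0] that by simp
    show "C k (s - 1) = 0" if "Suc k < s" for k using overlap[OF that, of s] that by simp
    show "C (Suc k) (Suc i) = C k i" if "Suc k < s" "Suc i < s" for k i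
      using overlap[OF that(1), of "Suc i"] that(2) by simp
  qed
qed

lemma ann_determines_point:
  assumes N_le: "N \<le> n" and indep_x: "lin_indep N (shift_rows n N x)"
    and ann_subset: "ann n (Suc N) x \<subseteq> ann n (Suc N) u"
  shows "u \<in> rat_span (n + 1) {x}"
proof -
  define s where "s = n + 1 - N"
  have s_bounds: "0 < s" "N + s = n + 1" using N_le by (simp_all add: s_def)
  have "shift k u \<in> rat_span (Suc N) (set (shift_rows n (Suc N) x))" if "k < s" for k
  proof -
    have "shift k u \<in> set (shift_rows n (Suc N) u)"
      using that by (intro shift_in_shift_rows) (simp add: s_def)
    then show ?thesis
      using ann_subset orth_antimono[of "ann n (Suc N) x"] subset_rat_span[of "set (shift_rows n (Suc N) u)" "Suc N"]
      unfolding rat_span_def ann_def by blast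
  qed
  then obtain A C where A_nonzero: "A \<noteq> 0"
    and rows: "\<And>k j. k < s \<Longrightarrow> j < Suc N \<Longrightarrow> A * shift k u j = lincomb (shift_rows n (Suc N) x) (C k) j"
    using common_denominator[of s "\<lambda>k. shift k u"] by metis
  have coeffs: "A * u (k + j) = (\<Sum>i<s. C k i * x (i + j))" if "k < s" "j < Suc N" for k j
    using rows[OF that] by (simp add: lincomb_def shift_def s_def)
  have "A * u j = C 0 0 * x j" if j_less: "j < n + 1" for j
  proof -
    define k where "k = min j (s - 1)"
    have k_less: "k < s" "k + (j - k) = j" "j - k < Suc N" using s_bounds j_less by (auto simp: k_def)
    have "A * u j = (\<Sum>i<s. C k i * x (i + (j - k)))" using coeffs[OF k_less(1,3)] k_less(2) by simp
    also have "\<dots> = (\<Sum>i<s. if i = k then C 0 0 * x j else 0)"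
      using shift_coeffs_scalar[OF s_bounds(2) indep_x coeffs k_less(1)] k_less(2) by (intro sum.cong) auto
    finally show ?thesis using k_less(1) by simp
  qed
  then show ?thesis using A_nonzero by (auto simp: rat_span_singleton_iff)
qed

lemma supp_below_lincomb_tmults: "supp_below (Suc d) p \<Longrightarrow> supp_below (d + r) (lincomb (tmults r p) c)"
  by (auto simp: supp_below_def lincomb_tmults tmult_def intro!: sum.neutral)

lemma tmult_lincomb_tmults: "tmult k (lincomb (tmults r p) c) j = (\<Sum>i<r. c i * tmult (k + i) p j)"
  by (auto simp: lincomb_tmults tmult_def add.commute intro!: sum.cong)

lemma supp_below_eqI:
  assumes "supp_below N f" "supp_below N g" "\<And>j. j < N \<Longrightarrow> f j = g j"
  shows "f = (g :: nat \<Rightarrow> int)"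
  using assms unfolding supp_below_def by (metis ext not_le)

text \<open>Subtracting \<open>T\<^sup>q\<close> times the first relation from the second kills all coefficients but the constant one.\<close>

lemma rat_span_tmults_cancel:
  assumes p_supp: "supp_below (Suc d) p" "nonzero_below (Suc d) p" and p'_supp: "supp_below (Suc d) p'"
    and span: "p' \<in> rat_span (d + Suc q) (set (tmults (Suc q) p))"
      "tmult q p' \<in> rat_span (d + Suc q) (set (tmults (Suc q) p))"
  shows "p' \<in> rat_span (Suc d) {p}"
proof -
  let ?L = "\<lambda>c. lincomb (tmults (Suc q) p) c"
  obtain a c where a_nonzero: "a \<noteq> 0" and "\<And>j. j < d + Suc q \<Longrightarrow> a * p' j = ?L c j"
    using span(1) by (auto simp: rat_span_set_iff)
  then have p'_eq: "(\<lambda>j. a * p' j) = ?L c"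
    using p'_supp
    by (intro supp_below_eqI[OF _ supp_below_lincomb_tmults[OF p_supp(1)]]) (simp_all add: supp_below_def)
  obtain b e where b_nonzero: "b \<noteq> 0" and "\<And>j. j < d + Suc q \<Longrightarrow> b * tmult q p' j = ?L e j"
    using span(2) by (auto simp: rat_span_set_iff)
  then have tmult_p'_eq: "(\<lambda>j. b * tmult q p' j) = ?L e"
    using p'_supp
    by (intro supp_below_eqI[OF _ supp_below_lincomb_tmults[OF p_supp(1)]]) (simp_all add: supp_below_def tmult_def)
  define E where "E = (\<lambda>i. (if q \<le> i then b * c (i - q) else 0) - (if i < Suc q then a * e i else 0))"
  have "lincomb (tmults (q + Suc q) p) E j = 0" for j
  proof -
    have "(\<Sum>i<q + Suc q. (if q \<le> i then b * c (i - q) else 0) * tmult i p j) = (\<Sum>i = q..<q + Suc q. b * c (i - q) * tmult i p j)"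
      by (intro sum.mono_neutral_cong_right) auto
    also have "\<dots> = b * tmult q (?L c) j"
      using sum.shift_bounds_nat_ivl[of "\<lambda>i. b * c (i - q) * tmult i p j" 0 q "Suc q"]
      by (simp add: tmult_lincomb_tmults add.commute lessThan_atLeast0 sum_distrib_left mult.assoc
          del: sum.lessThan_Suc sum.op_ivl_Suc)
    also have "\<dots> = a * (b * tmult q p' j)" by (simp add: tmult_def flip: p'_eq)
    also have "\<dots> = a * ?L e j" by (simp flip: tmult_p'_eq)
    also have "\<dots> = (\<Sum>i<q + Suc q. (if i < Suc q then a * e i else 0) * tmult i p j)"
      unfolding lincomb_tmults sum_distrib_left by (intro sum.mono_neutral_cong_left) auto
    finally show ?thesis
      by (simp add: lincomb_tmults E_def left_diff_distrib sum_subtractf del: sum.lessThan_Suc)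
  qed
  then have E_eq_0: "E i = 0" if "i < q + Suc q" for i
    using lin_indepD[OF lin_indep_tmults[OF p_supp, of "q + Suc q"], of E i] that by simp
  have "c i = 0" if "0 < i" "i < Suc q" for i using E_eq_0[of "q + i"] that b_nonzero by (simp add: E_def)
  then have "(\<Sum>i<Suc q. c i * tmult i p j) = (\<Sum>i\<in>{0}. c i * tmult i p j)" for j
    by (intro sum.mono_neutral_right) auto
  then have "a * p' j = c 0 * p j" for j using fun_cong[OF p'_eq, of j] by (simp add: lincomb_tmults)
  then show ?thesis using a_nonzero by (auto simp: rat_span_singleton_iff)
qed

lemma ann_eq_rat_span_tmults:
  assumes d_bounds: "1 \<le> d" "2 * d \<le> n + 1" and no_ann: "\<And>q. q \<in> ann n d x \<Longrightarrow> \<not> nonzero_below d q"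
    and p_supp: "supp_below (Suc d) p" "nonzero_below (Suc d) p" "p \<in> ann n (Suc d) x"
    and d_add_q: "d + q = n + 2 - d"
  shows "ann n (d + q) x = rat_span (d + q) (set (tmults q p))"
  unfolding ann_def
proof (rule orth_eq_rat_span)
  show "lin_indep (d + q) (shift_rows n (d + q) x)"
    by (rule lin_indep_shift_rows) (use d_bounds no_ann d_add_q in auto)
  show "lin_indep (d + q) (tmults q p)" by (rule lin_indep_tmults[OF p_supp(1,2)])
  show "set (tmults q p) \<subseteq> orth (d + q) (set (shift_rows n (d + q) x))"
    using tmult_in_ann[OF p_supp(3,1), of _ "d + q"] by (auto simp: set_tmults ann_def)
qed (use d_add_q d_bounds in simp)

lemma low_degree_ann_unique:
  assumes d_bounds: "1 \<le> d" "2 * d \<le> n + 1" and no_ann: "\<And>q. q \<in> ann n d x \<Longrightarrow> \<not> nonzero_below d q"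
    and p_supp: "supp_below (Suc d) p" "nonzero_below (Suc d) p" "p \<in> ann n (Suc d) x"
    and p'_supp: "supp_below (Suc d) p'" "p' \<in> ann n (Suc d) x"
  shows "p' \<in> rat_span (Suc d) {p}"
proof -
  define q where "q = n + 1 - 2 * d"
  have d_add_q: "d + Suc q = n + 2 - d" using d_bounds by (simp add: q_def)
  have "tmult i p' \<in> ann n (d + Suc q) x" if "i < Suc q" for i
    using tmult_in_ann[OF p'_supp(2,1), of i "d + Suc q"] that by simp
  then have "tmult i p' \<in> rat_span (d + Suc q) (set (tmults (Suc q) p))" if "i < Suc q" for i
    using that ann_eq_rat_span_tmults[OF d_bounds no_ann p_supp d_add_q] by simp
  from this[of 0] this[of q] show ?thesis by (intro rat_span_tmults_cancel[OF p_supp(1,2) p'_supp(1)]) auto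
qed

lemma rat_span_insertE:
  assumes "q \<in> rat_span N (set (p # gs))"
  obtains a b where "a \<noteq> 0" "(\<lambda>j. a * q j + b * p j) \<in> rat_span N (set gs)"
proof -
  obtain a c where a_nonzero: "a \<noteq> 0" and coeffs: "\<And>j. j < N \<Longrightarrow> a * q j = lincomb (p # gs) c j"
    using assms unfolding rat_span_set_iff by blast
  have "(\<lambda>j. a * q j + - c 0 * p j) \<in> rat_span N (set gs)"
    by (rule rat_spanI[of 1, where c = "\<lambda>i. c (Suc i)" and gs = gs]) (use coeffs subset_rat_span in simp_all)
  then show thesis using that a_nonzero by blast
qed

lemma exists_ann_basis_of_pencil:
  assumes n_eq: "n = 2 * m + 1" and one_le_m: "1 \<le> m" and full_rank: "full_rank n m y"
    and P_ann: "supp_below (m + 2) P" "P \<in> ann n (m + 2) y" "P \<notin> ann n (m + 2) y'"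
    and pencil: "lin_indep (m + 3) [G1, G2]" "{G1, G2} \<subseteq> ann n (m + 3) y" "{G1, G2} \<subseteq> ann n (m + 3) y'"
  obtains Q Q' where "{Q, Q'} = {P, tmult (Suc 0) P}" "{Q, Q'} \<subseteq> ann n (m + 3) y"
    "ann n (m + 3) y = rat_span (m + 3) {Q, G1, G2}"
proof -
  let ?TP = "tmult (Suc 0) P"
  have multiples_ann: "{P, ?TP} \<subseteq> ann n (m + 3) y" using in_ann_mono[OF P_ann(2,1)] tmult_in_ann[OF P_ann(2,1)] by auto
  have "\<not> {P, ?TP} \<subseteq> rat_span (m + 3) {G1, G2}"
  proof
    assume "{P, ?TP} \<subseteq> rat_span (m + 3) {G1, G2}"
    then have "{P, ?TP} \<subseteq> ann n (Suc (m + 2)) y'"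
      using rat_span_subset_ann[OF pencil(3)] by (simp add: numeral_3_eq_3) blast
    then show False using in_ann_of_Suc[OF P_ann(1), of n y'] P_ann(3) n_eq one_le_m by simp
  qed
  then obtain Q Q' where Q_multiple: "Q \<notin> rat_span (m + 3) {G1, G2}" "{Q, Q'} = {P, ?TP}" by blast
  have QQ'_ann: "{Q, Q'} \<subseteq> ann n (m + 3) y" unfolding Q_multiple(2) by (rule multiples_ann)
  have indep: "lin_indep (m + 3) [G1, G2, Q]"
    using lin_indep_snoc_iff[OF pencil(1), of Q] Q_multiple(1) by simp
  have "ann n (m + 3) y = rat_span (m + 3) (set [G1, G2, Q])"
    unfolding ann_def
  proof (rule orth_eq_rat_span[OF _ indep])
    show "lin_indep (m + 3) (shift_rows n (m + 3) y)"
      by (rule full_rank_lin_indep[OF full_rank]) (use n_eq one_le_m in auto)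
    show "set [G1, G2, Q] \<subseteq> orth (m + 3) (set (shift_rows n (m + 3) y))"
      using pencil(2) QQ'_ann by (auto simp: ann_def)
  qed (use n_eq in simp)
  then have "ann n (m + 3) y = rat_span (m + 3) {Q, G1, G2}" by (simp add: insert_commute)
  then show thesis using that Q_multiple(2) QQ'_ann by blast
qed

text \<open>
  The annihilators \<open>P\<close>, \<open>TP\<close>, \<open>G1\<close>, \<open>G2\<close> of \<open>y\<close> lie in a space of dimension three, so a linear
  multiple of \<open>P\<close> lies in the pencil of \<open>G1\<close>, \<open>G2\<close>.
\<close>

lemma pencil_contains_multiple:
  assumes n_eq: "n = 2 * m + 1" and one_le_m: "1 \<le> m" and full_rank: "full_rank n m y"
    and P_ann: "supp_below (m + 2) P" "P \<in> ann n (m + 2) y" "P \<notin> ann n (m + 2) y'"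
    and pencil: "lin_indep (m + 3) [G1, G2]" "{G1, G2} \<subseteq> ann n (m + 3) y" "{G1, G2} \<subseteq> ann n (m + 3) y'"
  obtains \<alpha> \<beta> Q where "\<alpha> \<noteq> 0 \<or> \<beta> \<noteq> 0"
    "(\<lambda>j. \<alpha> * P j + \<beta> * tmult (Suc 0) P j) \<in> rat_span (m + 3) {G1, G2}"
    "Q \<in> {P, tmult (Suc 0) P}" "ann n (m + 3) y = rat_span (m + 3) {Q, G1, G2}"
proof -
  let ?TP = "tmult (Suc 0) P"
  obtain Q Q' where Q_multiple: "{Q, Q'} = {P, ?TP}" "{Q, Q'} \<subseteq> ann n (m + 3) y"
    and basis: "ann n (m + 3) y = rat_span (m + 3) {Q, G1, G2}"
    by (rule exists_ann_basis_of_pencil[OF assms])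
  have "Q' \<in> rat_span (m + 3) (set (Q # [G1, G2]))" using Q_multiple(2) basis by simp
  then obtain a b where a_nonzero: "a \<noteq> 0"
    and comb: "(\<lambda>j. a * Q' j + b * Q j) \<in> rat_span (m + 3) (set [G1, G2])"
    by (rule rat_span_insertE)
  from Q_multiple(1) consider "Q = P" "Q' = ?TP" | "Q = ?TP" "Q' = P" by (auto simp: doubleton_eq_iff)
  then show thesis
    using that[of b a Q] that[of a b Q] a_nonzero comb basis by cases (simp_all add: add.commute)
qed

text \<open>By the preceding lemma, \<open>P\<close> maps both \<open>u\<close> and \<open>y'\<close> to geometric progressions of the same ratio.\<close>

lemma common_pencil_imp_coplanar:
  assumes n_eq: "n = 2 * m + 1" and one_le_m: "1 \<le> m" and full_rank: "full_rank n m y"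
    and P_ann: "supp_below (m + 2) P" "P \<in> ann n (m + 2) y" "P \<notin> ann n (m + 2) y'"
    and pencil: "lin_indep (m + 3) [G1, G2]" "\<And>x. x \<in> {y, y', u} \<Longrightarrow> {G1, G2} \<subseteq> ann n (m + 3) x"
  shows "u \<in> rat_span (n + 1) {y, y'}"
proof -
  let ?TP = "tmult (Suc 0) P"
  have Suc: "m + 3 = Suc (m + 2)" by simp
  obtain \<alpha> \<beta> Q where coeffs_nonzero: "\<alpha> \<noteq> 0 \<or> \<beta> \<noteq> 0"
    and multiple_in_pencil: "(\<lambda>j. \<alpha> * P j + \<beta> * ?TP j) \<in> rat_span (m + 3) {G1, G2}"
    and Q_multiple: "Q \<in> {P, ?TP}" "ann n (m + 3) y = rat_span (m + 3) {Q, G1, G2}"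
    by (rule pencil_contains_multiple[OF n_eq one_le_m full_rank P_ann pencil(1)]) (use pencil(2) in auto)
  have "(\<lambda>j. \<alpha> * P j + \<beta> * ?TP j) \<in> ann n (Suc (m + 2)) x" if "x \<in> {u, y'}" for x
    using rat_span_subset_ann[OF pencil(2), of x] multiple_in_pencil that unfolding Suc by blast
  then obtain s t where st_nonzero: "s \<noteq> 0 \<or> t \<noteq> 0" and P_ann_w: "P \<in> ann n (m + 2) (\<lambda>j. s * u j + t * y' j)"
    by (rule exists_ann_combination[OF P_ann(1) coeffs_nonzero])
  define w where "w = (\<lambda>j. s * u j + t * y' j)"
  have "s \<noteq> 0"
  proof
    assume "s = 0"
    then have "y' \<in> rat_span (n + 1) {w}"
      using rat_span_base[of w "{w}" "n + 1"] rat_span_scale_iff[of t y'] st_nonzero by (simp add: w_def)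
    then have "P \<in> ann n (m + 2) y'" by (rule in_ann_of_rat_span) (use P_ann_w in \<open>simp add: w_def\<close>)
    then show False using P_ann(3) by simp
  qed
  have "w \<in> rat_span (n + 1) {u, y'}"
    unfolding w_def by (intro rat_span_add rat_span_base) auto
  then have "{G1, G2} \<subseteq> ann n (m + 3) w"
    using in_ann_of_rat_span[of w n "{u, y'}" _ "m + 3"] pencil(2) by auto
  moreover have "{P, ?TP} \<subseteq> ann n (m + 3) w"
    using in_ann_mono[OF P_ann_w P_ann(1)] tmult_in_ann[OF P_ann_w P_ann(1)] by (simp add: w_def)
  ultimately have "{Q, G1, G2} \<subseteq> ann n (m + 3) w" using Q_multiple(1) by blast
  then have "ann n (m + 3) y \<subseteq> ann n (m + 3) w" unfolding Q_multiple(2) by (rule rat_span_subset_ann)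
  then have "w \<in> rat_span (n + 1) {y}"
    unfolding Suc
    by (intro ann_determines_point[where N = "m + 2"] full_rank_lin_indep[OF full_rank]) (use n_eq one_le_m in auto)
  then have "{w, y'} \<subseteq> rat_span (n + 1) {y, y'}"
    using rat_span_mono[of "{y}" "{y, y'}" "n + 1"] by (auto intro: rat_span_base)
  then have "(\<lambda>j. 1 * w j + - t * y' j) \<in> rat_span (n + 1) {y, y'}" by (intro rat_span_add) auto
  then show ?thesis using \<open>s \<noteq> 0\<close> by (simp add: w_def rat_span_scale_iff)
qed

lemma dotp_unit_row_add: "i < N \<Longrightarrow> j < N \<Longrightarrow> dotp N (\<lambda>k. unit_row i k + unit_row j k) f = f i + f j"
  using dotp_add_left[of N 1 "unit_row i" 1 "unit_row j" f] by (simp add: dotp_unit_row)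

lemma dotp_comb_shift_eq: "dotp N (comb_shift R r v) p = dotp R r (\<lambda>k. dotp N (shift k v) p)"
  by (simp add: dotp_comb_shift dotp_def[of R])

lemma columns_proportional_of_singular:
  fixes a1 a2 e1 e2 :: "nat \<Rightarrow> int"
  assumes sing: "\<And>k j. k < m \<Longrightarrow> j < m \<Longrightarrow> a1 k * e2 j + a1 j * e2 k = a2 k * e1 j + a2 j * e1 k"
    and parallel: "\<And>k. k < m \<Longrightarrow> a1 i * e2 k = a2 i * e1 k" and j_coeff: "j < m" "e1 j \<noteq> 0" and k_less: "k < m"
  shows "a2 i * a1 k = a1 i * a2 k"
proof -
  define \<Delta> where "\<Delta> = (\<lambda>k. a2 i * a1 k - a1 i * a2 k)"
  have \<Delta>_sym: "\<Delta> k * e1 j + \<Delta> j * e1 k = 0" if "k < m" "j < m" for k j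
  proof -
    have "\<Delta> k * e1 j + \<Delta> j * e1 k = a1 k * (a2 i * e1 j) + a1 j * (a2 i * e1 k) - a1 i * (a2 k * e1 j + a2 j * e1 k)"
      by (simp add: \<Delta>_def algebra_simps)
    also have "\<dots> = 0"
      unfolding parallel[OF that(1), symmetric] parallel[OF that(2), symmetric] sing[OF that, symmetric]
      by (simp add: algebra_simps)
    finally show ?thesis .
  qed
  have "\<Delta> j = 0" using \<Delta>_sym[OF j_coeff(1) j_coeff(1)] j_coeff(2) by simp
  then have "\<Delta> k = 0" using \<Delta>_sym[OF k_less j_coeff(1)] j_coeff(2) by simp
  then show ?thesis by (simp add: \<Delta>_def)
qed

text \<open>
  A linear space of singular \<open>2 \<times> 2\<close> matrices, spanned by the matrices with rows \<open>(a1 k, a2 k)\<close> and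
  \<open>(b1 k, b2 k)\<close>, has a common left or right kernel.
\<close>

lemma singular_space_kernel_of_nonzero:
  fixes a1 a2 b1 b2 :: "nat \<Rightarrow> int"
  assumes sing: "\<And>i j. i < m \<Longrightarrow> j < m \<Longrightarrow> a1 i * b2 j + a1 j * b2 i = a2 i * b1 j + a2 j * b1 i"
    and i_coeff: "i < m" "a1 i \<noteq> 0"
  shows "(\<exists>s t. (s \<noteq> 0 \<or> t \<noteq> 0) \<and> (\<forall>k<m. s * a1 k + t * b1 k = 0 \<and> s * a2 k + t * b2 k = 0)) \<or>
    (\<exists>c d. (c \<noteq> 0 \<or> d \<noteq> 0) \<and> (\<forall>k<m. c * a1 k + d * a2 k = 0 \<and> c * b1 k + d * b2 k = 0))"
proof -
  define e1 where "e1 = (\<lambda>k. a1 i * b1 k - b1 i * a1 k)"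
  define e2 where "e2 = (\<lambda>k. a1 i * b2 k - b1 i * a2 k)"
  have sing_e: "a1 k * e2 j + a1 j * e2 k = a2 k * e1 j + a2 j * e1 k" if "k < m" "j < m" for k j
  proof -
    have "a1 k * e2 j + a1 j * e2 k - (a2 k * e1 j + a2 j * e1 k) =
      a1 i * ((a1 k * b2 j + a1 j * b2 k) - (a2 k * b1 j + a2 j * b1 k))"
      by (simp add: e1_def e2_def algebra_simps)
    then show ?thesis using sing[OF that] by simp
  qed
  have "e1 i = 0" "e2 i = 0" using sing[OF i_coeff(1) i_coeff(1)] by (auto simp: e1_def e2_def algebra_simps)
  then have parallel: "a1 i * e2 k = a2 i * e1 k" if "k < m" for k using sing_e[OF i_coeff(1) that] by simp
  show ?thesis
  proof (cases "\<forall>k<m. e1 k = 0")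
    case True
    then have "e2 k = 0" if "k < m" for k using parallel[OF that] i_coeff(2) that by simp
    then have "\<forall>k<m. - b1 i * a1 k + a1 i * b1 k = 0 \<and> - b1 i * a2 k + a1 i * b2 k = 0"
      using True by (auto simp: e1_def e2_def)
    then show ?thesis using i_coeff(2) by blast
  next
    case False
    then have a_proportional: "a2 i * a1 k = a1 i * a2 k" if "k < m" for k
      using columns_proportional_of_singular[of m a1 e2 a2 e1 i, OF sing_e parallel] that by blast
    have "a2 i * b1 k = a1 i * b2 k" if k_less: "k < m" for k
    proof -
      have "a1 i * (a2 i * b1 k - a1 i * b2 k) = (a2 i * e1 k - a1 i * e2 k) + b1 i * (a2 i * a1 k - a1 i * a2 k)"
        by (simp add: e1_def e2_def algebra_simps)
      then show ?thesis using parallel[OF k_less] a_proportional[OF k_less] i_coeff(2) by simp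
    qed
    then have "\<forall>k<m. a2 i * a1 k + - a1 i * a2 k = 0 \<and> a2 i * b1 k + - a1 i * b2 k = 0"
      using a_proportional by auto
    then show ?thesis using i_coeff(2) by (metis neg_equal_0_iff_equal)
  qed
qed

lemma singular_space_kernel:
  fixes a1 a2 b1 b2 :: "nat \<Rightarrow> int"
  assumes sing: "\<And>r. r \<in> generic_rows m \<Longrightarrow> dotp m r a1 * dotp m r b2 = dotp m r a2 * dotp m r b1"
  obtains (left) s t where "s \<noteq> 0 \<or> t \<noteq> 0" "\<And>k. k < m \<Longrightarrow> s * a1 k + t * b1 k = 0 \<and> s * a2 k + t * b2 k = 0"
  | (right) c d where "c \<noteq> 0 \<or> d \<noteq> 0" "\<And>k. k < m \<Longrightarrow> c * a1 k + d * a2 k = 0 \<and> c * b1 k + d * b2 k = 0"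
proof -
  have diag: "a1 i * b2 i = a2 i * b1 i" if "i < m" for i
    using sing[OF unit_row_in_generic_rows[OF that]] that by (simp add: dotp_unit_row)
  have polar: "a1 i * b2 j + a1 j * b2 i = a2 i * b1 j + a2 j * b1 i" if "i < m" "j < m" for i j
  proof (cases "i = j")
    case False
    then have "(\<lambda>k. unit_row i k + unit_row j k) \<in> generic_rows m" using that by (auto simp: generic_rows_def)
    from sing[OF this] have "(a1 i + a1 j) * (b2 i + b2 j) = (a2 i + a2 j) * (b1 i + b1 j)"
      using that by (simp add: dotp_unit_row_add)
    then show ?thesis using diag[OF that(1)] diag[OF that(2)] by (simp add: algebra_simps)
  qed (use diag that in simp)
  consider (a1) i where "i < m" "a1 i \<noteq> 0" | (a2) i where "i < m"
    "a2 i \<noteq> 0" | (zero) "\<forall>k<m. a1 k = 0 \<and> a2 k = 0" by blast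
  then show thesis
  proof cases
    case a1
    then show thesis using singular_space_kernel_of_nonzero[of m a1 b2 a2 b1 i, OF polar] left right by blast
  next
    case a2
    have "a2 i * b1 j + a2 j * b1 i = a1 i * b2 j + a1 j * b2 i" if "i < m" "j < m" for i j
      using polar[OF that] by simp
    from singular_space_kernel_of_nonzero[of m a2 b1 a1 b2 i, OF this a2] show thesis
      using left right by (metis add.commute)
  next
    case zero
    then show thesis using left[of 1 0] by simp
  qed
qed

lemma Cramer_orth_pair:
  assumes p_span: "p \<in> rat_span N {S, F1, F2}" "dotp N v p = 0" "dotp N w p = 0"
    and S_orth: "dotp N v S = 0" "dotp N w S = 0"
    and det: "dotp N v F1 * dotp N w F2 \<noteq> dotp N v F2 * dotp N w F1"
  shows "p \<in> rat_span N {S}"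
proof -
  obtain a c where a_nonzero: "a \<noteq> 0" and coeffs: "\<And>j. j < N \<Longrightarrow> a * p j = lincomb [S, F1, F2] c j"
    using p_span(1) rat_span_set_iff[of p N "[S, F1, F2]"] by auto
  have values_eq: "c 1 * dotp N u F1 + c 2 * dotp N u F2 = 0" if "dotp N u p = 0" "dotp N u S = 0" for u
  proof -
    have "a * dotp N u p = dotp N u (lincomb [S, F1, F2] c)"
      unfolding dotp_scale_right[symmetric] using coeffs by (intro dotp_cong) auto
    also have "\<dots> = c 0 * dotp N u S + c 1 * dotp N u F1 + c 2 * dotp N u F2"
      unfolding dotp_lincomb_right by (simp add: numeral_3_eq_3 numeral_2_eq_2)
    finally show ?thesis using that by simp
  qed
  define D where "D = dotp N v F1 * dotp N w F2 - dotp N v F2 * dotp N w F1"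
  have v_relation: "c 1 * dotp N v F1 + c 2 * dotp N v F2 = 0"
    and w_relation: "c 1 * dotp N w F1 + c 2 * dotp N w F2 = 0"
    using values_eq p_span S_orth by auto
  have "c 1 * D = (c 1 * dotp N v F1 + c 2 * dotp N v F2) * dotp N w F2 - (c 1 * dotp N w F1 + c 2 * dotp N w F2) * dotp N v F2"
    "c 2 * D = (c 1 * dotp N w F1 + c 2 * dotp N w F2) * dotp N v F1 - (c 1 * dotp N v F1 + c 2 * dotp N v F2) * dotp N w F1"
    by (simp_all add: D_def algebra_simps)
  then have "c 1 = 0" "c 2 = 0" unfolding v_relation w_relation using det by (simp_all add: D_def)
  then have "a * p j = c 0 * S j" if "j < N" for j using coeffs[OF that] by (simp add: numeral_2_eq_2)
  then show ?thesis using a_nonzero by (auto simp: rat_span_singleton_iff)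
qed

lemma ann_basis_containing:
  assumes n_eq: "n = 2 * m + 1" and one_le_m: "1 \<le> m" and full_rank: "full_rank n m y"
    and S_ann: "nonzero_below (m + 3) S" "S \<in> ann n (m + 3) y"
  obtains F1 F2 where "lin_indep (m + 3) [S, F1, F2]" "ann n (m + 3) y = rat_span (m + 3) {S, F1, F2}"
proof -
  have "lin_indep (m + 3) (shift_rows n (m + 3) y)"
    by (rule full_rank_lin_indep[OF full_rank]) (use n_eq one_le_m in auto)
  then obtain hs where hs: "lin_indep (m + 3) ([S] @ hs)"
    "ann n (m + 3) y = rat_span (m + 3) (set ([S] @ hs))"
    "length (shift_rows n (m + 3) y) + length ([S] @ hs) = m + 3"
    using exists_orth_basis[of "m + 3" "shift_rows n (m + 3) y" "[S]"] S_ann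
    by (auto simp: ann_def lin_indep_singleton)
  then have "length hs = 2" using n_eq by simp
  then obtain F1 F2 where "hs = [F1, F2]" by (auto simp: length_Suc_conv numeral_2_eq_2)
  then show thesis using that hs(1,2) by simp
qed

lemma no_left_kernel:
  assumes n_eq: "n = 2 * m + 1" and one_le_m: "1 \<le> m" and full_rank: "full_rank n m y"
    and indep: "lin_indep (n + 1) [y, u1, u2]"
    and span: "ann n (m + 3) y = rat_span (m + 3) {S, F1, F2}" and st_nonzero: "s \<noteq> 0 \<or> t \<noteq> 0"
  shows "\<not> {S, F1, F2} \<subseteq> ann n (m + 3) (\<lambda>j. s * u1 j + t * u2 j)"
proof
  let ?w = "\<lambda>j. s * u1 j + t * u2 j"
  assume "{S, F1, F2} \<subseteq> ann n (m + 3) ?w"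
  then have "ann n (Suc (m + 2)) y \<subseteq> ann n (Suc (m + 2)) ?w"
    using rat_span_subset_ann[of "{S, F1, F2}" n "m + 3"] span by (simp add: numeral_3_eq_3)
  then have "?w \<in> rat_span (n + 1) {y}"
    by (intro ann_determines_point[where N = "m + 2"] full_rank_lin_indep[OF full_rank]) (use n_eq one_le_m in auto)
  then obtain a b where a_nonzero: "a \<noteq> 0" and proportional: "\<And>j. j < n + 1 \<Longrightarrow> a * ?w j = b * y j"
    unfolding rat_span_singleton_iff by blast
  have "lincomb [y, u1, u2] ((!) [- b, a * s, a * t]) j = 0" if "j < n + 1" for j
    using proportional[OF that] by (simp add: algebra_simps)
  from lin_indepD[OF indep this, of 1] lin_indepD[OF indep this, of 2] show False
    using a_nonzero st_nonzero by auto
qed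

lemma no_right_kernel:
  assumes indep: "lin_indep N [S, F1, F2]" and cd_nonzero: "c \<noteq> 0 \<or> d \<noteq> 0"
  shows "(\<lambda>j. c * F1 j + d * F2 j) \<notin> rat_span N {S}"
proof
  assume "(\<lambda>j. c * F1 j + d * F2 j) \<in> rat_span N {S}"
  then obtain a b where a_nonzero: "a \<noteq> 0" and proportional: "\<And>j. j < N \<Longrightarrow> a * (c * F1 j + d * F2 j) = b * S j"
    unfolding rat_span_singleton_iff by blast
  have "lincomb [S, F1, F2] ((!) [- b, a * c, a * d]) j = 0" if "j < N" for j
    using proportional[OF that] by (simp add: algebra_simps)
  from lin_indepD[OF indep this, of 1] lin_indepD[OF indep this, of 2] show False
    using a_nonzero cd_nonzero by auto
qed

text \<open>
  The \<open>2 \<times> 2\<close> matrices of the values of \<open>F1\<close>, \<open>F2\<close> on the shifts of \<open>u1\<close>, \<open>u2\<close> span a linear space;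
  were it singular, it would have a common left or right kernel.
\<close>

lemma exists_nonsingular_row:
  assumes n_eq: "n = 2 * m + 1" and one_le_m: "1 \<le> m" and full_rank: "full_rank n m y"
    and indep: "lin_indep (n + 1) [y, u1, u2]"
    and S_ann: "{u1, u2} \<subseteq> {x. S \<in> ann n (m + 3) x}"
    and uniq: "ann n (m + 3) y \<inter> ann n (m + 3) u1 \<inter> ann n (m + 3) u2 \<subseteq> rat_span (m + 3) {S}"
    and F_basis: "lin_indep (m + 3) [S, F1, F2]" "ann n (m + 3) y = rat_span (m + 3) {S, F1, F2}"
  obtains r where "r \<in> generic_rows m"
    "dotp (m + 3) (comb_shift m r u1) F1 * dotp (m + 3) (comb_shift m r u2) F2 \<noteq>
      dotp (m + 3) (comb_shift m r u1) F2 * dotp (m + 3) (comb_shift m r u2) F1"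
proof -
  define val where "val = (\<lambda>u F k. dotp (m + 3) (shift k u) F)"
  have ann_val: "F \<in> ann n (m + 3) u \<longleftrightarrow> (\<forall>k<m. val u F k = 0)" for u F
    using n_eq by (auto simp: ann_iff val_def)
  have val_add: "val u (\<lambda>j. c * F j + d * G j) k = c * val u F k + d * val u G k"
    "val (\<lambda>j. c * u j + d * v j) F k = c * val u F k + d * val v F k" for u v F G c d k
    by (simp_all add: val_def dotp_add_right shift_def flip: dotp_add_left)
  have "\<exists>r\<in>generic_rows m. dotp m r (val u1 F1) * dotp m r (val u2 F2) \<noteq> dotp m r (val u1 F2) * dotp m r (val u2 F1)"
  proof (rule ccontr)
    assume singular: "\<not> ?thesis"
    show False
    proof (rule singular_space_kernel[of m "val u1 F1" "val u2 F2" "val u1 F2" "val u2 F1"])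
      fix s t assume st_nonzero: "s \<noteq> 0 \<or> t \<noteq> 0"
        "\<And>k. k < m \<Longrightarrow> s * val u1 F1 k + t * val u2 F1 k = 0 \<and> s * val u1 F2 k + t * val u2 F2 k = 0"
      then have "{S, F1, F2} \<subseteq> ann n (m + 3) (\<lambda>j. s * u1 j + t * u2 j)"
        using S_ann by (simp add: ann_val val_add)
      then show False using no_left_kernel[OF n_eq one_le_m full_rank indep F_basis(2) st_nonzero(1)] by blast
    next
      fix c d assume cd_nonzero: "c \<noteq> 0 \<or> d \<noteq> 0"
        "\<And>k. k < m \<Longrightarrow> c * val u1 F1 k + d * val u1 F2 k = 0 \<and> c * val u2 F1 k + d * val u2 F2 k = 0"
      have "(\<lambda>j. c * F1 j + d * F2 j) \<in> ann n (m + 3) y"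
        unfolding F_basis(2) by (intro rat_span_add rat_span_base) auto
      moreover have "(\<lambda>j. c * F1 j + d * F2 j) \<in> ann n (m + 3) u1 \<inter> ann n (m + 3) u2"
        using cd_nonzero(2) by (simp add: ann_val val_add)
      ultimately show False using uniq no_right_kernel[OF F_basis(1) cd_nonzero(1)] by blast
    qed (use singular in auto)
  qed
  then show thesis using that by (auto simp: dotp_comb_shift_eq val_def)
qed

lemma exists_generic_row:
  assumes n_eq: "n = 2 * m + 1" and one_le_m: "1 \<le> m" and full_rank: "full_rank n m y"
    and indep: "lin_indep (n + 1) [y, u1, u2]"
    and S_ann: "nonzero_below (m + 3) S" "\<And>x. x \<in> {y, u1, u2} \<Longrightarrow> S \<in> ann n (m + 3) x"
    and uniq: "ann n (m + 3) y \<inter> ann n (m + 3) u1 \<inter> ann n (m + 3) u2 \<subseteq> rat_span (m + 3) {S}"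
  obtains r where "r \<in> generic_rows m"
    "ann n (m + 3) y \<inter> orth (m + 3) {comb_shift m r u1, comb_shift m r u2} \<subseteq> rat_span (m + 3) {S}"
proof -
  obtain F1 F2 where F_basis: "lin_indep (m + 3) [S, F1, F2]" "ann n (m + 3) y = rat_span (m + 3) {S, F1, F2}"
    by (rule ann_basis_containing[OF n_eq one_le_m full_rank S_ann(1)]) (use S_ann(2) in auto)
  obtain r where r_generic: "r \<in> generic_rows m"
    "dotp (m + 3) (comb_shift m r u1) F1 * dotp (m + 3) (comb_shift m r u2) F2 \<noteq>
      dotp (m + 3) (comb_shift m r u1) F2 * dotp (m + 3) (comb_shift m r u2) F1"
    by (rule exists_nonsingular_row[OF n_eq one_le_m full_rank indep _ uniq F_basis]) (use S_ann(2) in auto)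
  have "dotp (m + 3) (comb_shift m r u) S = 0" if "u \<in> {u1, u2}" for u
    using S_ann(2)[of u] that n_eq unfolding dotp_comb_shift by (auto simp: ann_iff intro!: sum.neutral)
  then have "p \<in> rat_span (m + 3) {S}"
    if "p \<in> ann n (m + 3) y \<inter> orth (m + 3) {comb_shift m r u1, comb_shift m r u2}" for p
    using that r_generic(2)
    by (intro Cramer_orth_pair[of p _ S F1 F2 "comb_shift m r u1" "comb_shift m r u2"])
      (auto simp: F_basis(2) orth_def)
  then show thesis using that r_generic(1) by blast
qed

locale four_points =
  fixes n m :: nat and y y' u1 u2 P S G :: "nat \<Rightarrow> int"
  assumes n_eq: "n = 2 * m + 1" and one_le_m: "1 \<le> m" and full_rank: "full_rank n m y"
    and indep: "lin_indep (n + 1) [y, y', u1, u2]"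
    and P_ann: "supp_below (m + 2) P" "P \<in> ann n (m + 2) y" "P \<notin> ann n (m + 2) y'"
    and indep_SG: "lin_indep (m + 3) [S, G]" and supp: "supp_below (m + 3) S" "supp_below (m + 3) G"
    and S_ann: "\<And>x. x \<in> {y, y', u1, u2} \<Longrightarrow> S \<in> ann n (m + 3) x"
    and G_ann: "G \<in> ann n (m + 3) y" "G \<in> ann n (m + 3) y'"
begin

lemma no_common_multiple_of_G:
  assumes mult: "\<And>x. x \<in> {u1, u2} \<Longrightarrow> (\<lambda>j. \<alpha> * G j + \<beta> * tmult (Suc 0) G j) \<in> ann n (Suc (m + 3)) x"
  shows "\<alpha> = 0 \<and> \<beta> = 0"
proof (rule ccontr)
  assume "\<not> (\<alpha> = 0 \<and> \<beta> = 0)"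
  then have "\<alpha> \<noteq> 0 \<or> \<beta> \<noteq> 0" by blast
  then obtain s t where st_nonzero: "s \<noteq> 0 \<or> t \<noteq> 0" and G_ann_w: "G \<in> ann n (m + 3) (\<lambda>j. s * u1 j + t * u2 j)"
    by (rule exists_ann_combination[OF supp(2) _ mult])
  let ?w = "\<lambda>j. s * u1 j + t * u2 j"
  have "?w \<in> rat_span (n + 1) {u1, u2}" by (intro rat_span_add rat_span_base) auto
  then have "S \<in> ann n (m + 3) ?w" by (rule in_ann_of_rat_span) (use S_ann in auto)
  then have "?w \<in> rat_span (n + 1) {y, y'}"
    using S_ann G_ann G_ann_w by (intro common_pencil_imp_coplanar[OF n_eq one_le_m full_rank P_ann indep_SG]) auto
  then obtain a c where a_nonzero: "a \<noteq> 0" and coeffs: "\<And>j. j < n + 1 \<Longrightarrow> a * ?w j = lincomb [y, y'] c j"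
    using rat_span_set_iff[of ?w "n + 1" "[y, y']"] by auto
  have "lincomb [y, y', u1, u2] ((!) [- c 0, - c 1, a * s, a * t]) j = 0" if "j < n + 1" for j
    using coeffs[OF that] by (simp add: algebra_simps)
  from lin_indepD[OF indep this, of 2] lin_indepD[OF indep this, of 3] show False
    using a_nonzero st_nonzero by (auto simp: numeral_3_eq_3)
qed

lemma tmults_in_ann: "supp_below (m + 3) q \<Longrightarrow> q \<in> ann n (m + 3) x \<Longrightarrow> {q, tmult (Suc 0) q} \<subseteq> ann n (m + 4) x"
  using in_ann_mono[of q n "m + 3" x] tmult_in_ann[of q n "m + 3" x] by simp

lemma lincomb_multiples_in_ann:
  assumes "lincomb [S, tmult (Suc 0) S, G, tmult (Suc 0) G] c \<in> ann n (m + 4) u1 \<inter> ann n (m + 4) u2"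
  shows "c 2 = 0 \<and> c 3 = 0"
proof (rule no_common_multiple_of_G)
  let ?L = "lincomb [S, tmult (Suc 0) S, G, tmult (Suc 0) G] c"
  fix x assume x_in: "x \<in> {u1, u2}"
  have "?L \<in> ann n (m + 4) x" using assms x_in by blast
  moreover have "(\<lambda>j. c 0 * S j + c 1 * tmult (Suc 0) S j) \<in> ann n (m + 4) x"
    using tmults_in_ann[OF supp(1) S_ann, of x] x_in unfolding ann_def by (intro orth_add) auto
  ultimately have "(\<lambda>j. 1 * ?L j + -1 * (c 0 * S j + c 1 * tmult (Suc 0) S j)) \<in> ann n (m + 4) x"
    unfolding ann_def by (rule orth_add)
  then show "(\<lambda>j. c 2 * G j + c 3 * tmult (Suc 0) G j) \<in> ann n (Suc (m + 3)) x"
    by (simp add: eval_nat_numeral)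
qed

lemma lin_indep_multiples: "lin_indep (m + 4) [S, tmult (Suc 0) S, G, tmult (Suc 0) G]"
  unfolding lin_indep_def
proof (intro allI impI)
  let ?TS = "tmult (Suc 0) S" and ?TG = "tmult (Suc 0) G"
  have "nonzero_below (m + 3) S" using indep_SG by (simp add: lin_indep_pair_iff)
  then have indep_S: "lin_indep (m + 4) [S, ?TS]"
    using lin_indep_tmults[of "m + 2" S 2, unfolded tmults_2] supp(1) by (simp add: eval_nat_numeral)
  fix c i assume rel: "\<forall>j<m + 4. lincomb [S, ?TS, G, ?TG] c j = 0" and i_less: "i < length [S, ?TS, G, ?TG]"
  then have c_eq_0: "c 2 = 0 \<and> c 3 = 0"
    by (intro lincomb_multiples_in_ann IntI zero_in_ann) (auto simp: nonzero_below_def)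
  then have rel_S: "lincomb [S, ?TS] c j = 0" if "j < m + 4" for j
    using rel that by (simp add: eval_nat_numeral)
  have "c 0 = 0" "c 1 = 0" by (rule lin_indepD[OF indep_S rel_S]; simp)+
  then have "\<forall>i\<in>{0, 1, 2, 3}. c i = 0" using c_eq_0 by simp
  moreover have "i \<in> {0, 1, 2, 3}" using i_less by auto
  ultimately show "c i = 0" by blast
qed

lemma orth_Int_ann_subset:
  assumes rs: "lin_indep (m + 4) rs" "length rs = m"
    "ann n (m + 4) y \<inter> ann n (m + 4) y' \<subseteq> orth (m + 4) (set rs)"
  shows "orth (m + 4) (set rs) \<inter> ann n (m + 4) u1 \<inter> ann n (m + 4) u2 \<subseteq> rat_span (m + 4) {S, tmult (Suc 0) S}"
proof clarify
  let ?TS = "tmult (Suc 0) S" and ?TG = "tmult (Suc 0) G"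
  have basis: "orth (m + 4) (set rs) = rat_span (m + 4) (set [S, ?TS, G, ?TG])"
    by (rule orth_eq_rat_span[OF rs(1) lin_indep_multiples]) (use tmults_in_ann supp S_ann G_ann rs(2,3) in auto)
  fix p assume p_ann: "p \<in> orth (m + 4) (set rs)" "p \<in> ann n (m + 4) u1" "p \<in> ann n (m + 4) u2"
  then obtain a c where a_nonzero: "a \<noteq> 0"
    and coeffs: "\<And>j. j < m + 4 \<Longrightarrow> a * p j = lincomb [S, ?TS, G, ?TG] c j"
    unfolding basis rat_span_set_iff by blast
  have "lincomb [S, ?TS, G, ?TG] c \<in> ann n (m + 4) u" if "p \<in> ann n (m + 4) u" for u
    using that a_nonzero coeffs orth_cong[of "m + 4" "\<lambda>j. a * p j" "lincomb [S, ?TS, G, ?TG] c"] ann_scale_iff[OF a_nonzero, of p]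
    unfolding ann_def by blast
  then have "c 2 = 0 \<and> c 3 = 0" using p_ann lincomb_multiples_in_ann by blast
  then have "a * p j = lincomb [S, ?TS] c j" if "j < m + 4" for j
    using coeffs[OF that] by (simp add: eval_nat_numeral)
  then show "p \<in> rat_span (m + 4) {S, ?TS}"
    using a_nonzero rat_span_set_iff[of p "m + 4" "[S, ?TS]"] by auto
qed

end

section \<open>Heights of annihilators\<close>

definition kappa :: "nat \<Rightarrow> real \<Rightarrow> real" where
  "kappa n \<xi> = height_const (n + 1) (n + 1) * det_const n \<xi>"

lemma det_const_le_kappa: "det_const n \<xi> \<le> kappa n \<xi>"
  unfolding kappa_def
  using mult_right_mono[OF height_const_ge_1[of "n + 1" "n + 1"], of "det_const n \<xi>"]
    row_const_le_det_const[of n \<xi>] row_const_ge_1[of n \<xi>] by simp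

lemma kappa_ge_power_bound: "1 + power_bound n \<xi> \<le> kappa n \<xi>"
  using row_const_ge_power_bound row_const_le_det_const det_const_le_kappa order_trans by meson

lemma kappa_ge_1: "1 \<le> kappa n \<xi>"
  using kappa_ge_power_bound[of n \<xi>] power_bound_ge_1[of n \<xi>] by linarith

lemma hgt_power_le_of_point_rows:
  assumes N_eq: "N = d + q" "1 \<le> N" "N \<le> n + 1" and R_le: "R + N \<le> n + 2" "r \<in> generic_rows R"
    and Q_ge_1: "1 \<le> Q" and gap: "0 < gap n \<xi>"
    and vs: "near_points n \<xi> Q vs es"
    and y_span: "y \<in> rat_span (n + 1) (set vs)" "near_curve n \<xi> y M" and ks: "\<And>k. k \<in> set ks \<Longrightarrow> k + N \<le> n + 1"
    and ws: "near_rows n N \<xi> Q ws fs"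
    and len: "length vs + length ks + length ws = d"
    and p_primitive: "primitive p" "supp_below (Suc d) p"
    and span: "orth N (set (map (comb_shift R r) vs @ map (\<lambda>k. shift k y) ks @ ws)) = rat_span N (set (tmults q p))"
  shows "hgt (Suc d) p ^ q \<le> kappa n \<xi> * (Q * (prod_list es * M ^ length ks * prod_list fs))"
proof -
  let ?rows = "map (comb_shift R r) vs @ map (\<lambda>k. shift k y) ks @ ws"
  obtain h
    where hgt_le: "hgt (Suc d) p ^ q \<le> height_const d q * \<bar>real_of_int (det (rows_mat N (?rows @ unit_rows h q)))\<bar>"
    using hgt_power_le_det[OF p_primitive, of ?rows q] len span N_eq(1) by auto
  have "near_rows n N \<xi> Q (ws @ unit_rows h q) (fs @ replicate q 1)"
    using ws near_row_unit_row[OF N_eq(2,3) Q_ge_1]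
    by (intro list_all2_appendI) (auto simp: list_all2_conv_all_nth)
  from abs_det_point_rows_le[OF N_eq(2,3) R_le Q_ge_1 gap vs y_span ks this]
  have "\<bar>real_of_int (det (rows_mat N (map (comb_shift R r) vs @ map (\<lambda>k. shift k y) ks @ ws @ unit_rows h q)))\<bar>
      \<le> det_const n \<xi> * (Q * (prod_list es * M ^ length ks * prod_list (fs @ replicate q 1)))"
    using len N_eq(1) by auto
  then have det: "\<bar>real_of_int (det (rows_mat N (?rows @ unit_rows h q)))\<bar> \<le> det_const n \<xi> * (Q * (prod_list es * M ^ length ks * prod_list fs))"
    by simp
  have const: "height_const d q \<le> height_const (n + 1) (n + 1)" using N_eq by (intro height_const_mono) auto
  have "height_const d q * \<bar>real_of_int (det (rows_mat N (?rows @ unit_rows h q)))\<bar>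
      \<le> height_const (n + 1) (n + 1) * (det_const n \<xi> * (Q * (prod_list es * M ^ length ks * prod_list fs)))"
    by (rule mult_mono[OF const det]) (use height_const_ge_1[of "n + 1" "n + 1"] in auto)
  with hgt_le show ?thesis by (simp add: kappa_def mult.assoc)
qed

lemma low_degree_ann_height:
  assumes gap: "0 < gap n \<xi>" and d_bounds: "1 \<le> d" "2 * d \<le> n + 1"
    and no_ann: "\<And>q. q \<in> ann n d x \<Longrightarrow> \<not> nonzero_below d q"
    and p_primitive: "primitive p" "supp_below (Suc d) p" "p \<in> ann n (Suc d) x"
    and near: "near_curve n \<xi> x L" and L_bounds: "0 < L" "L \<le> \<bar>real_of_int (x 0)\<bar>"
  shows "hgt (Suc d) p ^ (n + 2 - 2 * d) \<le> kappa n \<xi> * (\<bar>real_of_int (x 0)\<bar> * L ^ (d - 1))"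
proof -
  define q where "q = n + 2 - 2 * d"
  let ?N = "d + q" and ?Q = "\<bar>real_of_int (x 0)\<bar> / L"
  have dual_length: "n + 2 - ?N = d" "?N = n + 2 - d" using d_bounds by (auto simp: q_def)
  have "[0..<d] = 0 # [1..<d]" using d_bounds(1) by (simp add: upt_conv_Cons)
  then have rows: "map (comb_shift 1 (unit_row 0)) [x] @ map (\<lambda>k. shift k x) [1..<d] @ [] = shift_rows n ?N x"
    using dual_length(1) by (simp add: shift_rows_def comb_shift_unit_row)
  have "hgt (Suc d) p ^ q \<le> kappa n \<xi> * (?Q * (prod_list [L] * L ^ length [1..<d] * prod_list []))"
  proof (rule hgt_power_le_of_point_rows)
    show "x \<in> rat_span (n + 1) (set [x])" by (simp add: rat_span_base)
    show "k + ?N \<le> n + 1" if "k \<in> set [1..<d]" for k using that dual_length(2) d_bounds by auto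
    show "orth ?N (set (map (comb_shift 1 (unit_row 0)) [x] @ map (\<lambda>k. shift k x) [1..<d] @ [])) = rat_span ?N (set (tmults q p))"
      unfolding rows
      using ann_eq_rat_span_tmults[OF d_bounds no_ann p_primitive(2) primitive_nonzero[OF p_primitive(1,2)] p_primitive(3) dual_length(2)]
        by (simp add: ann_def)
  qed (use d_bounds near L_bounds p_primitive(1,2) gap in \<open>auto simp: q_def unit_row_in_generic_rows\<close>)
  also have "?Q * (prod_list [L] * L ^ length [1..<d] * prod_list []) = \<bar>real_of_int (x 0)\<bar> * L ^ (d - 1)"
    using L_bounds(1) by simp
  finally show ?thesis unfolding q_def .
qed

lemma abs_dotp_shift_diff_le:
  assumes "k + N \<le> n + 1" "near_curve n \<xi> x L"
  shows "\<bar>real_of_int (dotp N (shift k x) p) - real_of_int (x 0) * \<xi> ^ k * poly_value N p \<xi>\<bar> \<le> hgt N p * L"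
proof -
  have "real_of_int (dotp N (shift k x) p) - real_of_int (x 0) * \<xi> ^ k * poly_value N p \<xi> =
    (\<Sum>j<N. real_of_int (p j) * (real_of_int (x (k + j)) - real_of_int (x 0) * \<xi> ^ (k + j)))"
    by (simp add: dotp_def shift_def poly_value_def sum_distrib_left right_diff_distrib sum_subtractf power_add mult_ac)
  also have "\<bar>\<dots>\<bar> \<le> (\<Sum>j<N. \<bar>real_of_int (p j)\<bar> * L)"
    by (rule order.trans[OF sum_abs], rule sum_mono)
      (use assms in \<open>auto simp: abs_mult near_curve_def intro!: mult_left_mono\<close>)
  also have "\<dots> = hgt N p * L" by (simp add: hgt_def sum_distrib_right)
  finally show ?thesis .
qed

lemma hgt_ge_of_not_in_ann:
  assumes N_bounds: "1 \<le> N" "N \<le> n + 1" and p_ann: "p \<in> ann n N x" "p \<notin> ann n N x'"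
    and near: "near_curve n \<xi> x L" "near_curve n \<xi> x' L'" and L_le: "L \<le> L'"
    and x'_0_le: "\<bar>real_of_int (x' 0)\<bar> \<le> \<bar>real_of_int (x 0)\<bar>"
  shows "1 \<le> kappa n \<xi> * (hgt N p * L')"
proof -
  define v where "v = poly_value N p \<xi>"
  have value_le: "\<bar>real_of_int (x 0)\<bar> * \<bar>v\<bar> \<le> hgt N p * L"
    using abs_dotp_shift_diff_le[OF _ near(1), of 0 N p] annD[OF p_ann(1), of 0] N_bounds(2)
    by (simp add: v_def abs_mult)
  obtain k where k_value: "k + N \<le> n + 1" "dotp N (shift k x') p \<noteq> 0" using p_ann(2) by (auto simp: ann_iff)
  then have "1 \<le> \<bar>real_of_int (dotp N (shift k x') p)\<bar>" by linarith
  also have "\<dots> \<le> \<bar>\<xi> ^ k\<bar> * (\<bar>real_of_int (x' 0)\<bar> * \<bar>v\<bar>) + hgt N p * L'"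
    using abs_dotp_shift_diff_le[OF k_value(1) near(2), of p] by (simp add: v_def abs_mult[symmetric] mult_ac)
  also have "\<dots> \<le> power_bound n \<xi> * (hgt N p * L') + hgt N p * L'"
  proof (rule add_right_mono, rule mult_mono[OF abs_power_le_power_bound])
    have "\<bar>real_of_int (x' 0)\<bar> * \<bar>v\<bar> \<le> \<bar>real_of_int (x 0)\<bar> * \<bar>v\<bar>" using x'_0_le by (intro mult_right_mono) auto
    also note value_le
    also have "hgt N p * L \<le> hgt N p * L'" using L_le by (intro mult_left_mono) auto
    finally show "\<bar>real_of_int (x' 0)\<bar> * \<bar>v\<bar> \<le> hgt N p * L'" .
  qed (use k_value(1) N_bounds(1) power_bound_ge_1[of n \<xi>] in auto)
  also have "\<dots> = (1 + power_bound n \<xi>) * (hgt N p * L')" by (simp add: algebra_simps)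
  also have "\<dots> \<le> kappa n \<xi> * (hgt N p * L')"
    using near_curve_nonneg[OF near(2)] by (intro mult_right_mono kappa_ge_power_bound) auto
  finally show ?thesis .
qed

text \<open>Dividing the relation \<open>dotp N (x k) p = 0\<close> by \<open>x k 0\<close> makes \<open>\<xi>\<close> a root of \<open>p\<close> in the limit.\<close>

lemma eventually_not_in_ann:
  assumes no_root: "no_int_root n \<xi>" and p_nonzero: "nonzero_below N p" "N \<le> n + 1"
    and x_near: "\<And>k. near_curve n \<xi> (x k) (L k)" "\<And>k. 1 \<le> x k 0" and L_tendsto_0: "L \<longlonglongrightarrow> 0"
  shows "\<forall>\<^sub>F k in sequentially. p \<notin> ann n N (x k)"
proof -
  define v where "v = poly_value N p \<xi>"
  have v_pos: "0 < \<bar>v\<bar>" using poly_value_nonzero[OF no_root p_nonzero] by (simp add: v_def)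
  have "\<bar>v\<bar> \<le> hgt N p * L k" if "p \<in> ann n N (x k)" for k
  proof -
    have "1 * \<bar>v\<bar> \<le> \<bar>real_of_int (x k 0)\<bar> * \<bar>v\<bar>" using x_near(2)[of k] by (intro mult_right_mono) auto
    also have "\<dots> \<le> hgt N p * L k"
      using abs_dotp_shift_diff_le[OF _ x_near(1), of 0 N k p] annD[OF that, of 0] p_nonzero(2)
      by (simp add: v_def abs_mult)
    finally show ?thesis by simp
  qed
  moreover have "(\<lambda>k. hgt N p * L k) \<longlonglongrightarrow> 0"
    using tendsto_mult[OF tendsto_const L_tendsto_0, of "hgt N p"] by simp
  then have "\<forall>\<^sub>F k in sequentially. hgt N p * L k < \<bar>v\<bar>" using v_pos by (rule order_tendstoD)
  ultimately show ?thesis by (elim eventually_mono) fastforce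
qed

section \<open>Sequences of points spanning consecutive planes\<close>

definition common_ann :: "nat \<Rightarrow> nat \<Rightarrow> (nat \<Rightarrow> int) set \<Rightarrow> (nat \<Rightarrow> int) set" where
  "common_ann n N Y = (\<Inter>x\<in>Y. ann n N x)"

definition all_shifts :: "nat \<Rightarrow> nat \<Rightarrow> (nat \<Rightarrow> int) set \<Rightarrow> (nat \<Rightarrow> int) set" where
  "all_shifts n N Y = (\<Union>x\<in>Y. set (shift_rows n N x))"

lemma orth_all_shifts: "orth N (all_shifts n N Y) = common_ann n N Y"
  by (auto simp: all_shifts_def common_ann_def ann_def orth_def)

lemma all_shiftsE:
  assumes "w \<in> all_shifts n N Y"
  obtains l x where "x \<in> Y" "l + N \<le> n + 1" "w = shift l x"
proof -
  obtain l x where "x \<in> Y" "l < n + 2 - N" "w = shift l x"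
    using assms by (auto simp: all_shifts_def shift_rows_def)
  then show thesis using that[of x l] by simp
qed

lemma common_ann_insert [simp]: "common_ann n N (insert x Y) = ann n N x \<inter> common_ann n N Y"
  by (simp add: common_ann_def)

lemma common_ann_empty [simp]: "common_ann n N {} = UNIV"
  by (simp add: common_ann_def)

lemma length_remove1_upt: "k < N \<Longrightarrow> length (remove1 k [0..<N]) = N - 1"
  by (simp add: length_remove1)

lemma set_remove1_upt: "set (remove1 k [0..<N]) = {..<N} - {k}"
  by (auto simp: set_remove1_eq)

text \<open>
  In the application \<open>y k\<close> is a best approximation that is independent of its two neighbours, \<open>yp k\<close> is
  the best approximation following \<open>y k\<close>, \<open>H (Suc k)\<close> is the height of \<open>yp k\<close>, and \<open>M k\<close> is the distance
  of \<open>y k\<close> from the curve; \<open>H 0\<close> is a dummy.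
\<close>

locale point_sequence =
  fixes n m :: nat and \<xi> :: real and y yp :: "nat \<Rightarrow> nat \<Rightarrow> int" and H M :: "nat \<Rightarrow> real"
  assumes n_eq: "n = 2 * m + 1" and two_le_m: "2 \<le> m"
    and no_root: "no_int_root n \<xi>"
    and full_rank: "full_rank n m (y k)"
    and primitive_y: "primitive (y k)"
    and supp_y: "supp_below (n + 1) (y k)"
    and y_pos: "1 \<le> y k 0"
    and y_mono: "y k 0 \<le> y (Suc k) 0"
    and y_le_H: "real_of_int (y k 0) \<le> H (Suc k)"
    and yp_le_H: "\<bar>real_of_int (yp k 0)\<bar> \<le> H (Suc k)"
    and near: "near_curve n \<xi> (y k) (M k)"
    and near_yp: "near_curve n \<xi> (yp k) (M k)"
    and plane: "y (Suc k) \<in> rat_span (n + 1) {y k, yp k}"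
    and indep3: "lin_indep (n + 1) [y k, y (Suc k), y (Suc (Suc k))]"
    and H_gt_1: "1 < H k" and H_Suc: "H k \<le> H (Suc k)"
    and M_pos: "0 < M k" and M_le_1: "M k \<le> 1" and M_Suc: "M (Suc k) \<le> M k"
begin

lemma H_mono: "i \<le> j \<Longrightarrow> H i \<le> H j"
  by (rule lift_Suc_mono_le[of H, OF H_Suc])

lemma M_antimono: "i \<le> j \<Longrightarrow> M j \<le> M i"
  by (rule lift_Suc_antimono_le[of M, OF M_Suc])

lemma gap: "0 < gap n \<xi>"
  by (rule gap_pos[OF no_root])

lemma Q_ge_1: "1 \<le> H (Suc k) / M k"
  using M_le_1[of k] H_gt_1[of "Suc k"] M_pos[of k] by simp

lemma indep2: "lin_indep (n + 1) [y k, y (Suc k)]"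
  using lin_indep_appendD[of "n + 1" "[y k, y (Suc k)]" "[y (Suc (Suc k))]"] indep3 by simp

lemma indep2': "lin_indep (n + 1) [y (Suc k), y k]"
  by (rule lin_indep_perm[OF indep2]) auto

lemma rat_span_pair: "rat_span (n + 1) {y k, y (Suc k)} = rat_span (n + 1) {y k, yp k}"
  using rat_span_eq_of_length[OF indep2[of k], of "[y k, yp k]"] plane[of k] by (simp add: rat_span_base)

lemma near_row_shift_y:
  assumes "l + N \<le> n + 1" "1 \<le> N" "i \<le> k" "i0 \<le> i"
  shows "near_row N \<xi> (H (Suc k) / M k) (\<lambda>j. real_of_int (shift l (y i) j)) (row_const n \<xi> * M i0)"
proof -
  let ?Q = "H (Suc k) / M k"
  have "\<bar>real_of_int (y i 0)\<bar> \<le> H (Suc i)" using y_le_H[of i] y_pos[of i] by simp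
  also have "\<dots> \<le> H (Suc k)" using H_mono assms(3) by simp
  also have "\<dots> = ?Q * M k" using M_pos[of k] by simp
  also have "\<dots> \<le> ?Q * M i" using M_antimono[OF assms(3)] Q_ge_1[of k] by (intro mult_left_mono) auto
  finally have "near_row N \<xi> ?Q (\<lambda>j. real_of_int (shift l (y i) j)) (row_const n \<xi> * M i)"
    by (intro near_row_shift near assms Q_ge_1)
  moreover have "row_const n \<xi> * M i \<le> row_const n \<xi> * M i0"
    using M_antimono[OF assms(4)] row_const_ge_1[of n \<xi>] by (intro mult_left_mono) auto
  ultimately show ?thesis by (rule near_row_mono) (use Q_ge_1[of k] in linarith)
qed

lemma near_y_yp:
  "near_points n \<xi> (H (Suc k) / M k) [y k, yp k] [M k, M k]"
  using near near_yp y_le_H[of k] y_pos[of k] yp_le_H[of k] M_pos[of k] by simp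

text \<open>
  The space \<open>ann n N (y (Suc k)) \<inter> orth N {shift k0 (y k)}\<close> is cut out by rows that involve the best
  approximation \<open>yp k\<close> in place of one shift of the larger point \<open>y (Suc k)\<close>.
\<close>

definition pair_rows :: "nat \<Rightarrow> nat \<Rightarrow> nat \<Rightarrow> (nat \<Rightarrow> int) list" where
  "pair_rows k N k0 = [shift k0 (y k), shift k0 (yp k)] @ map (\<lambda>l. shift l (y (Suc k))) (remove1 k0 [0..<n + 2 - N])"

lemma pair_rows_eq:
  assumes "k0 + N \<le> n + 1"
  shows "pair_rows k N k0 = map (comb_shift (n + 2 - N) (unit_row k0)) [y k, yp k] @
    map (\<lambda>l. shift l (y (Suc k))) (remove1 k0 [0..<n + 2 - N])"
  using assms by (simp add: pair_rows_def comb_shift_unit_row)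

lemma length_pair_rows: "k0 + N \<le> n + 1 \<Longrightarrow> length (pair_rows k N k0) = n + 3 - N"
  by (simp add: pair_rows_def length_remove1_upt)

lemma orth_pair_rows:
  assumes k0_le: "k0 + N \<le> n + 1"
  shows "orth N (set (pair_rows k N k0)) = ann n N (y (Suc k)) \<inter> orth N {shift k0 (y k)}"
proof (intro antisym subsetI IntI)
  fix p assume p_orth: "p \<in> orth N (set (pair_rows k N k0))"
  then have y_k_orth: "dotp N (shift k0 (y k)) p = 0" "dotp N (shift k0 (yp k)) p = 0"
    by (auto simp: pair_rows_def orth_def)
  then have "p \<in> orth N (rat_span N (shift k0 ` {y k, yp k}))" unfolding orth_rat_span by (simp add: orth_def)
  then have "dotp N (shift k0 (y (Suc k))) p = 0" using shift_in_rat_span[OF plane k0_le] by (rule orthD)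
  moreover have "dotp N (shift l (y (Suc k))) p = 0" if "l + N \<le> n + 1" "l \<noteq> k0" for l
    using p_orth that by (auto simp: pair_rows_def set_remove1_upt intro!: orthD[OF p_orth])
  ultimately show "p \<in> ann n N (y (Suc k))" unfolding ann_iff by metis
  show "p \<in> orth N {shift k0 (y k)}" using y_k_orth(1) by (simp add: orth_def)
next
  fix p assume p_ann: "p \<in> ann n N (y (Suc k)) \<inter> orth N {shift k0 (y k)}"
  then have "p \<in> orth N (rat_span N (shift k0 ` {y k, y (Suc k)}))"
    using annD[of p n N "y (Suc k)" k0] k0_le unfolding orth_rat_span by (simp add: orth_def)
  moreover have "yp k \<in> rat_span (n + 1) {y k, y (Suc k)}"
    unfolding rat_span_pair by (simp add: rat_span_base)
  from shift_in_rat_span[OF this k0_le] have "shift k0 (yp k) \<in> rat_span N (shift k0 ` {y k, y (Suc k)})" .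
  ultimately have "dotp N (shift k0 (yp k)) p = 0" by (rule orthD)
  then show "p \<in> orth N (set (pair_rows k N k0))"
    using p_ann by (auto simp: pair_rows_def orth_def set_remove1_upt ann_iff)
qed

lemma orth_pair_rows_append:
  assumes "k0 + N \<le> n + 1"
  shows "orth N (set (pair_rows k N k0 @ ts)) = orth N (set (shift_rows n N (y (Suc k)) @ shift k0 (y k) # ts))"
  using orth_pair_rows[OF assms] by (auto simp: orth_Un orth_insert ann_def orth_def)

lemma pair_rows_prod:
  "H (Suc k) / M k * (prod_list [M k, M k] * L * z) = H (Suc k) * M k * L * z"
  using M_pos[of k] by simp

lemma pair_rows_growth:
  assumes N_bounds: "1 \<le> N" and k0_le: "k0 + N \<le> n + 1" and len: "n + 3 - N + length ts = N"
    and indep: "lin_indep N (shift_rows n N (y (Suc k)) @ shift k0 (y k) # ts)"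
    and ts: "near_rows n N \<xi> (H (Suc k) / M k) ts es"
  shows "1 \<le> kappa n \<xi> * (H (Suc k) * M k * M (Suc k) ^ (n + 1 - N) * prod_list es)"
proof -
  let ?rows = "pair_rows k N k0 @ ts" and ?rows' = "shift_rows n N (y (Suc k)) @ shift k0 (y k) # ts"
  have len': "length ?rows = N" "length ?rows' = N" using len k0_le by (simp_all add: length_pair_rows)
  have "\<not> nonzero_below N p" if "p \<in> orth N (set ?rows)" for p
    using that indep det_rows_mat_eq_0_iff[OF len'(2)] lin_indep_iff_det[OF len'(2)]
    unfolding orth_pair_rows_append[OF k0_le] by blast
  then have "1 \<le> \<bar>real_of_int (det (rows_mat N ?rows))\<bar>" by (rule abs_det_rows_mat_ge_1[OF len'(1)])
  also have "\<dots> \<le> det_const n \<xi> * (H (Suc k) / M k * (prod_list [M k, M k] *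
      M (Suc k) ^ length (remove1 k0 [0..<n + 2 - N]) * prod_list es))"
    unfolding pair_rows_eq[OF k0_le] append_assoc
    by (rule abs_det_point_rows_le[OF _ _ _ _ Q_ge_1 gap near_y_yp _ near _ ts])
      (use N_bounds k0_le len plane in \<open>auto simp: unit_row_in_generic_rows set_remove1_upt length_remove1_upt\<close>)
  also have "length (remove1 k0 [0..<n + 2 - N]) = n + 1 - N" using k0_le by (simp add: length_remove1_upt)
  finally have ge_1: "1 \<le> det_const n \<xi> * (H (Suc k) * M k * M (Suc k) ^ (n + 1 - N) * prod_list es)"
    unfolding pair_rows_prod .
  have "1 \<le> kappa n \<xi> * B" if "1 \<le> det_const n \<xi> * B" for B
  proof -
    have "0 < det_const n \<xi>" using row_const_ge_1[of n \<xi>] row_const_le_det_const[of n \<xi>] by linarith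
    then have "0 \<le> B" using that zero_less_mult_pos[of "det_const n \<xi>" B] by simp
    then show ?thesis using that mult_right_mono[OF det_const_le_kappa[of n \<xi>], of B] by linarith
  qed
  then show ?thesis using ge_1 .
qed

lemma pair_rows_height:
  assumes N_eq: "N = d + q" "1 \<le> N" and k0_le: "k0 + N \<le> n + 1" and len: "n + 3 - N + length ts = d"
    and ts: "near_rows n N \<xi> (H (Suc k) / M k) ts es"
    and p_primitive: "primitive p" "supp_below (Suc d) p"
    and span: "orth N (set (shift_rows n N (y (Suc k)) @ shift k0 (y k) # ts)) = rat_span N (set (tmults q p))"
  shows "hgt (Suc d) p ^ q \<le> kappa n \<xi> * (H (Suc k) * M k * M (Suc k) ^ (n + 1 - N) * prod_list es)"
proof -
  have "hgt (Suc d) p ^ q \<le> kappa n \<xi> * (H (Suc k) / M k * (prod_list [M k, M k] *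
      M (Suc k) ^ length (remove1 k0 [0..<n + 2 - N]) * prod_list es))"
  proof (rule hgt_power_le_of_point_rows[OF N_eq _ _ _ Q_ge_1 gap near_y_yp _ near _ ts _ p_primitive])
    show "orth N (set (map (comb_shift (n + 2 - N) (unit_row k0)) [y k, yp k] @
        map (\<lambda>l. shift l (y (Suc k))) (remove1 k0 [0..<n + 2 - N]) @ ts)) = rat_span N (set (tmults q p))"
      unfolding span[symmetric] orth_pair_rows_append[OF k0_le, symmetric] pair_rows_eq[OF k0_le] append_assoc ..
  qed (use k0_le len plane in \<open>auto simp: unit_row_in_generic_rows set_remove1_upt length_remove1_upt\<close>)
  also have "length (remove1 k0 [0..<n + 2 - N]) = n + 1 - N" using k0_le by (simp add: length_remove1_upt)
  finally show ?thesis unfolding pair_rows_prod .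
qed

lemma lin_indep_shift_rows_y: "m + 2 \<le> N \<Longrightarrow> N \<le> n + 1 \<Longrightarrow> lin_indep N (shift_rows n N (y k))"
  by (rule full_rank_lin_indep[OF full_rank]) (use n_eq in auto)

lemma plane_height_growth:
  assumes "p \<in> ann n (m + 2) (y (Suc k))" "p \<notin> ann n (m + 2) (y k)"
  shows "1 \<le> kappa n \<xi> * (H (Suc k) * M k * M (Suc k) ^ m)"
proof -
  obtain k0 where k0_value: "k0 + (m + 2) \<le> n + 1" "dotp (m + 2) (shift k0 (y k)) p \<noteq> 0"
    using assms(2) by (auto simp: ann_iff)
  have "lin_indep (m + 2) (shift_rows n (m + 2) (y (Suc k)))"
    by (rule lin_indep_shift_rows_y) (use n_eq in auto)
  then have "lin_indep (m + 2) (shift_rows n (m + 2) (y (Suc k)) @ [shift k0 (y k)])"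
    using assms(1) k0_value(2) unfolding ann_def by (rule lin_indep_snocI)
  then show ?thesis using pair_rows_growth[of "m + 2" k0 "[]" k "[]"] k0_value(1) n_eq by simp
qed

lemma exists_indep_shift:
  assumes N_bounds: "m + 3 \<le> N" "N \<le> m + 4"
  obtains k0 where "k0 + N \<le> n + 1" "lin_indep N (shift_rows n N (y (Suc k)) @ [shift k0 (y k)])"
proof -
  obtain N' where N': "N = Suc N'" using N_bounds(1) by (cases N) auto
  have "\<not> ann n N (y (Suc k)) \<subseteq> ann n N (y k)"
  proof
    assume "ann n N (y (Suc k)) \<subseteq> ann n N (y k)"
    then have "y k \<in> rat_span (n + 1) {y (Suc k)}"
      unfolding N'
      by (intro ann_determines_point lin_indep_shift_rows_y) (use N_bounds N' n_eq two_le_m in auto)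
    then show False using indep2'[of k] by (simp add: lin_indep_pair_iff)
  qed
  then obtain p where p_ann: "p \<in> ann n N (y (Suc k))" "p \<notin> ann n N (y k)" by blast
  then obtain k0 where k0_value: "k0 + N \<le> n + 1" "dotp N (shift k0 (y k)) p \<noteq> 0" by (auto simp: ann_iff)
  have "lin_indep N (shift_rows n N (y (Suc k)))"
    by (rule lin_indep_shift_rows_y) (use N_bounds n_eq two_le_m in auto)
  then have "lin_indep N (shift_rows n N (y (Suc k)) @ [shift k0 (y k)])"
    using p_ann(1) k0_value(2) unfolding ann_def by (rule lin_indep_snocI)
  then show thesis using that k0_value(1) by blast
qed

lemma ann_Int_ann_subset_orth:
  "k0 + N \<le> n + 1 \<Longrightarrow> ann n N (y (Suc k)) \<inter> ann n N (y k) \<subseteq> orth N (set (shift_rows n N (y (Suc k)) @ [shift k0 (y k)]))"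
  using annD[of _ n N "y k" k0]
  by (auto simp: orth_Un orth_insert ann_def[of n N "y (Suc k)"] orth_def[of N "{}"])

lemma extend_pair_rows:
  assumes base_indep: "lin_indep N (shift_rows n N (y (Suc k)) @ shift k0 (y k) # rs)"
  obtains ts where "set ts \<subseteq> all_shifts n N Y"
    "lin_indep N (shift_rows n N (y (Suc k)) @ shift k0 (y k) # rs @ ts)"
    "orth N (set (shift_rows n N (y (Suc k)) @ shift k0 (y k) # rs @ ts)) \<subseteq> orth N (set rs) \<inter> common_ann n N (insert (y (Suc k)) Y)"
proof (rule lin_indep_extend[OF base_indep, of "all_shifts n N Y"])
  fix ts assume ts: "set ts \<subseteq> all_shifts n N Y"
    "lin_indep N ((shift_rows n N (y (Suc k)) @ shift k0 (y k) # rs) @ ts)"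
    "orth N (set ((shift_rows n N (y (Suc k)) @ shift k0 (y k) # rs) @ ts)) \<subseteq> orth N (all_shifts n N Y)"
  show thesis
    by (rule that[of ts]) (use ts in \<open>auto simp: orth_all_shifts orth_Un orth_insert ann_def\<close>)
qed

lemma near_row_all_shifts:
  assumes "set ts \<subseteq> all_shifts n N (y ` I)" "\<And>i. i \<in> I \<Longrightarrow> i0 \<le> i \<and> i \<le> k" "1 \<le> N"
  shows "near_rows n N \<xi> (H (Suc k) / M k) ts (replicate (length ts) (M i0))"
proof (rule list_all2_all_nthI)
  fix j assume j_less: "j < length ts"
  then have "ts ! j \<in> all_shifts n N (y ` I)" using assms(1) nth_mem by blast
  then obtain l i where "i \<in> I" "l + N \<le> n + 1" "ts ! j = shift l (y i)" by (auto elim!: all_shiftsE)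
  then show "near_row N \<xi> (H (Suc k) / M k) (\<lambda>i. real_of_int ((ts ! j) i)) (row_const n \<xi> * replicate (length ts) (M i0) ! j)"
    using near_row_shift_y[of l N i k i0] assms(2)[of i] assms(3) j_less by simp
qed simp

lemma growth_of_no_common_ann:
  assumes no_common: "\<And>p. p \<in> common_ann n (m + 3) {y k, y (Suc k), y (Suc (Suc k))} \<Longrightarrow> \<not> nonzero_below (m + 3) p"
  shows "1 \<le> kappa n \<xi> * (H (Suc (Suc k)) * M (Suc k) * M (Suc (Suc k)) ^ (m - 1) * (M k)\<^sup>2)"
proof -
  obtain k0 where k0_le: "k0 + (m + 3) \<le> n + 1"
    and base_indep: "lin_indep (m + 3) (shift_rows n (m + 3) (y (Suc (Suc k))) @ [shift k0 (y (Suc k))])"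
    by (rule exists_indep_shift[of "m + 3" "Suc k"]) auto
  obtain ts where ts: "set ts \<subseteq> all_shifts n (m + 3) (y ` {k, Suc k})"
    and indep: "lin_indep (m + 3) (shift_rows n (m + 3) (y (Suc (Suc k))) @ shift k0 (y (Suc k)) # [] @ ts)"
    and orth: "orth (m + 3) (set (shift_rows n (m + 3) (y (Suc (Suc k))) @ shift k0 (y (Suc k)) # [] @ ts))
      \<subseteq> orth (m + 3) (set []) \<inter> common_ann n (m + 3) (insert (y (Suc (Suc k))) (y ` {k, Suc k}))"
    by (rule extend_pair_rows[OF base_indep])
  have "\<not> nonzero_below (m + 3) p"
    if "p \<in> orth (m + 3) (set (shift_rows n (m + 3) (y (Suc (Suc k))) @ shift k0 (y (Suc k)) # ts))" for p
    using that orth no_common[of p] by auto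
  then have "m + 3 \<le> length (shift_rows n (m + 3) (y (Suc (Suc k))) @ shift k0 (y (Suc k)) # ts)"
    using exists_orth not_le by metis
  then have len: "length ts = 2" using lin_indep_length_le[OF indep] n_eq two_le_m by simp
  have "list_all2 (\<lambda>w e. near_row (m + 3) \<xi> (H (Suc (Suc k)) / M (Suc k)) (\<lambda>j. real_of_int (w j)) (row_const n \<xi> * e)) ts (replicate 2 (M k))"
    by (rule near_row_all_shifts[OF ts, of k "Suc k", unfolded len]) auto
  then have "1 \<le> kappa n \<xi> * (H (Suc (Suc k)) * M (Suc k) * M (Suc (Suc k)) ^ (n + 1 - (m + 3)) * prod_list (replicate 2 (M k)))"
    by (rule pair_rows_growth[OF _ k0_le, rotated 3]) (use indep len n_eq in auto)
  then show ?thesis using n_eq by (simp add: power2_eq_square numeral_2_eq_2 mult.assoc)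
qed

definition sole_ann :: "nat set \<Rightarrow> (nat \<Rightarrow> int) \<Rightarrow> bool" where
  "sole_ann I S \<longleftrightarrow> primitive S \<and> supp_below (m + 3) S \<and> common_ann n (m + 3) (y ` I) = rat_span (m + 3) {S}"

lemma sole_ann_height:
  assumes S_sole: "sole_ann (insert (Suc k) I) S" "S \<in> ann n (m + 3) (y k)"
    and I_bounds: "\<And>i. i \<in> I \<Longrightarrow> i0 \<le> i \<and> i \<le> k"
  shows "hgt (m + 3) S \<le> kappa n \<xi> * (H (Suc k) * M k * M (Suc k) ^ (m - 1) * M i0)"
proof -
  have prim: "primitive S" "supp_below (m + 3) S"
    and sole: "common_ann n (m + 3) (insert (y (Suc k)) (y ` I)) = rat_span (m + 3) {S}"
    using S_sole(1) by (simp_all add: sole_ann_def)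
  obtain k0 where k0_le: "k0 + (m + 3) \<le> n + 1"
    and base_indep: "lin_indep (m + 3) (shift_rows n (m + 3) (y (Suc k)) @ [shift k0 (y k)])"
    by (rule exists_indep_shift[of "m + 3" k]) auto
  define rows where "rows = (\<lambda>ts. shift_rows n (m + 3) (y (Suc k)) @ shift k0 (y k) # [] @ ts)"
  obtain ts where ts: "set ts \<subseteq> all_shifts n (m + 3) (y ` I)" and indep: "lin_indep (m + 3) (rows ts)"
    and orth: "orth (m + 3) (set (rows ts)) \<subseteq> orth (m + 3) (set []) \<inter> common_ann n (m + 3) (insert (y (Suc k)) (y ` I))"
    unfolding rows_def by (rule extend_pair_rows[OF base_indep])
  have "S \<in> common_ann n (m + 3) (insert (y (Suc k)) (y ` I))" unfolding sole by (simp add: rat_span_base)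
  then have "S \<in> orth (m + 3) (set (rows ts))"
    using orth_antimono[OF ts, of "m + 3"] annD[OF S_sole(2) k0_le]
    by (auto simp: orth_Un orth_insert orth_all_shifts ann_def rows_def)
  then have span: "orth (m + 3) (set (rows ts)) = rat_span (m + 3) (set [S])"
    using orth rat_span_subset_orth[of "{S}" "m + 3" "set (rows ts)"] unfolding sole by auto
  have "lin_indep (m + 3) [S]" using primitive_nonzero[OF prim] by (simp add: lin_indep_singleton)
  from length_add_eq_of_orth_eq_rat_span[OF indep this span] have len: "length ts = 1"
    using n_eq by (simp add: rows_def)
  have "hgt (Suc (m + 2)) S ^ 1 \<le> kappa n \<xi> * (H (Suc k) * M k * M (Suc k) ^ (n + 1 - (m + 3)) * prod_list (replicate (length ts) (M i0)))"
    by (rule pair_rows_height[OF _ _ k0_le _ near_row_all_shifts[OF ts I_bounds] prim(1)])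
      (use prim(2) span len n_eq in \<open>auto simp: rows_def numeral_3_eq_3\<close>)
  then show ?thesis using len n_eq by (simp add: numeral_3_eq_3)
qed

lemma repeated_ann_height:
  assumes P_ann: "primitive P" "supp_below (m + 2) P" "P \<in> ann n (m + 2) (y k)"
    "P \<in> ann n (m + 2) (y (Suc k))"
  shows "(hgt (m + 2) P)\<^sup>2 \<le> kappa n \<xi> * (H (Suc k) * M k * M (Suc k) ^ (m - 1))"
proof -
  obtain k0 where k0_le: "k0 + (m + 3) \<le> n + 1"
    and base_indep: "lin_indep (m + 3) (shift_rows n (m + 3) (y (Suc k)) @ [shift k0 (y k)])"
    by (rule exists_indep_shift[of "m + 3" k]) auto
  have indep: "lin_indep (m + 3) (tmults 2 P)"
    using lin_indep_tmults[of "m + 1" P 2] P_ann(2) primitive_nonzero[OF P_ann(1,2)]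
    by (simp add: numeral_3_eq_3)
  have "tmult i P \<in> ann n (m + 3) (y j)" if "i < 2" "j \<in> {k, Suc k}" for i j
    using that P_ann by (intro tmult_in_ann[of P n "m + 2"]) auto
  then have "set (tmults 2 P) \<subseteq> ann n (m + 3) (y (Suc k)) \<inter> ann n (m + 3) (y k)" by (auto simp: set_tmults)
  then have "set (tmults 2 P) \<subseteq> orth (m + 3) (set (shift_rows n (m + 3) (y (Suc k)) @ [shift k0 (y k)]))"
    using ann_Int_ann_subset_orth[OF k0_le] by (rule order_trans)
  from orth_eq_rat_span[OF base_indep indep this]
  have "orth (m + 3) (set (shift_rows n (m + 3) (y (Suc k)) @ [shift k0 (y k)])) = rat_span (m + 3) (set (tmults 2 P))" using n_eq by simp
  then have "hgt (Suc (m + 1)) P ^ 2 \<le> kappa n \<xi> * (H (Suc k) * M k * M (Suc k) ^ (n + 1 - (m + 3)) * prod_list [])"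
    by (intro pair_rows_height[OF _ _ k0_le, where ts = "[]"]) (use P_ann(1,2) n_eq in auto)
  then show ?thesis using n_eq by simp
qed

end

lemma abs_det_rows_mat_le:
  assumes "length rs = N" and es: "list_all2 (\<lambda>r e. \<forall>j. \<bar>real_of_int (r j)\<bar> \<le> e) rs es"
  shows "\<bar>real_of_int (det (rows_mat N rs))\<bar> \<le> fact N * prod_list es"
proof -
  have len: "length es = N" using es assms(1) by (simp add: list_all2_lengthD)
  have "\<bar>det (map_mat real_of_int (rows_mat N rs))\<bar> \<le> fact N * (\<Prod>i<N. es ! i) * (\<Prod>j<N. 1)"
    by (rule abs_det_le) (use es assms(1) in \<open>auto simp: rows_mat_def list_all2_conv_all_nth\<close>)
  also have "(\<Prod>i<N. es ! i) = prod_list es" by (simp add: prod.list_conv_set_nth len lessThan_atLeast0)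
  finally show ?thesis by (simp add: of_int_hom.hom_det)
qed

context point_sequence
begin

lemma orth_pencil_shifts:
  assumes pencil: "lin_indep (m + 3) [S1, S2]"
    "\<And>S. S \<in> {S1, S2} \<Longrightarrow> supp_below (m + 3) S \<and> S \<in> common_ann n (m + 3) {y k, y (Suc k)}"
    and P_ann: "supp_below (m + 2) P" "P \<in> ann n (m + 2) (y (Suc k))"
    and l_value: "l + (m + 2) \<le> n + 1" "dotp (m + 2) (shift l (y k)) P \<noteq> 0"
  shows "orth (n + 1) (set (tmults m S1 @ tmults m S2 @ [tmult l P])) = rat_span (n + 1) {y (Suc k)}"
proof -
  let ?rows = "tmults m S1 @ tmults m S2 @ [tmult l P]"
  have ann: "S \<in> ann n (m + 3) x \<longleftrightarrow> (\<forall>i<m. dotp (n + 1) x (tmult i S) = 0)" if "S \<in> {S1, S2}" for S x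
    using pencil(2)[OF that] n_eq by (auto simp: ann_iff dotp_tmult)
  have iff: "x \<in> orth (n + 1) (set ?rows) \<longleftrightarrow> {S1, S2} \<subseteq> ann n (m + 3) x \<and> dotp (m + 2) (shift l x) P = 0" for x
    using dotp_tmult[OF P_ann(1) l_value(1), of x]
    by (auto simp: orth_def set_tmults ann dotp_commute[of _ _ x])
  have "y (Suc k) \<in> orth (n + 1) (set ?rows)"
    unfolding iff using pencil(2) annD[OF P_ann(2) l_value(1)] by auto
  moreover have "x \<in> rat_span (n + 1) {y (Suc k)}" if x_orth: "x \<in> orth (n + 1) (set ?rows)" for x
  proof -
    have "P \<notin> ann n (m + 2) (y k)" using l_value by (auto simp: ann_iff)
    then have "x \<in> rat_span (n + 1) {y (Suc k), y k}"
      using pencil x_orth two_le_m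
      unfolding iff by (intro common_pencil_imp_coplanar[OF n_eq _ full_rank P_ann _ pencil(1)]) auto
    then obtain a c where a_nonzero: "a \<noteq> 0"
      and coeffs: "\<And>j. j < n + 1 \<Longrightarrow> a * x j = lincomb [y (Suc k), y k] c j"
      using rat_span_set_iff[of x "n + 1" "[y (Suc k), y k]"] by auto
    have "a * dotp (m + 2) (shift l x) P = dotp (m + 2) (\<lambda>j. a * shift l x j) P"
      by (simp only: dotp_def sum_distrib_left mult.assoc)
    also have "\<dots> = dotp (m + 2) (\<lambda>j. c 0 * shift l (y (Suc k)) j + c 1 * shift l (y k) j) P"
      using coeffs l_value(1) by (intro dotp_cong) (auto simp: shift_def)
    also have "\<dots> = c 1 * dotp (m + 2) (shift l (y k)) P"
      using annD[OF P_ann(2) l_value(1)] by (simp add: dotp_add_left)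
    finally have "c 1 = 0" using x_orth l_value(2) unfolding iff by simp
    then show ?thesis using a_nonzero coeffs by (auto simp: rat_span_singleton_iff)
  qed
  ultimately show ?thesis using rat_span_subset_orth[of "{y (Suc k)}" "n + 1" "set ?rows"] by blast
qed

lemma hgt_y_le_pencil_heights:
  assumes pencil: "lin_indep (m + 3) [S1, S2]"
    "\<And>S. S \<in> {S1, S2} \<Longrightarrow> supp_below (m + 3) S \<and> S \<in> common_ann n (m + 3) {y k, y (Suc k)}"
    and P_ann: "supp_below (m + 2) P" "P \<in> ann n (m + 2) (y (Suc k))" "P \<notin> ann n (m + 2) (y k)"
  shows "hgt (n + 1) (y (Suc k)) \<le> kappa n \<xi> * ((hgt (m + 3) S1 * hgt (m + 3) S2) ^ m * hgt (m + 2) P)"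
proof -
  obtain l where l_value: "l + (m + 2) \<le> n + 1" "dotp (m + 2) (shift l (y k)) P \<noteq> 0"
    using P_ann(3) by (auto simp: ann_iff)
  let ?rows = "tmults m S1 @ tmults m S2 @ [tmult l P]"
  let ?es = "replicate m (hgt (m + 3) S1) @ replicate m (hgt (m + 3) S2) @ [hgt (m + 2) P, 1]"
  obtain h
    where hgt_le: "hgt (Suc n) (y (Suc k)) ^ 1 \<le> height_const n 1 * \<bar>real_of_int (det (rows_mat (n + 1) (?rows @ unit_rows h 1)))\<bar>"
    using hgt_power_le_det[OF primitive_y, of n "Suc k" ?rows 1] supp_y[of "Suc k"] orth_pencil_shifts[OF pencil P_ann(1,2) l_value] n_eq by auto
  have "list_all2 (\<lambda>r e. \<forall>j. \<bar>real_of_int (r j)\<bar> \<le> e) (?rows @ unit_rows h 1) ?es"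
    using pencil(2) P_ann(1)
    by (auto simp: list_all2_append list_all2_conv_all_nth[of _ "tmults m _"] abs_tmult_le_hgt unit_rows_def unit_row_def)
  then have det: "\<bar>real_of_int (det (rows_mat (n + 1) (?rows @ unit_rows h 1)))\<bar> \<le> fact (n + 1) * prod_list ?es"
    by (rule abs_det_rows_mat_le[rotated]) (use n_eq in simp)
  have "height_const n 1 * \<bar>real_of_int (det (rows_mat (n + 1) (?rows @ unit_rows h 1)))\<bar>
      \<le> height_const (n + 1) (n + 1) * (fact (n + 1) * prod_list ?es)"
    using det height_const_ge_1[of "n + 1" "n + 1"] by (intro mult_mono height_const_mono) auto
  also have "\<dots> = height_const (n + 1) (n + 1) * fact (n + 1) * ((hgt (m + 3) S1 * hgt (m + 3) S2) ^ m * hgt (m + 2) P)"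
    by (simp add: power_mult_distrib mult.assoc)
  also have "\<dots> \<le> kappa n \<xi> * ((hgt (m + 3) S1 * hgt (m + 3) S2) ^ m * hgt (m + 2) P)"
    unfolding kappa_def
    using fact_mult_power_le_det_const[of "n + 1" n \<xi>] height_const_ge_1[of "n + 1" "n + 1"] row_const_ge_1[of n \<xi>]
      one_le_power[of "row_const n \<xi>" "n + 1"]
    by (intro mult_right_mono mult_left_mono mult_nonneg_nonneg zero_le_power)
      (auto intro: order_trans[OF _ fact_mult_power_le_det_const[of "n + 1" n \<xi>]])
  finally show ?thesis using hgt_le by simp
qed

lemma pencil_heights_ge:
  assumes pencil: "lin_indep (m + 3) [S1, S2]"
    "\<And>S. S \<in> {S1, S2} \<Longrightarrow> supp_below (m + 3) S \<and> S \<in> common_ann n (m + 3) {y k, y (Suc k)}"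
    and P_ann: "primitive P" "supp_below (m + 2) P" "P \<in> ann n (m + 2) (y (Suc k))" "P \<notin> ann n (m + 2) (y k)"
  shows "1 \<le> (kappa n \<xi>)\<^sup>2 * (hgt (m + 3) S1 * hgt (m + 3) S2 * M (Suc k)) ^ m"
proof -
  let ?A = "(hgt (m + 3) S1 * hgt (m + 3) S2) ^ m" and ?y = "real_of_int (y (Suc k) 0)"
  have height_ge_1: "1 \<le> ?y" using y_pos[of "Suc k"] by simp
  have "hgt (Suc (m + 1)) P ^ (n + 2 - 2 * (m + 1)) \<le> kappa n \<xi> * (\<bar>?y\<bar> * M (Suc k) ^ (m + 1 - 1))"
    using full_rank[of "Suc k"] M_le_1[of "Suc k"] height_ge_1 P_ann n_eq
    by (intro low_degree_ann_height gap near M_pos) (auto simp: full_rank_def)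
  then have P_le: "hgt (m + 2) P \<le> kappa n \<xi> * (?y * M (Suc k) ^ m)" using n_eq height_ge_1 by simp
  have "?y \<le> hgt (n + 1) (y (Suc k))" using abs_le_hgt[of 0 "n + 1" "y (Suc k)"] height_ge_1 by simp
  also have "\<dots> \<le> kappa n \<xi> * (?A * hgt (m + 2) P)" by (rule hgt_y_le_pencil_heights[OF pencil P_ann(2-4)])
  also have "\<dots> \<le> kappa n \<xi> * (?A * (kappa n \<xi> * (?y * M (Suc k) ^ m)))"
    using P_le kappa_ge_1[of n \<xi>] by (intro mult_left_mono) auto
  finally have "1 * ?y \<le> (kappa n \<xi>)\<^sup>2 * (?A * M (Suc k) ^ m) * ?y" by (simp add: power2_eq_square mult_ac)
  then show ?thesis using height_ge_1 by (simp add: power_mult_distrib)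
qed

end

lemma dotp_shift_eq_0_of_comb_shift:
  assumes "i < R" "r i \<noteq> 0" "dotp N (comb_shift R r x) p = 0" "\<And>k. k < R \<Longrightarrow> k \<noteq> i \<Longrightarrow> dotp N (shift k x) p = 0"
  shows "dotp N (shift i x) p = 0"
proof -
  have "dotp N (comb_shift R r x) p = r i * dotp N (shift i x) p + (\<Sum>k\<in>{..<R} - {i}. r k * dotp N (shift k x) p)"
    unfolding dotp_comb_shift by (rule sum.remove) (use assms(1) in auto)
  also have "(\<Sum>k\<in>{..<R} - {i}. r k * dotp N (shift k x) p) = 0" by (rule sum.neutral) (use assms(4) in auto)
  finally show ?thesis using assms(2,3) by simp
qed

lemma dotp_comb_shift_eq_0: "p \<in> ann n N x \<Longrightarrow> R + N \<le> n + 2 \<Longrightarrow> dotp N (comb_shift R r x) p = 0"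
  unfolding dotp_comb_shift by (rule sum.neutral) (auto simp: ann_iff)

abbreviation triple :: "nat \<Rightarrow> nat set" where
  "triple k \<equiv> {k, Suc k, Suc (Suc k)}"

context point_sequence
begin

definition span3 :: "nat \<Rightarrow> (nat \<Rightarrow> int) set" where
  "span3 a = rat_span (n + 1) {y a, y (Suc a), y (Suc (Suc a))}"

lemma y_in_span3: "i \<in> triple a \<Longrightarrow> y i \<in> span3 a"
  unfolding span3_def by (rule rat_span_base) auto

lemma ann_of_span3: "x \<in> span3 a \<Longrightarrow> p \<in> common_ann n N (y ` triple a) \<Longrightarrow> p \<in> ann n N x"
  unfolding span3_def by (erule in_ann_of_rat_span) auto

lemma span3_eq: "span3 a = rat_span (n + 1) {y a, y (Suc a), yp (Suc a)}"
proof (unfold span3_def, rule antisym; rule rat_span_minimal)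
  have "y (Suc (Suc a)) \<in> rat_span (n + 1) {y a, y (Suc a), yp (Suc a)}"
    using plane[of "Suc a"] rat_span_mono[of "{y (Suc a), yp (Suc a)}"] by blast
  then show "{y a, y (Suc a), y (Suc (Suc a))} \<subseteq> rat_span (n + 1) {y a, y (Suc a), yp (Suc a)}"
    by (simp add: rat_span_base)
  have "yp (Suc a) \<in> rat_span (n + 1) {y (Suc a), y (Suc (Suc a))}"
    unfolding rat_span_pair by (simp add: rat_span_base)
  then have "yp (Suc a) \<in> rat_span (n + 1) {y a, y (Suc a), y (Suc (Suc a))}"
    using rat_span_mono[of "{y (Suc a), y (Suc (Suc a))}"] by blast
  then show "{y a, y (Suc a), yp (Suc a)} \<subseteq> rat_span (n + 1) {y a, y (Suc a), y (Suc (Suc a))}"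
    by (simp add: rat_span_base)
qed

lemma span3_exchange:
  assumes "y c \<in> span3 a"
  obtains u1 u2 where "{u1, u2} \<subseteq> {y a, y (Suc a), y (Suc (Suc a))}" "lin_indep (n + 1) [y c, u1, u2]"
    "span3 a = rat_span (n + 1) {y c, u1, u2}"
proof -
  have "y c \<in> rat_span (n + 1) (set [y a, y (Suc a), y (Suc (Suc a))])" using assms by (simp add: span3_def)
  moreover have "nonzero_below (n + 1) (y c)"
    using y_pos[of c] by (auto simp: nonzero_below_def intro!: exI[of _ 0])
  ultimately obtain ts where ts: "set ts \<subseteq> set [y a, y (Suc a), y (Suc (Suc a))]"
    "length [y a, y (Suc a), y (Suc (Suc a))] = Suc (length ts)"
    "lin_indep (n + 1) (y c # ts)"
      "rat_span (n + 1) (set (y c # ts)) = rat_span (n + 1) (set [y a, y (Suc a), y (Suc (Suc a))])"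
    by (rule exchange_in_basis[OF indep3])
  obtain u1 u2 where "ts = [u1, u2]" using ts(2) by (auto simp: Suc_length_conv length_Suc_conv)
  then show thesis using that[of u1 u2] ts by (simp add: span3_def)
qed

lemma sole_ann_span3:
  assumes "sole_ann (triple a) S" "x \<in> span3 a"
  shows "S \<in> ann n (m + 3) x"
proof (rule ann_of_span3[OF assms(2)])
  show "S \<in> common_ann n (m + 3) (y ` triple a)"
    using assms(1) by (simp add: sole_ann_def rat_span_base)
qed

lemma exists_generic_row_of_span3:
  assumes c_span3: "y c \<in> span3 a" and S_sole: "sole_ann (triple a) S"
  obtains r where "r \<in> generic_rows m"
    "\<And>p. p \<in> ann n (m + 3) (y c) \<Longrightarrow> (\<And>x. x \<in> span3 a \<Longrightarrow> dotp (m + 3) (comb_shift m r x) p = 0) \<Longrightarrow>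
      p \<in> rat_span (m + 3) {S}"
proof -
  have prim: "primitive S" "supp_below (m + 3) S"
    and sole: "common_ann n (m + 3) (y ` triple a) = rat_span (m + 3) {S}"
    using S_sole unfolding sole_ann_def by auto
  obtain u1 u2 where indep_u: "lin_indep (n + 1) [y c, u1, u2]"
    and basis: "span3 a = rat_span (n + 1) {y c, u1, u2}"
    by (rule span3_exchange[OF c_span3])
  have u_span: "{y c, u1, u2} \<subseteq> span3 a" unfolding basis by (rule subset_rat_span)
  have "ann n (m + 3) (y c) \<inter> ann n (m + 3) u1 \<inter> ann n (m + 3) u2 \<subseteq> common_ann n (m + 3) (y ` triple a)"
    using y_in_span3[of _ a] in_ann_of_rat_span[of _ n "{y c, u1, u2}" _ "m + 3"] unfolding basis by auto
  then obtain r where r_generic: "r \<in> generic_rows m"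
    and generic: "ann n (m + 3) (y c) \<inter> orth (m + 3) {comb_shift m r u1, comb_shift m r u2} \<subseteq> rat_span (m + 3) {S}"
    using exists_generic_row[OF n_eq _ full_rank indep_u primitive_nonzero[OF prim] sole_ann_span3[OF S_sole]] two_le_m u_span
    unfolding sole by auto
  show thesis by (rule that[OF r_generic]) (use generic u_span in \<open>auto simp: orth_def\<close>)
qed

lemma exists_generic_rows_of_span3:
  assumes c_span3: "y c \<in> span3 a" and S_sole: "sole_ann (triple a) S"
  obtains r i where "r \<in> generic_rows m" "i < m"
    "orth (m + 3) (set (map (comb_shift m r) [y a, y (Suc a), yp (Suc a)] @ map (\<lambda>k. shift k (y c)) (remove1 i [0..<m]))) =
      rat_span (m + 3) {S}"
proof -
  obtain r where r_generic: "r \<in> generic_rows m" and generic: "\<And>p. p \<in> ann n (m + 3) (y c) \<Longrightarrow>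
      (\<And>x. x \<in> span3 a \<Longrightarrow> dotp (m + 3) (comb_shift m r x) p = 0) \<Longrightarrow> p \<in> rat_span (m + 3) {S}"
    by (rule exists_generic_row_of_span3[OF assms]) blast
  obtain i where i_coeff: "i < m" "r i \<noteq> 0"
    using nonzero_below_generic_row[OF r_generic] by (auto simp: nonzero_below_def)
  let ?vs = "[y a, y (Suc a), yp (Suc a)]"
  let ?rows = "map (comb_shift m r) ?vs @ map (\<lambda>k. shift k (y c)) (remove1 i [0..<m])"
  have rows_le: "m + (m + 3) \<le> n + 2" using n_eq by simp
  have "p \<in> rat_span (m + 3) {S}" if p_orth: "p \<in> orth (m + 3) (set ?rows)" for p
  proof -
    have "p \<in> orth (m + 3) (rat_span (m + 3) (comb_shift m r ` {y a, y (Suc a), yp (Suc a)}))"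
      unfolding orth_rat_span using p_orth by (simp add: orth_def)
    then have comb: "dotp (m + 3) (comb_shift m r x) p = 0" if "x \<in> span3 a" for x
      using comb_shift_in_rat_span[OF that[unfolded span3_eq] rows_le] by (rule orthD)
    have others: "dotp (m + 3) (shift k (y c)) p = 0" if "k < m" "k \<noteq> i" for k
      using that by (intro orthD[OF p_orth]) (auto simp: set_remove1_upt)
    then have "dotp (m + 3) (shift k (y c)) p = 0" if "k < m" for k
      using dotp_shift_eq_0_of_comb_shift[OF i_coeff comb[OF c_span3]] that by blast
    then have "p \<in> ann n (m + 3) (y c)" using n_eq by (simp add: ann_iff)
    then show ?thesis using generic comb by blast
  qed
  moreover have "S \<in> orth (m + 3) (set ?rows)"
  proof -
    have "{y a, y (Suc a), yp (Suc a)} \<subseteq> span3 a" unfolding span3_eq by (rule subset_rat_span)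
    then have "dotp (m + 3) (comb_shift m r x) S = 0" if "x \<in> set ?vs" for x
      using dotp_comb_shift_eq_0[OF sole_ann_span3[OF S_sole] rows_le] that by auto
    moreover have "dotp (m + 3) (shift k (y c)) S = 0" if "k < m" for k
      using annD[OF sole_ann_span3[OF S_sole c_span3]] that n_eq by simp
    ultimately show ?thesis by (auto simp: orth_def set_remove1_upt)
  qed
  ultimately show thesis
    using that[OF r_generic i_coeff(1)] rat_span_subset_orth[of "{S}" "m + 3" "set ?rows"] by blast
qed

lemma span3_ann_height:
  assumes c_span3: "y c \<in> span3 a" and S_sole: "sole_ann (triple a) S"
  shows "hgt (m + 3) S \<le> kappa n \<xi> * (H (Suc (Suc a)) * M (Suc a) * M a * M c ^ (m - 1))"
proof -
  obtain r i where r_generic: "r \<in> generic_rows m" "i < m"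
    and span: "orth (m + 3) (set (map (comb_shift m r) [y a, y (Suc a), yp (Suc a)] @
      map (\<lambda>k. shift k (y c)) (remove1 i [0..<m]))) = rat_span (m + 3) {S}"
    by (rule exists_generic_rows_of_span3[OF assms])
  have prim: "primitive S" "supp_below (m + 3) S" using S_sole by (simp_all add: sole_ann_def)
  let ?Q = "H (Suc (Suc a)) / M (Suc a)"
  have "\<bar>real_of_int (y a 0)\<bar> \<le> H (Suc a)" using y_le_H[of a] y_pos[of a] by simp
  also have "\<dots> \<le> ?Q * M (Suc a)" using H_Suc[of "Suc a"] M_pos[of "Suc a"] by simp
  also have "\<dots> \<le> ?Q * M a" using M_Suc[of a] Q_ge_1[of "Suc a"] by (intro mult_left_mono) auto
  finally have vs: "near_points n \<xi> ?Q [y a, y (Suc a), yp (Suc a)] [M a, M (Suc a), M (Suc a)]"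
    using near near_y_yp[of "Suc a"] by simp
  have "hgt (Suc (m + 2)) S ^ 1 \<le> kappa n \<xi> * (?Q * (prod_list [M a, M (Suc a), M (Suc a)] * M c ^ length (remove1 i [0..<m]) * prod_list []))"
  proof (rule hgt_power_le_of_point_rows[OF _ _ _ _ r_generic(1) Q_ge_1 gap vs _ near])
    show "y c \<in> rat_span (n + 1) (set [y a, y (Suc a), yp (Suc a)])" using c_span3 by (simp add: span3_eq)
    show "orth (m + 3) (set (map (comb_shift m r) [y a, y (Suc a), yp (Suc a)] @ map (\<lambda>k. shift k (y c)) (remove1 i [0..<m]) @ []))
        = rat_span (m + 3) (set (tmults 1 S))" using span by simp
  qed (use prim r_generic(2) n_eq two_le_m in \<open>auto simp: set_remove1_upt length_remove1_upt numeral_3_eq_3\<close>)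
  then show ?thesis
    using r_generic(2) M_pos[of "Suc a"] by (simp add: numeral_3_eq_3 length_remove1_upt mult_ac)
qed

end

locale spread_points = point_sequence +
  fixes a c :: nat and S G P :: "nat \<Rightarrow> int"
  assumes a_le_c: "Suc (Suc a) \<le> c" and in_span3: "y c \<in> span3 a" and not_in_span3: "y (Suc c) \<notin> span3 a"
    and S_common_ann: "primitive S" "supp_below (m + 3) S"
      "S \<in> common_ann n (m + 3) (y ` {a, Suc a, Suc (Suc a), Suc c})"
    and G_common_ann: "supp_below (m + 3) G" "G \<in> common_ann n (m + 3) {y (Suc c), y c}"
    and indep_SG: "lin_indep (m + 3) [S, G]"
    and P_ann: "supp_below (m + 2) P" "P \<in> ann n (m + 2) (y (Suc c))" "P \<notin> ann n (m + 2) (y c)"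
begin

lemma S_ann:
  assumes "i \<in> {a, Suc a, Suc (Suc a), c, Suc c}"
  shows "S \<in> ann n (m + 3) (y i)"
proof (cases "i = c")
  case True
  show ?thesis unfolding True by (rule ann_of_span3[OF in_span3]) (use S_common_ann(3) in simp)
qed (use assms S_common_ann(3) in auto)

lemma tmults_S_ann: "i \<in> {a, Suc a, Suc (Suc a), c, Suc c} \<Longrightarrow> set (tmults 2 S) \<subseteq> ann n (m + 4) (y i)"
  using tmult_in_ann[OF S_ann S_common_ann(2), of i _ "m + 4"] by (auto simp: set_tmults)

text \<open>Two points in the plane of \<open>y (Suc c)\<close> and \<open>y c\<close> span it, so \<open>y (Suc c)\<close> would lie in \<open>span3 a\<close>.\<close>

lemma exists_shift_off_plane:
  assumes rs: "lin_indep (m + 4) rs" "ann n (m + 4) (y (Suc c)) \<inter> ann n (m + 4) (y c) \<subseteq> orth (m + 4) (set rs)"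
  obtains i l where "i \<in> {Suc a, Suc (Suc a)}" "l + (m + 4) \<le> n + 1"
    "lin_indep (m + 4) (rs @ [shift l (y i)])"
proof -
  have "\<exists>i\<in>{Suc a, Suc (Suc a)}. \<not> orth (m + 4) (set rs) \<subseteq> ann n (m + 4) (y i)"
  proof (rule ccontr)
    assume "\<not> ?thesis"
    then have orth_subset_ann: "orth (m + 4) (set rs) \<subseteq> ann n (Suc (m + 3)) (y i)"
      if "i \<in> {Suc a, Suc (Suc a)}" for i
      using that by (simp add: eval_nat_numeral) blast
    have "{G, tmult (Suc 0) G} \<subseteq> ann n (m + 4) (y (Suc c)) \<inter> ann n (m + 4) (y c)"
      using G_common_ann in_ann_mono[of G n "m + 3" _ "m + 4"] tmult_in_ann[of G n "m + 3" _ "Suc 0" "m + 4"]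
      by auto
    then have G_rs: "{G, tmult (Suc 0) G} \<subseteq> orth (m + 4) (set rs)" using rs(2) by blast
    have "G \<in> ann n (m + 3) (y i)" if "i \<in> {Suc a, Suc (Suc a)}" for i
      by (rule in_ann_of_Suc[OF G_common_ann(1)]) (use orth_subset_ann[OF that] G_rs n_eq two_le_m in auto)
    then have "y i \<in> rat_span (n + 1) {y (Suc c), y c}" if "i \<in> {Suc a, Suc (Suc a)}" for i
      by (intro common_pencil_imp_coplanar[OF n_eq _ full_rank P_ann indep_SG]) (use that S_ann G_common_ann(2) two_le_m in auto)
    then have "rat_span (n + 1) (set [y (Suc a), y (Suc (Suc a))]) = rat_span (n + 1) (set [y (Suc c), y c])"
      by (intro rat_span_eq_of_length[OF indep2]) auto
    then have "y (Suc c) \<in> rat_span (n + 1) {y (Suc a), y (Suc (Suc a))}" by (simp add: rat_span_base)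
    then show False
      using not_in_span3 rat_span_mono[of "{y (Suc a), y (Suc (Suc a))}" _ "n + 1"]
      unfolding span3_def by blast
  qed
  then obtain i p where i_in: "i \<in> {Suc a, Suc (Suc a)}"
    and p_ann: "p \<in> orth (m + 4) (set rs)" "p \<notin> ann n (m + 4) (y i)" by blast
  then obtain l where l_value: "l + (m + 4) \<le> n + 1" "dotp (m + 4) (shift l (y i)) p \<noteq> 0"
    by (auto simp: ann_iff)
  show thesis by (rule that[OF i_in l_value(1) lin_indep_snocI[OF rs(1) p_ann(1) l_value(2)]])
qed

lemma orth_Int_common_ann_subset:
  assumes rs: "lin_indep (m + 4) rs" "length rs = m"
    "ann n (m + 4) (y (Suc c)) \<inter> ann n (m + 4) (y c) \<subseteq> orth (m + 4) (set rs)"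
  shows "orth (m + 4) (set rs) \<inter> common_ann n (m + 4) (y ` triple a) \<subseteq> rat_span (m + 4) (set (tmults 2 S))"
proof -
  obtain u1 u2 where indep_u: "{u1, u2} \<subseteq> {y a, y (Suc a), y (Suc (Suc a))}" "lin_indep (n + 1) [y c, u1, u2]"
      and basis: "span3 a = rat_span (n + 1) {y c, u1, u2}"
    by (rule span3_exchange[OF in_span3])
  have "y (Suc c) \<notin> rat_span (n + 1) (set [y c, u1, u2])" using not_in_span3 by (simp add: basis)
  then have "lin_indep (n + 1) ([y c, u1, u2] @ [y (Suc c)])"
    by (simp only: lin_indep_snoc_iff[OF indep_u(2)] not_False_eq_True)
  then have indep: "lin_indep (n + 1) [y (Suc c), y c, u1, u2]" by (rule lin_indep_perm) auto
  have "S \<in> ann n (m + 3) x" if "x \<in> {y (Suc c), y c, u1, u2}" for x using that S_ann indep_u(1) by auto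
  then interpret four: four_points n m "y (Suc c)" "y c" u1 u2 P S G
    using n_eq two_le_m full_rank indep P_ann indep_SG S_common_ann(2) G_common_ann by unfold_locales auto
  from four.orth_Int_ann_subset[OF rs]
  have "orth (m + 4) (set rs) \<inter> ann n (m + 4) u1 \<inter> ann n (m + 4) u2 \<subseteq> rat_span (m + 4) (set (tmults 2 S))"
    by (simp add: tmults_2)
  then show ?thesis using indep_u(1) by auto
qed

lemma exists_rows_orth_eq_tmults_S:
  obtains k0 i l ts where "k0 + (m + 4) \<le> n + 1" "i \<in> {Suc a, Suc (Suc a)}" "l + (m + 4) \<le> n + 1"
    "set ts \<subseteq> all_shifts n (m + 4) (y ` triple a)" "length ts = 1"
    "orth (m + 4) (set (shift_rows n (m + 4) (y (Suc c)) @ shift k0 (y c) # [shift l (y i)] @ ts)) = rat_span (m + 4) (set (tmults 2 S))"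
proof -
  let ?A = "triple a"
  obtain k0 where k0_le: "k0 + (m + 4) \<le> n + 1"
    and base_indep: "lin_indep (m + 4) (shift_rows n (m + 4) (y (Suc c)) @ [shift k0 (y c)])"
    by (rule exists_indep_shift[of "m + 4" c]) auto
  define rs where "rs = shift_rows n (m + 4) (y (Suc c)) @ [shift k0 (y c)]"
  have orth_rs: "ann n (m + 4) (y (Suc c)) \<inter> ann n (m + 4) (y c) \<subseteq> orth (m + 4) (set rs)"
    unfolding rs_def by (rule ann_Int_ann_subset_orth[OF k0_le])
  obtain i l where t: "i \<in> {Suc a, Suc (Suc a)}" "l + (m + 4) \<le> n + 1"
    "lin_indep (m + 4) (rs @ [shift l (y i)])"
    by (rule exists_shift_off_plane[OF base_indep[folded rs_def] orth_rs])
  obtain ts where ts: "set ts \<subseteq> all_shifts n (m + 4) (y ` ?A)"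
    and indep: "lin_indep (m + 4) (rs @ [shift l (y i)] @ ts)"
    and orth: "orth (m + 4) (set (rs @ [shift l (y i)] @ ts)) \<subseteq> common_ann n (m + 4) (y ` ?A)"
    by (rule lin_indep_extend[OF t(3), of "all_shifts n (m + 4) (y ` ?A)"]) (simp add: orth_all_shifts)
  let ?rows = "rs @ [shift l (y i)] @ ts"
  have "orth (m + 4) (set ?rows) \<subseteq> orth (m + 4) (set rs) \<inter> common_ann n (m + 4) (y ` ?A)"
    using orth orth_antimono[of "set rs" "set ?rows" "m + 4"] by auto
  also have "\<dots> \<subseteq> rat_span (m + 4) (set (tmults 2 S))"
    by (rule orth_Int_common_ann_subset) (use base_indep orth_rs n_eq two_le_m in \<open>auto simp: rs_def\<close>)
  finally have orth_subset: "orth (m + 4) (set ?rows) \<subseteq> rat_span (m + 4) (set (tmults 2 S))" .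
  have "set (tmults 2 S) \<subseteq> common_ann n (m + 4) (y ` ?A)" using tmults_S_ann by (auto simp: common_ann_def)
  then have "set (tmults 2 S) \<subseteq> orth (m + 4) (set ts)"
    using orth_antimono[OF ts, of "m + 4"] by (auto simp: orth_all_shifts)
  moreover have "set (tmults 2 S) \<subseteq> orth (m + 4) (set rs)" using tmults_S_ann orth_rs by blast
  moreover have "set (tmults 2 S) \<subseteq> orth (m + 4) {shift l (y i)}"
    using tmults_S_ann[of i] t(1) annD[OF _ t(2), of _ "y i"] unfolding orth_def by blast
  ultimately have "set (tmults 2 S) \<subseteq> orth (m + 4) (set ?rows)" unfolding set_append orth_Un by simp
  then have span: "orth (m + 4) (set ?rows) = rat_span (m + 4) (set (tmults 2 S))"
    using orth_subset rat_span_subset_orth by blast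
  have "lin_indep (m + 2 + 2) (tmults 2 S)"
    by (rule lin_indep_tmults) (use S_common_ann(2) primitive_nonzero[OF S_common_ann(1,2)] in \<open>auto simp: numeral_3_eq_3\<close>)
  moreover have "m + 2 + 2 = m + 4" by simp
  ultimately have "lin_indep (m + 4) (tmults 2 S)" by (simp only:)
  from length_add_eq_of_orth_eq_rat_span[OF indep this span] have "length ts = 1"
    using n_eq two_le_m by (simp add: rs_def)
  then show thesis using that[OF k0_le t(1,2) ts] span by (simp add: rs_def)
qed

lemma ann_height: "(hgt (m + 3) S)\<^sup>2 \<le> kappa n \<xi> * (H (Suc c) * M c * M (Suc c) ^ (m - 2) * (M (Suc a) * M a))"
proof -
  obtain k0 i l ts where k0_le: "k0 + (m + 4) \<le> n + 1" and t_rows: "i \<in> {Suc a, Suc (Suc a)}" "l + (m + 4) \<le> n + 1"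
    and ts: "set ts \<subseteq> all_shifts n (m + 4) (y ` triple a)" "length ts = 1"
    and span: "orth (m + 4) (set (shift_rows n (m + 4) (y (Suc c)) @ shift k0 (y c) # [shift l (y i)] @ ts)) = rat_span (m + 4) (set (tmults 2 S))"
    by (rule exists_rows_orth_eq_tmults_S)
  have "near_rows n (m + 4) \<xi> (H (Suc c) / M c) ts [M a]"
    by (rule near_row_all_shifts[OF ts(1), of a c, unfolded ts(2), simplified]) (use a_le_c in auto)
  then have "near_rows n (m + 4) \<xi> (H (Suc c) / M c)
      ([shift l (y i)] @ ts) [M (Suc a), M a]"
    using near_row_shift_y[of l "m + 4" i c "Suc a"] t_rows a_le_c by auto
  from pair_rows_height[OF _ _ k0_le _ this S_common_ann(1) _ span, of "m + 2"]
  have "hgt (Suc (m + 2)) S ^ 2 \<le> kappa n \<xi> * (H (Suc c) * M c * M (Suc c) ^ (n + 1 - (m + 4)) * prod_list [M (Suc a), M a])"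
    using S_common_ann(2) n_eq two_le_m k0_le ts(2) by (simp add: numeral_3_eq_3)
  then show ?thesis using n_eq by (simp add: numeral_3_eq_3)
qed

end

section \<open>Numerical inequalities\<close>

text \<open>
  Writing \<open>1 / \<lambda> = m + 1 + \<mu>\<close> and \<open>t = 1 + \<mu> / m\<close>, the condition \<open>\<lambda> > alpha m\<close> becomes \<open>(1 + \<mu>) * t < 2\<close>.
  In the lemmas below \<open>h0, h1, h2\<close> stand for logarithms of consecutive heights, which grow at most by the
  factor \<open>t\<close>, and \<open>s, s'\<close> for those of the heights of two annihilators.
\<close>

locale exponent_numbers =
  fixes m t \<mu> :: real
  assumes m_ge_2: "2 \<le> m" and t_gt_1: "1 < t" and mu_eq: "\<mu> = m * (t - 1)" and mu_t_lt_2: "(1 + \<mu>) * t < 2"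
begin

lemma quadratic_neg: "m * t\<^sup>2 - (m - 1) * t - 2 < 0"
  using mu_t_lt_2 unfolding mu_eq by (simp add: power2_eq_square algebra_simps)

lemma mu_pos: "0 < \<mu>"
  using m_ge_2 t_gt_1 by (simp add: mu_eq)

lemma mu_lt_1: "\<mu> < 1"
proof -
  have "(1 + \<mu>) * 1 \<le> (1 + \<mu>) * t" using t_gt_1 mu_pos by (intro mult_left_mono) auto
  then have "1 + \<mu> \<le> (1 + \<mu>) * t" by (simp only: mult_1_right)
  then show ?thesis using mu_t_lt_2 by linarith
qed

lemma mt_eq: "m * t = m + \<mu>"
  by (simp add: mu_eq algebra_simps)

lemma t_bound: "(m + 1) * t < m + 2"
proof (rule ccontr)
  assume "\<not> ?thesis"
  then obtain d where d_eq: "(m + 1) * t = m + 2 + d" "0 \<le> d"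
    by (metis le_add_diff_inverse not_less diff_ge_0_iff_ge)
  have "(m + 1)\<^sup>2 * ((1 + \<mu>) * t) = ((m + 1) * (1 + \<mu>)) * ((m + 1) * t)"
    by (simp add: power2_eq_square algebra_simps)
  also have "(m + 1) * (1 + \<mu>) = 2 * m + 1 + m * d"
  proof -
    have "(m + 1) * (1 + \<mu>) = m * ((m + 1) * t) - m\<^sup>2 + 1" by (simp add: mu_eq power2_eq_square algebra_simps)
    then show ?thesis unfolding d_eq(1) by (simp add: power2_eq_square algebra_simps)
  qed
  finally have square_eq: "(m + 1)\<^sup>2 * ((1 + \<mu>) * t) = (2 * m + 1 + m * d) * (m + 2 + d)" unfolding d_eq(1) .
  have "(m + 1)\<^sup>2 * ((1 + \<mu>) * t) < (m + 1)\<^sup>2 * 2"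
    using mu_t_lt_2 m_ge_2 by (intro mult_strict_left_mono) auto
  moreover have "(2 * m + 1) * (m + 2) \<le> (2 * m + 1 + m * d) * (m + 2 + d)"
    using m_ge_2 d_eq(2) by (intro mult_mono) auto
  ultimately have "(2 * m + 1) * (m + 2) < (m + 1)\<^sup>2 * 2" using square_eq by linarith
  then show False using m_ge_2 by (simp add: power2_eq_square algebra_simps)
qed

lemma spread_polynomial: "((2 + \<mu>) * (m * t) - (m - 1)) * t\<^sup>2 - (m + 1 + \<mu>) * t < 2 * m + \<mu>"
proof -
  have "((2 + \<mu>) * (m * t) - (m - 1)) * t\<^sup>2 - (m + 1 + \<mu>) * t - (2 * m + \<mu>) =
      (m * t\<^sup>2 + t + 1) * (m * t\<^sup>2 - (m - 1) * t - 2) + (2 - m)"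
    unfolding mu_eq by (simp add: power2_eq_square algebra_simps)
  moreover have "(m * t\<^sup>2 + t + 1) * (m * t\<^sup>2 - (m - 1) * t - 2) < 0"
    using quadratic_neg m_ge_2 t_gt_1 by (intro mult_pos_neg) (auto intro!: add_nonneg_pos)
  ultimately show ?thesis using m_ge_2 by linarith
qed

lemma spread_contradiction:
  assumes heights: "0 < h0" "h1 \<le> t * h0" "h2 \<le> t * h1" "h0 \<le> h1"
    and s_bounds: "h0 \<le> s" "s \<le> m * t * h2 - h1 - (m - 1) * g"
    and spread: "2 * s \<le> (2 + \<mu>) * g - h2 - h1"
  shows False
proof -
  define A where "A = (2 + \<mu>) * (m * t) - (m - 1)"
  define B where "B = A * t - (m + 1 + \<mu>)"
  have "1 * m \<le> t * m" using t_gt_1 m_ge_2 by (intro mult_right_mono) auto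
  then have "2 * m \<le> (2 + \<mu>) * (m * t)" using mu_pos m_ge_2 by (intro mult_mono) (auto simp: mult.commute)
  then have A_nonneg: "0 \<le> A" using m_ge_2 unfolding A_def by linarith
  have "(m - 1) * (2 * s + h2 + h1) \<le> (m - 1) * ((2 + \<mu>) * g)"
    using spread m_ge_2 by (intro mult_left_mono) auto
  also have "\<dots> = (2 + \<mu>) * ((m - 1) * g)" by simp
  also have "\<dots> \<le> (2 + \<mu>) * (m * t * h2 - h1 - s)" using s_bounds(2) mu_pos by (intro mult_left_mono) auto
  finally have "(2 * m + \<mu>) * s \<le> A * h2 - (m + 1 + \<mu>) * h1" by (simp add: A_def algebra_simps)
  also have "\<dots> \<le> A * (t * h1) - (m + 1 + \<mu>) * h1" using mult_left_mono[OF heights(3) A_nonneg] by simp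
  also have "\<dots> = B * h1" by (simp add: B_def algebra_simps)
  finally have "(2 * m + \<mu>) * s \<le> B * h1" .
  moreover have "(2 * m + \<mu>) * h0 \<le> (2 * m + \<mu>) * s"
    using s_bounds(1) mu_pos m_ge_2 by (intro mult_left_mono) auto
  ultimately have lower: "(2 * m + \<mu>) * h0 \<le> B * h1" by linarith
  moreover have "0 < (2 * m + \<mu>) * h0" using heights(1) mu_pos m_ge_2 by (intro mult_pos_pos) auto
  ultimately have "0 < B * h1" by linarith
  then have "0 < B" using heights by (simp add: zero_less_mult_iff)
  then have "B * h1 \<le> B * (t * h0)" using heights(2) by (intro mult_left_mono) auto
  then have "(2 * m + \<mu>) * h0 \<le> (B * t) * h0" using lower by (simp add: mult.assoc)
  then have "2 * m + \<mu> \<le> B * t" using heights(1) by simp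
  then show False using spread_polynomial by (simp add: B_def A_def power2_eq_square algebra_simps)
qed

lemma separated_polynomial: "\<mu> * (t\<^sup>2 * (m * t\<^sup>2 - t - m) + m * t\<^sup>2 - 1) < (m - 1) * t"
proof -
  let ?c = "m\<^sup>2 * t ^ 3 - 2 * m * t\<^sup>2 + (m + 2) * t - 2"
  have expansion: "m * (\<mu> * (t\<^sup>2 * (m * t\<^sup>2 - t - m) + m * t\<^sup>2 - 1) - (m - 1) * t) =
      ?c * (m * t\<^sup>2 - (m - 1) * t - 2) + (m - 2) * (t - 1) * ((m + 1) * t - (m + 2))"
    unfolding mu_eq by (simp add: power2_eq_square power3_eq_cube algebra_simps)
  have "2 * 1 \<le> m * t" using m_ge_2 t_gt_1 by (intro mult_mono) auto
  then have "m * t\<^sup>2 * 2 \<le> m * t\<^sup>2 * (m * t)" using m_ge_2 by (intro mult_left_mono) auto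
  then have "2 * m * t\<^sup>2 \<le> m\<^sup>2 * t ^ 3" by (simp add: power2_eq_square power3_eq_cube mult_ac)
  moreover have "(m + 2) * 1 < (m + 2) * t" using m_ge_2 t_gt_1 by (intro mult_strict_left_mono) auto
  then have "m + 2 < (m + 2) * t" by (simp only: mult_1_right)
  ultimately have "0 < ?c" using m_ge_2 by linarith
  then have "?c * (m * t\<^sup>2 - (m - 1) * t - 2) < 0" using quadratic_neg by (rule mult_pos_neg)
  moreover have "(m - 2) * (t - 1) * ((m + 1) * t - (m + 2)) \<le> 0"
    using m_ge_2 t_gt_1 t_bound by (intro mult_nonneg_nonpos mult_nonneg_nonneg) auto
  ultimately have "m * (\<mu> * (t\<^sup>2 * (m * t\<^sup>2 - t - m) + m * t\<^sup>2 - 1) - (m - 1) * t) < 0"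
    unfolding expansion by linarith
  then show ?thesis using m_ge_2 by (simp add: mult_less_0_iff)
qed

lemma separated_polynomial_neg:
  assumes neg: "m * t\<^sup>2 - t - m < 0"
  shows "\<mu> * (m * t\<^sup>2 - 1) < (m - 1) * t"
proof (rule ccontr)
  assume "\<not> ?thesis"
  then have "(m - 1) * t \<le> \<mu> * (m * t\<^sup>2 - 1)" by simp
  also have "\<dots> < \<mu> * (t + m - 1)" using neg mu_pos by (intro mult_strict_left_mono) auto
  finally have "0 < m * (t - 1) * (t + m - 1) - (m - 1) * t" unfolding mu_eq by simp
  also have "\<dots> = (m * t\<^sup>2 - t - m) + (m - 2) * ((m - 1) * t - m)"
    by (simp add: power2_eq_square algebra_simps)
  finally have "0 < (m * t\<^sup>2 - t - m) + (m - 2) * ((m - 1) * t - m)" .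
  moreover have "(m - 1) * t \<le> m" using mu_lt_1 mt_eq t_gt_1 by (simp add: algebra_simps)
  then have "(m - 2) * ((m - 1) * t - m) \<le> 0" using m_ge_2 by (intro mult_nonneg_nonpos) auto
  ultimately show False using neg by linarith
qed

lemma separated_bound:
  assumes heights: "h0 \<le> t * hm" "h2 \<le> t * h1"
    and s_bounds: "h0 \<le> s" "s \<le> m * t * h2 - h1 - (m - 1) * g" "s \<le> \<mu> * g"
    and s'_bounds: "h2 \<le> s + s'" "s' \<le> m * t * h0 - (m - 1) * h1 - hm"
  shows "(m - 1) * t * h0 \<le> \<mu> * (t * (m * t\<^sup>2 - t - m) * h1 + (m * t\<^sup>2 - 1) * h0)"
proof -
  have mt_ge_1: "1 \<le> m * t" using mult_mono[of 1 m 1 t] m_ge_2 t_gt_1 by simp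
  have "(m - 1) * h0 \<le> (m - 1) * (\<mu> * g)" using s_bounds(1,3) m_ge_2 by (intro mult_left_mono) auto
  also have "\<dots> = \<mu> * ((m - 1) * g)" by simp
  also have "\<dots> \<le> \<mu> * ((m * t - 1) * h2 - m * h1 + m * t * h0 - hm)"
    using s_bounds(2) s'_bounds mu_pos by (intro mult_left_mono) (auto simp: algebra_simps)
  also have "\<dots> \<le> \<mu> * ((m * t - 1) * (t * h1) - m * h1 + m * t * h0 - hm)"
    using mult_left_mono[OF heights(2), of "m * t - 1"] mt_ge_1 mu_pos by (intro mult_left_mono) auto
  finally have "t * ((m - 1) * h0) \<le> t * (\<mu> * ((m * t - 1) * (t * h1) - m * h1 + m * t * h0 - hm))"
    using t_gt_1 by (intro mult_left_mono) auto
  also have "\<dots> = \<mu> * (t * (m * t\<^sup>2 - t - m) * h1 + m * t\<^sup>2 * h0 - t * hm)"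
    by (simp add: power2_eq_square algebra_simps)
  also have "\<dots> \<le> \<mu> * (t * (m * t\<^sup>2 - t - m) * h1 + m * t\<^sup>2 * h0 - h0)"
    using heights(1) mu_pos by (intro mult_left_mono) auto
  finally show ?thesis by (simp add: algebra_simps)
qed

lemma separated_contradiction:
  assumes heights: "0 < h0" "h0 \<le> t * hm" "h0 \<le> h1" "h1 \<le> t * h0" "h2 \<le> t * h1"
    and s_bounds: "h0 \<le> s" "s \<le> m * t * h2 - h1 - (m - 1) * g" "s \<le> \<mu> * g"
    and s'_bounds: "h2 \<le> s + s'" "s' \<le> m * t * h0 - (m - 1) * h1 - hm"
  shows False
proof -
  define c where "c = m * t\<^sup>2 - t - m"
  have bound: "(m - 1) * t * h0 \<le> \<mu> * (t * c * h1 + (m * t\<^sup>2 - 1) * h0)"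
    unfolding c_def by (rule separated_bound[OF heights(2,5) s_bounds s'_bounds])
  show False
  proof (cases "0 \<le> c")
    case True
    have "t * c * h1 \<le> t * c * (t * h0)" using heights(4) True t_gt_1 by (intro mult_left_mono) auto
    then have "\<mu> * (t * c * h1 + (m * t\<^sup>2 - 1) * h0) \<le> \<mu> * (t * c * (t * h0) + (m * t\<^sup>2 - 1) * h0)"
      using mu_pos by (intro mult_left_mono) auto
    also have "\<dots> = (\<mu> * (t\<^sup>2 * c + m * t\<^sup>2 - 1)) * h0" by (simp add: power2_eq_square algebra_simps)
    finally have "(m - 1) * t * h0 \<le> (\<mu> * (t\<^sup>2 * c + m * t\<^sup>2 - 1)) * h0" using bound by linarith
    then have "(m - 1) * t \<le> \<mu> * (t\<^sup>2 * c + m * t\<^sup>2 - 1)" using heights(1) by simp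
    then show False using separated_polynomial by (simp add: c_def)
  next
    case False
    have "t * c * h1 \<le> 0"
      using False t_gt_1 heights(1,3) by (intro mult_nonpos_nonneg mult_nonneg_nonpos) auto
    then have "\<mu> * (t * c * h1 + (m * t\<^sup>2 - 1) * h0) \<le> \<mu> * ((m * t\<^sup>2 - 1) * h0)"
      using mu_pos by (intro mult_left_mono) auto
    then have "(m - 1) * t * h0 \<le> (\<mu> * (m * t\<^sup>2 - 1)) * h0" using bound by (simp add: mult.assoc)
    then have "(m - 1) * t \<le> \<mu> * (m * t\<^sup>2 - 1)" using heights(1) by simp
    then show False using separated_polynomial_neg False by (simp add: c_def)
  qed
qed

lemma t_cubed_lt_2:
  assumes "3 \<le> m"
  shows "t ^ 3 < 2"
proof -
  have "t < 5 / 4"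
  proof (rule ccontr)
    assume "\<not> t < 5 / 4"
    then have t_ge: "5 / 4 \<le> t" by simp
    then have "3 * ((5 / 4) * (1 / 4)) \<le> m * (t * (t - 1))" using assms by (intro mult_mono) auto
    moreover have "m * (t * (t - 1)) + t - 2 < 0"
      using quadratic_neg by (simp add: power2_eq_square algebra_simps)
    ultimately show False using t_ge by linarith
  qed
  then have "t ^ 3 \<le> (5 / 4) ^ 3" using t_gt_1 by (intro power_mono) auto
  then show ?thesis by (simp add: power3_eq_cube)
qed

lemma chained_bound:
  assumes heights: "0 < h0" "h1 \<le> t * h0" "h2 \<le> t * h1" "h0 \<le> h1" "h1 \<le> h2"
    and s_bounds: "h0 \<le> s" "s \<le> m * t * h2 - h1 - (m - 1) * g2"
    and g_bounds: "h2 \<le> g1" "g1 \<le> t * g0" "g1 \<le> g2" "g1 + g0 \<le> (1 + \<mu>) * g2"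
  shows "m < 3"
proof (rule ccontr)
  assume "\<not> m < 3"
  have t_pos: "0 < t" using t_gt_1 by simp
  have "t * (g1 + g0) \<le> (1 + \<mu>) * t * g2"
    using mult_left_mono[OF g_bounds(4), of t] t_pos by (simp add: mult_ac)
  also have "\<dots> \<le> 2 * g2" using mu_t_lt_2 heights g_bounds by (intro mult_right_mono) auto
  finally have "(t + 1) * g1 \<le> 2 * g2" using g_bounds(2) by (simp add: algebra_simps)
  moreover have "(t + 1) * h2 \<le> (t + 1) * g1" using g_bounds(1) t_pos by (intro mult_left_mono) auto
  ultimately have g2_bound: "(t + 1) * h2 \<le> 2 * g2" by linarith
  have "t * h2 \<le> t\<^sup>2 * h1"
    using mult_left_mono[OF heights(3), of t] t_pos by (simp add: power2_eq_square mult_ac)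
  moreover have "t * h1 \<le> t\<^sup>2 * h0"
    using mult_left_mono[OF heights(2), of t] t_pos by (simp add: power2_eq_square mult_ac)
  ultimately have h2_bound: "t * h2 + h2 \<le> t\<^sup>2 * h1 + t\<^sup>2 * h0" using heights(3) by linarith
  have "(m - 1) * t\<^sup>2 * ((t + 1) * h2) \<le> (m - 1) * t\<^sup>2 * (2 * g2)"
    using g2_bound m_ge_2 by (intro mult_left_mono) auto
  also have "\<dots> = 2 * (t\<^sup>2 * ((m - 1) * g2))" by simp
  also have "\<dots> \<le> 2 * (t\<^sup>2 * (m * t * h2 - h1 - h0))" using s_bounds by (intro mult_left_mono) auto
  also have "\<dots> \<le> 2 * ((m * t ^ 3 - t - 1) * h2)"
    using h2_bound by (simp add: power2_eq_square power3_eq_cube algebra_simps)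
  finally have "((m - 1) * t\<^sup>2 * (t + 1)) * h2 \<le> (2 * (m * t ^ 3 - t - 1)) * h2" by (simp add: mult_ac)
  then have "(m - 1) * t\<^sup>2 * (t + 1) \<le> 2 * (m * t ^ 3 - t - 1)" using heights by simp
  then have "0 \<le> t * (m * t\<^sup>2 - (m - 1) * t - 2) + t ^ 3 - 2"
    by (simp add: power2_eq_square power3_eq_cube algebra_simps)
  moreover have "t * (m * t\<^sup>2 - (m - 1) * t - 2) < 0"
    using quadratic_neg t_pos by (rule mult_pos_neg[rotated])
  ultimately show False using t_cubed_lt_2 \<open>\<not> m < 3\<close> by simp
qed

lemma quadratic_neg_2: "m = 2 \<Longrightarrow> 2 * t\<^sup>2 < t + 2"
  using quadratic_neg by simp

lemma chained_polynomial_heights: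
  assumes "m = 2"
  shows "\<mu> * (4 * t ^ 3 - 3 * t - 3) < 1"
proof -
  have t_quadratic: "2 * t\<^sup>2 < t + 2" by (rule quadratic_neg_2[OF assms])
  have "4 * t ^ 3 = 2 * t * (2 * t\<^sup>2)" by (simp add: power2_eq_square power3_eq_cube)
  also have "\<dots> \<le> 2 * t * (t + 2)" using t_quadratic t_gt_1 by (intro mult_left_mono) auto
  also have "\<dots> = 2 * t\<^sup>2 + 4 * t" by (simp add: power2_eq_square algebra_simps)
  finally have "4 * t ^ 3 - 3 * t - 3 \<le> 2 * t - 1" using t_quadratic by linarith
  then have "\<mu> * (4 * t ^ 3 - 3 * t - 3) \<le> \<mu> * (2 * t - 1)" using mu_pos by (intro mult_left_mono) auto
  also have "\<dots> = (2 * t - 2) * (2 * t - 1)" using assms by (simp add: mu_eq)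
  also have "\<dots> < 1"
  proof (cases "t \<le> 5 / 4")
    case True
    then have "(2 * t - 2) * (2 * t - 1) \<le> (1 / 2) * (3 / 2)" using t_gt_1 by (intro mult_mono) auto
    then show ?thesis by simp
  next
    case False
    have "(2 * t - 2) * (2 * t - 1) = 2 * (2 * t\<^sup>2) - 6 * t + 2" by (simp add: power2_eq_square algebra_simps)
    then show ?thesis using t_quadratic False by linarith
  qed
  finally show ?thesis .
qed

lemma chained_polynomial_junctions:
  assumes "m = 2"
  shows "t * ((4 * t\<^sup>2 - 2 * t - 1) * (2 * t\<^sup>2) - 2 * t\<^sup>2) < (2 * t - 1) * t + (4 * t\<^sup>2 - 2 * t - 1) * (t + 1)"
proof (rule ccontr)
  have t_quadratic: "2 * t\<^sup>2 < t + 2" by (rule quadratic_neg_2[OF assms])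
  assume "\<not> ?thesis"
  then have "0 \<le> 4 * t ^ 3 * (2 * t\<^sup>2 - t - 2) - (4 * t\<^sup>2 - 4 * t - 1)"
    by (simp add: power2_eq_square power3_eq_cube algebra_simps)
  moreover have "4 * t ^ 3 * (2 * t\<^sup>2 - t - 2) \<le> 4 * 1 * (2 * t\<^sup>2 - t - 2)"
    using t_quadratic t_gt_1 by (intro mult_right_mono_neg) (auto intro: one_le_power)
  ultimately have "0 \<le> 4 * 1 * (2 * t\<^sup>2 - t - 2) - (4 * t\<^sup>2 - 4 * t - 1)"
    by (rule order.trans[OF _ diff_right_mono])
  then have "7 \<le> 4 * t\<^sup>2" by simp
  moreover have "t < 3 / 2"
  proof (rule ccontr)
    assume "\<not> t < 3 / 2"
    moreover from this have "(3 / 2) * t \<le> t * t" by (intro mult_right_mono) auto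
    ultimately show False using t_quadratic unfolding power2_eq_square by linarith
  qed
  ultimately show False using t_quadratic by linarith
qed

lemma chained_contradiction_heights:
  assumes m_eq_2: "m = 2" and heights: "0 < h1" "h2 \<le> t * h1"
    and g2_bound: "t * g2 \<le> 2 * t\<^sup>2 * h2 - (t + 1) * h1" and g_bounds: "h1 \<le> g0" "h2 \<le> g1"
    and s'_bounds: "g0 \<le> s'" "s' \<le> 2 * t * g2 - g1 - hx" "s' \<le> \<mu> * hx"
  shows False
proof -
  have "(1 + \<mu>) * h1 \<le> (1 + \<mu>) * s'" using g_bounds s'_bounds mu_pos by (intro mult_left_mono) auto
  also have "\<dots> \<le> \<mu> * hx + \<mu> * (2 * t * g2 - g1 - hx)"
    using s'_bounds(3) mult_left_mono[OF s'_bounds(2), of \<mu>] mu_pos by (simp add: algebra_simps)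
  also have "\<dots> = \<mu> * (2 * (t * g2) - g1)" by (simp add: algebra_simps)
  also have "\<dots> \<le> \<mu> * (2 * (2 * t\<^sup>2 * h2 - (t + 1) * h1) - h2)"
    using g2_bound g_bounds(2) mu_pos by (intro mult_left_mono) auto
  also have "\<dots> = \<mu> * ((4 * t\<^sup>2 - 1) * h2 - 2 * (t + 1) * h1)" by (simp add: algebra_simps)
  also have "\<dots> \<le> \<mu> * ((4 * t\<^sup>2 - 1) * (t * h1) - 2 * (t + 1) * h1)"
  proof -
    have "1 \<le> t\<^sup>2" using t_gt_1 by simp
    then have "(4 * t\<^sup>2 - 1) * h2 \<le> (4 * t\<^sup>2 - 1) * (t * h1)" using heights(2) by (intro mult_left_mono) auto
    then show ?thesis using mu_pos by (intro mult_left_mono) auto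
  qed
  also have "\<dots> = (\<mu> * (4 * t ^ 3 - 3 * t - 2)) * h1"
    by (simp add: power2_eq_square power3_eq_cube algebra_simps)
  finally have "1 + \<mu> \<le> \<mu> * (4 * t ^ 3 - 3 * t - 2)" using heights(1) by simp
  then show False using chained_polynomial_heights[OF m_eq_2] by (simp add: algebra_simps)
qed

lemma chained_contradiction_junctions:
  assumes m_eq_2: "m = 2" and heights: "0 < h1" "h2 \<le> t * h1"
    and g2_bound: "t * g2 \<le> 2 * t\<^sup>2 * h2 - (t + 1) * h1" and g_bounds: "h1 \<le> g0" "h2 \<le> g1"
    and hx: "g0 \<le> 2 * t * g2 - g1 - hx" "g2 + g1 \<le> (1 + \<mu>) * hx"
  shows False
proof -
  define c where "c = 4 * t\<^sup>2 - 2 * t - 1"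
  have mu_eq_2t: "1 + \<mu> = 2 * t - 1" using mu_eq m_eq_2 by simp
  have "1 * t \<le> t * t" using t_gt_1 by (intro mult_right_mono) auto
  then have c_bounds: "1 \<le> c" using t_gt_1 unfolding c_def power2_eq_square by linarith
  have "(1 + \<mu>) * hx \<le> (2 * t - 1) * (2 * t * g2 - g1 - g0)"
    unfolding mu_eq_2t using hx(1) t_gt_1 by (intro mult_left_mono) auto
  then have "2 * t * g1 + (2 * t - 1) * g0 \<le> c * g2"
    using hx(2) by (simp add: c_def power2_eq_square algebra_simps)
  moreover have "2 * t * h2 \<le> 2 * t * g1" "(2 * t - 1) * h1 \<le> (2 * t - 1) * g0"
    using g_bounds t_gt_1 by (auto intro!: mult_left_mono)
  ultimately have "2 * t * h2 + (2 * t - 1) * h1 \<le> c * g2" by linarith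
  then have "t * (2 * t * h2 + (2 * t - 1) * h1) \<le> t * (c * g2)" using t_gt_1 by (intro mult_left_mono) auto
  also have "\<dots> = c * (t * g2)" by simp
  also have "\<dots> \<le> c * (2 * t\<^sup>2 * h2 - (t + 1) * h1)" using g2_bound c_bounds by (intro mult_left_mono) auto
  finally have "((2 * t - 1) * t + c * (t + 1)) * h1 \<le> (c * (2 * t\<^sup>2) - 2 * t\<^sup>2) * h2"
    by (simp add: power2_eq_square algebra_simps)
  also have "\<dots> \<le> (c * (2 * t\<^sup>2) - 2 * t\<^sup>2) * (t * h1)"
  proof (rule mult_left_mono[OF heights(2)])
    have "1 * (2 * t\<^sup>2) \<le> c * (2 * t\<^sup>2)" using c_bounds by (intro mult_right_mono) auto
    then show "0 \<le> c * (2 * t\<^sup>2) - 2 * t\<^sup>2" by simp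
  qed
  finally have "((2 * t - 1) * t + c * (t + 1)) * h1 \<le> (t * (c * (2 * t\<^sup>2) - 2 * t\<^sup>2)) * h1"
    by (simp add: mult_ac)
  then have "(2 * t - 1) * t + c * (t + 1) \<le> t * (c * (2 * t\<^sup>2) - 2 * t\<^sup>2)" using heights(1) by simp
  then show False using chained_polynomial_junctions[OF m_eq_2] by (simp add: c_def)
qed

lemma chained_contradiction:
  assumes m_eq_2: "m = 2" and heights: "0 < h0" "h1 \<le> t * h0" "h2 \<le> t * h1" "h0 \<le> h1"
    and s_bounds: "h0 \<le> s" "s \<le> 2 * t * h2 - h1 - g2" and g_bounds: "h1 \<le> g0" "h2 \<le> g1"
    and s'_bounds: "g0 \<le> s'" "s' \<le> 2 * t * g2 - g1 - hx"
    and alternatives: "s' \<le> \<mu> * hx \<or> g2 + g1 \<le> (1 + \<mu>) * hx"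
  shows False
proof -
  have "t * g2 \<le> t * (2 * t * h2 - h1 - h0)" using s_bounds t_gt_1 by (intro mult_left_mono) auto
  also have "\<dots> \<le> 2 * t\<^sup>2 * h2 - (t + 1) * h1" using heights(2) by (simp add: power2_eq_square algebra_simps)
  finally have g2_bound: "t * g2 \<le> 2 * t\<^sup>2 * h2 - (t + 1) * h1" .
  have "0 < h1" using heights by linarith
  then show False
    using alternatives s'_bounds chained_contradiction_heights[OF m_eq_2 _ heights(3) g2_bound g_bounds s'_bounds]
      chained_contradiction_junctions[OF m_eq_2 _ heights(3) g2_bound g_bounds]
    by fastforce
qed

end

section \<open>Annihilators of three consecutive points\<close>

lemma exists_primitive_common_ann:
  assumes "p \<in> common_ann n N Y" "nonzero_below N p"
  obtains P where "primitive P" "supp_below N P" "P \<in> common_ann n N Y"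
proof -
  obtain g P where P_primitive: "g \<noteq> 0" "primitive P" "supp_below N P" "trunc N p = (\<lambda>j. g * P j)"
    by (rule primitive_part[OF assms(2)])
  have "P \<in> ann n N x" if "p \<in> ann n N x" for x
    using trunc_in_ann_iff[of N p n x] ann_scale_iff[OF P_primitive(1), of P n N x] that
    unfolding P_primitive(4) by blast
  then show thesis using that[OF P_primitive(2,3)] assms(1) by (auto simp: common_ann_def)
qed

locale exponent_sequence = point_sequence n m \<xi> y yp H M + exponent_numbers "real m" t \<mu>
  for n m :: nat and \<xi> :: real and y yp :: "nat \<Rightarrow> nat \<Rightarrow> int" and H M :: "nat \<Rightarrow> real" and t \<mu> :: real +
  fixes lam :: real
  assumes lam: "lam * (real m + 1 + \<mu>) = 1"
    and small: "(kappa n \<xi>)\<^sup>2 * M k \<le> H (Suc k) powr (- lam)"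
    and M_tendsto_0: "M \<longlonglongrightarrow> 0"
begin

definition h :: "nat \<Rightarrow> real" where
  "h k = ln (H k)"

text \<open>With this normalization the logarithm of \<open>M k\<close> is at most \<open>- h (Suc k)\<close>.\<close>

definition slog :: "real \<Rightarrow> real" where
  "slog z = (real m + 1 + \<mu>) * ln z"

lemma scale_pos: "0 < real m + 1 + \<mu>"
  using mu_pos by linarith

lemma H_pos: "0 < H k"
  using H_gt_1[of k] by linarith

lemma h_pos: "0 < h k"
  using H_gt_1[of k] by (simp add: h_def)

lemma h_mono: "i \<le> j \<Longrightarrow> h i \<le> h j"
  unfolding h_def using H_mono[of i j] H_pos[of i] by (intro ln_mono) auto

lemma slog_1 [simp]: "slog 1 = 0"
  by (simp add: slog_def)

lemma slog_mono: "0 < a \<Longrightarrow> a \<le> b \<Longrightarrow> slog a \<le> slog b"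
  unfolding slog_def using scale_pos by (intro mult_left_mono ln_mono) auto

lemma slog_mult: "0 < a \<Longrightarrow> 0 < b \<Longrightarrow> slog (a * b) = slog a + slog b"
  by (simp add: slog_def ln_mult_pos distrib_left)

lemma slog_power: "0 < a \<Longrightarrow> slog (a ^ k) = real k * slog a"
  by (simp add: slog_def ln_realpow)

lemma slog_H: "slog (H k) = (real m * t + 1) * h k"
  unfolding slog_def h_def mt_eq by (simp add: algebra_simps)

lemma kappa_pos: "0 < kappa n \<xi>"
  using kappa_ge_1[of n \<xi>] by linarith

lemma slog_kappa_nonneg: "0 \<le> slog (kappa n \<xi>)"
  using slog_mono[of 1 "kappa n \<xi>"] kappa_ge_1 by simp

lemma slog_M_le: "2 * slog (kappa n \<xi>) + slog (M k) \<le> - h (Suc k)"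
proof -
  have "slog ((kappa n \<xi>)\<^sup>2 * M k) \<le> slog (H (Suc k) powr (- lam))"
    using kappa_pos M_pos by (intro slog_mono small) auto
  also have "\<dots> = - (lam * (real m + 1 + \<mu>)) * h (Suc k)"
    using H_pos[of "Suc k"] by (simp add: slog_def h_def ln_powr)
  finally show ?thesis using kappa_pos M_pos[of k] by (simp add: lam slog_mult slog_power)
qed

lemma slog_M_le': "slog (M k) \<le> - h (Suc k)"
  using slog_M_le[of k] slog_kappa_nonneg by linarith

lemma slog_le_of_height_bound:
  assumes z_le: "z \<le> kappa n \<xi> * (H (Suc k) * M k * M (Suc k) ^ j * w)" and pos: "0 < z" "0 < w"
  shows "slog z \<le> real m * t * h (Suc k) - real j * h (Suc (Suc k)) + slog w"
proof -
  have "slog z \<le> slog (kappa n \<xi> * (H (Suc k) * M k * M (Suc k) ^ j * w))" by (rule slog_mono[OF pos(1) z_le])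
  also have "\<dots> = slog (kappa n \<xi>) + slog (H (Suc k)) + slog (M k) + real j * slog (M (Suc k)) + slog w"
    using kappa_pos H_pos[of "Suc k"] M_pos[of k] M_pos[of "Suc k"] pos(2) by (simp add: slog_mult slog_power)
  finally have "slog z \<le> slog (kappa n \<xi>) + (real m * t + 1) * h (Suc k) + slog (M k) + real j * slog (M (Suc k)) + slog w"
    by (simp only: slog_H)
  moreover have "real j * slog (M (Suc k)) \<le> real j * - h (Suc (Suc k))"
    by (intro mult_left_mono slog_M_le') auto
  ultimately show ?thesis using slog_M_le[of k] slog_kappa_nonneg by (simp add: algebra_simps)
qed

lemma h_growth:
  assumes "p \<in> ann n (m + 2) (y (Suc k))" "p \<notin> ann n (m + 2) (y k)"
  shows "h (Suc (Suc k)) \<le> t * h (Suc k)"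
proof -
  have "slog 1 \<le> real m * t * h (Suc k) - real m * h (Suc (Suc k)) + slog 1"
    using plane_height_growth[OF assms] by (intro slog_le_of_height_bound) auto
  then have "real m * h (Suc (Suc k)) \<le> real m * (t * h (Suc k))" by simp
  then show ?thesis using two_le_m by simp
qed

lemma h_le_slog_hgt:
  assumes N_bounds: "1 \<le> N" "N \<le> n + 1" and p_ann: "p \<in> ann n N (y (Suc k))" "p \<notin> ann n N (y k)"
  shows "h (Suc k) \<le> slog (hgt N p)"
proof -
  have "\<bar>real_of_int (y k 0)\<bar> \<le> \<bar>real_of_int (y (Suc k) 0)\<bar>" using y_mono[of k] y_pos[of k] by simp
  then have ge_1: "1 \<le> kappa n \<xi> * (hgt N p * M k)"
    by (rule hgt_ge_of_not_in_ann[OF N_bounds p_ann near near M_Suc])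
  then have "0 < hgt N p" using hgt_nonneg[of N p] by (cases "hgt N p = 0") (auto simp: less_le)
  then have "0 \<le> slog (kappa n \<xi>) + (slog (hgt N p) + slog (M k))"
    using slog_mono[OF _ ge_1] kappa_pos M_pos[of k] by (simp add: slog_mult)
  then show ?thesis using slog_M_le[of k] slog_kappa_nonneg by linarith
qed

lemma scaled_h_mono: "real j * h (Suc k) \<le> real j * h (Suc (Suc k))"
  by (intro mult_left_mono h_mono) auto

lemma slog_hgt_le_of_repeated:
  assumes P_ann: "primitive P" "supp_below (m + 2) P" "P \<in> ann n (m + 2) (y k)"
    "P \<in> ann n (m + 2) (y (Suc k))"
  shows "2 * slog (hgt (m + 2) P) \<le> (1 + \<mu>) * h (Suc k)"
proof -
  have pos: "0 < hgt (m + 2) P" by (rule hgt_pos[OF P_ann(1,2)])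
  have "slog ((hgt (m + 2) P)\<^sup>2) \<le> real m * t * h (Suc k) - real (m - 1) * h (Suc (Suc k)) + slog 1"
    using repeated_ann_height[OF P_ann] pos by (intro slog_le_of_height_bound) auto
  then have "2 * slog (hgt (m + 2) P) \<le> real m * t * h (Suc k) - real (m - 1) * h (Suc k)"
    using scaled_h_mono[of "m - 1" k] pos by (simp add: slog_power)
  then show ?thesis using two_le_m unfolding mt_eq by (simp add: of_nat_diff algebra_simps)
qed

lemma h_growth_of_no_common_ann:
  assumes "\<And>p. p \<in> common_ann n (m + 3) {y k, y (Suc k), y (Suc (Suc k))} \<Longrightarrow> \<not> nonzero_below (m + 3) p"
  shows "2 * h (Suc k) \<le> (1 + \<mu>) * h (Suc (Suc k))"
proof -
  have "slog 1 \<le> real m * t * h (Suc (Suc k)) - real (m - 1) * h (Suc (Suc (Suc k))) + slog ((M k)\<^sup>2)"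
    using growth_of_no_common_ann[OF assms] M_pos[of k] by (intro slog_le_of_height_bound) auto
  then have "2 * h (Suc k) \<le> real m * t * h (Suc (Suc k)) - real (m - 1) * h (Suc (Suc k))"
    using scaled_h_mono[of "m - 1" "Suc k"] slog_M_le'[of k] M_pos[of k] by (simp add: slog_power)
  then show ?thesis using two_le_m unfolding mt_eq by (simp add: of_nat_diff algebra_simps)
qed

lemma not_two_le: "h (Suc (Suc k)) \<le> t * h (Suc k) \<Longrightarrow> (1 + \<mu>) * h (Suc (Suc k)) < 2 * h (Suc k)"
proof -
  assume "h (Suc (Suc k)) \<le> t * h (Suc k)"
  then have "(1 + \<mu>) * h (Suc (Suc k)) \<le> (1 + \<mu>) * (t * h (Suc k))"
    using mu_pos by (intro mult_left_mono) auto
  also have "\<dots> = ((1 + \<mu>) * t) * h (Suc k)" by simp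
  also have "\<dots> < 2 * h (Suc k)" using mu_t_lt_2 h_pos by (intro mult_strict_right_mono) auto
  finally show ?thesis .
qed

lemma slog_sole_ann_le:
  assumes S_sole: "sole_ann (insert (Suc k) I) S" "S \<in> ann n (m + 3) (y k)"
    and I_bounds: "\<And>i. i \<in> I \<Longrightarrow> i0 \<le> i \<and> i \<le> k"
  shows "slog (hgt (m + 3) S) \<le> real m * t * h (Suc k) - (real m - 1) * h (Suc (Suc k)) - h (Suc i0)"
proof -
  have "0 < hgt (m + 3) S" using S_sole(1) by (intro hgt_pos) (auto simp: sole_ann_def)
  then have "slog (hgt (m + 3) S) \<le> real m * t * h (Suc k) - real (m - 1) * h (Suc (Suc k)) + slog (M i0)"
    using sole_ann_height[OF assms] M_pos[of i0] by (intro slog_le_of_height_bound) auto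
  then show ?thesis using slog_M_le'[of i0] two_le_m by (simp add: of_nat_diff)
qed

lemma h_le_slog_pencil:
  assumes pencil: "lin_indep (m + 3) [S1, S2]"
      "\<And>S. S \<in> {S1, S2} \<Longrightarrow> primitive S \<and> supp_below (m + 3) S \<and> S \<in> common_ann n (m + 3) {y k, y (Suc k)}"
    and P_ann: "primitive P" "supp_below (m + 2) P" "P \<in> ann n (m + 2) (y (Suc k))" "P \<notin> ann n (m + 2) (y k)"
  shows "h (Suc (Suc k)) \<le> slog (hgt (m + 3) S1) + slog (hgt (m + 3) S2)"
proof -
  define z where "z = hgt (m + 3) S1 * hgt (m + 3) S2 * M (Suc k)"
  have pos: "0 < hgt (m + 3) S1" "0 < hgt (m + 3) S2" using pencil(2) by (auto intro!: hgt_pos)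
  then have z_pos: "0 < z" using M_pos by (simp add: z_def)
  have "1 \<le> (kappa n \<xi>)\<^sup>2 * z ^ m"
    unfolding z_def by (rule pencil_heights_ge[OF pencil(1) _ P_ann]) (use pencil(2) in blast)
  also have "\<dots> \<le> ((kappa n \<xi>)\<^sup>2) ^ m * z ^ m"
    using z_pos kappa_ge_1 two_le_m by (intro mult_right_mono self_le_power one_le_power) auto
  also have "\<dots> = ((kappa n \<xi>)\<^sup>2 * z) ^ m" by (simp add: power_mult_distrib)
  finally have "0 \<le> slog (((kappa n \<xi>)\<^sup>2 * z) ^ m)" using slog_mono[of 1] by fastforce
  then have "0 \<le> real m * (2 * slog (kappa n \<xi>) + slog z)"
    using kappa_pos z_pos by (simp add: slog_power slog_mult)
  then have "0 \<le> 2 * slog (kappa n \<xi>) + slog z" using two_le_m by (simp add: zero_le_mult_iff)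
  then show ?thesis using slog_M_le[of "Suc k"] pos M_pos[of "Suc k"] by (simp add: z_def slog_mult)
qed

lemma slog_span3_ann_le:
  assumes "y c \<in> span3 a" and S_sole: "sole_ann (triple a) S"
  shows "slog (hgt (m + 3) S) \<le> real m * t * h (a + 2) - h (a + 1) - (real m - 1) * h (c + 1)"
proof -
  have "0 < hgt (m + 3) S" using S_sole by (intro hgt_pos) (auto simp: sole_ann_def)
  then have "slog (hgt (m + 3) S) \<le> real m * t * h (Suc (Suc a)) - real 0 * h (Suc (Suc (Suc a))) + slog (M a * M c ^ (m - 1))"
    using span3_ann_height[OF assms] M_pos[of a] M_pos[of c]
    by (intro slog_le_of_height_bound) (auto simp: mult.assoc)
  moreover have "real (m - 1) * slog (M c) \<le> real (m - 1) * - h (Suc c)"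
    by (intro mult_left_mono slog_M_le') auto
  ultimately show ?thesis
    using slog_M_le'[of a] M_pos[of a] M_pos[of c] two_le_m by (simp add: slog_mult slog_power of_nat_diff)
qed

lemma slog_spread_ann_le:
  assumes "spread_points n m \<xi> y yp H M a c S G P"
  shows "2 * slog (hgt (m + 3) S) \<le> (2 + \<mu>) * h (c + 1) - h (a + 2) - h (a + 1)"
proof -
  interpret spread_points n m \<xi> y yp H M a c S G P by fact
  have pos: "0 < hgt (m + 3) S" by (rule hgt_pos[OF S_common_ann(1,2)])
  have "slog ((hgt (m + 3) S)\<^sup>2) \<le> real m * t * h (Suc c) - real (m - 2) * h (Suc (Suc c)) + slog (M (Suc a) * M a)"
    using ann_height pos M_pos[of a] M_pos[of "Suc a"] by (intro slog_le_of_height_bound) auto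
  then have "2 * slog (hgt (m + 3) S) \<le> real m * t * h (Suc c) - real (m - 2) * h (Suc c) - h (Suc (Suc a)) - h (Suc a)"
    using scaled_h_mono[of "m - 2" c] slog_M_le'[of a] slog_M_le'[of "Suc a"] pos M_pos[of a] M_pos[of "Suc a"]
    by (simp add: slog_power slog_mult)
  then show ?thesis using two_le_m unfolding mt_eq by (simp add: of_nat_diff algebra_simps)
qed

lemma ann_inherited:
  assumes P_ann: "primitive P" "supp_below (m + 2) P" "P \<in> ann n (m + 2) (y (Suc k))"
    "P \<in> ann n (m + 2) (y (Suc (Suc k)))"
  shows "P \<in> ann n (m + 2) (y k)"
proof (rule ccontr)
  assume not_ann: "P \<notin> ann n (m + 2) (y k)"
  have "h (Suc k) \<le> slog (hgt (m + 2) P)" by (rule h_le_slog_hgt[OF _ _ P_ann(3) not_ann]) (use n_eq in auto)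
  then show False
    using slog_hgt_le_of_repeated[OF P_ann] not_two_le[OF h_growth[OF P_ann(3) not_ann]] by linarith
qed

text \<open>
  An annihilator common to \<open>y k\<close>, \<open>y (k + 1)\<close> is inherited by all earlier points; if this happened for
  arbitrarily large \<open>k\<close>, the annihilator of \<open>y 0\<close> would kill infinitely many points.
\<close>

lemma eventually_no_repeated_ann:
  "\<forall>\<^sub>F k in sequentially. \<forall>p\<in>common_ann n (m + 2) {y k, y (Suc k)}. \<not> nonzero_below (m + 2) p"
proof -
  obtain P0 where P0_primitive: "primitive P0" "supp_below (m + 2) P0" "P0 \<in> ann n (m + 2) (y 0)"
    by (rule exists_primitive_ann[of n "m + 2"]) (use n_eq in auto)
  have inherited: "P \<in> ann n (m + 2) (y 0)"
    if "primitive P" "supp_below (m + 2) P" "P \<in> ann n (m + 2) (y k)" "P \<in> ann n (m + 2) (y (Suc k))" for P k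
    using that
  proof (induction k)
    case (Suc k)
    then show ?case using ann_inherited[OF Suc.prems] by blast
  qed simp
  have P0_ann: "P0 \<in> ann n (m + 2) (y k)"
    if p_ann: "p \<in> common_ann n (m + 2) {y k, y (Suc k)}" "nonzero_below (m + 2) p" for p k
  proof -
    obtain P where P_ann: "primitive P" "supp_below (m + 2) P" "P \<in> common_ann n (m + 2) {y k, y (Suc k)}"
      by (rule exists_primitive_common_ann[OF p_ann])
    have "P0 \<in> rat_span (Suc (m + 1)) {P}"
      by (rule low_degree_ann_unique[of "m + 1" n "y 0"])
        (use P_ann P0_primitive inherited[OF P_ann(1,2)] primitive_nonzero full_rank[of 0] n_eq in \<open>auto simp: full_rank_def\<close>)
    then show ?thesis using rat_span_subset_ann[of "{P}" n "m + 2" "y k"] P_ann(3) by auto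
  qed
  have "\<forall>\<^sub>F k in sequentially. P0 \<notin> ann n (m + 2) (y k)"
    by (rule eventually_not_in_ann[OF no_root primitive_nonzero[OF P0_primitive(1,2)] _ near y_pos M_tendsto_0])
      (use n_eq in simp)
  then show ?thesis by (rule eventually_mono) (use P0_ann in blast)
qed

end

locale tail_sequence = exponent_sequence +
  fixes K :: nat
  assumes no_repeated_ann: "K \<le> k \<Longrightarrow> p \<in> common_ann n (m + 2) {y k, y (Suc k)} \<Longrightarrow> \<not> nonzero_below (m + 2) p"
begin

abbreviation log_height :: "(nat \<Rightarrow> int) \<Rightarrow> real" where
  "log_height S \<equiv> slog (hgt (m + 3) S)"

lemma exists_new_ann:
  assumes "K \<le> k"
  obtains P where "primitive P" "supp_below (m + 2) P" "P \<in> ann n (m + 2) (y (Suc k))"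
    "P \<notin> ann n (m + 2) (y k)"
proof -
  obtain P where P_ann: "primitive P" "supp_below (m + 2) P" "P \<in> ann n (m + 2) (y (Suc k))"
    by (rule exists_primitive_ann[of n "m + 2"]) (use n_eq in auto)
  then have "P \<notin> ann n (m + 2) (y k)" using no_repeated_ann[OF assms, of P] primitive_nonzero by auto
  then show thesis using that P_ann by blast
qed

lemma h_Suc_le:
  assumes "K < k"
  shows "h (k + 1) \<le> t * h k"
proof -
  obtain j where k_eq: "k = Suc j" "K \<le> j" using assms by (cases k) auto
  obtain P where "P \<in> ann n (m + 2) (y (Suc j))" "P \<notin> ann n (m + 2) (y j)" by (rule exists_new_ann[OF k_eq(2)])
  then show ?thesis using h_growth k_eq(1) by simp
qed

lemma sole_annD:
  assumes "sole_ann I S"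
  shows "primitive S" "supp_below (m + 3) S" "nonzero_below (m + 3) S" "S \<in> common_ann n (m + 3) (y ` I)"
  using assms primitive_nonzero[of S "m + 3"] by (auto simp: sole_ann_def intro: rat_span_base)

lemma sole_ann_tripleI:
  assumes K_le: "K \<le> k"
    and S_ann: "primitive S" "supp_below (m + 3) S" "S \<in> common_ann n (m + 3) (y ` triple k)"
  shows "sole_ann (triple k) S"
proof -
  have "p \<in> rat_span (m + 3) {S}" if p_ann: "p \<in> common_ann n (m + 3) (y ` triple k)" for p
  proof (rule ccontr)
    assume "p \<notin> rat_span (m + 3) {S}"
    then have indep: "lin_indep (m + 3) [S, p]"
      using primitive_nonzero[OF S_ann(1,2)] by (simp add: lin_indep_pair_iff)
    obtain P where P_ann: "supp_below (m + 2) P" "P \<in> ann n (m + 2) (y (Suc k))" "P \<notin> ann n (m + 2) (y k)"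
      by (rule exists_new_ann[OF K_le])
    have "y (Suc (Suc k)) \<in> rat_span (n + 1) {y (Suc k), y k}"
      by (rule common_pencil_imp_coplanar[OF n_eq _ full_rank P_ann indep]) (use S_ann(3) p_ann two_le_m in auto)
    then show False
      using lin_indep_snoc_iff[OF indep2, of k "y (Suc (Suc k))"] indep3[of k] by (simp add: insert_commute)
  qed
  moreover have "rat_span (m + 3) {S} \<subseteq> common_ann n (m + 3) (y ` triple k)"
    using rat_span_subset_ann[of "{S}" n "m + 3"] S_ann(3) by auto
  ultimately show ?thesis using S_ann(1,2) by (auto simp: sole_ann_def)
qed

lemma exists_sole_ann:
  assumes K_le: "K \<le> k"
  obtains S where "sole_ann (triple k) S"
proof -
  have "\<exists>p\<in>common_ann n (m + 3) {y k, y (Suc k), y (Suc (Suc k))}. nonzero_below (m + 3) p"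
  proof (rule ccontr)
    assume "\<not> ?thesis"
    then have "2 * h (Suc k) \<le> (1 + \<mu>) * h (Suc (Suc k))" by (intro h_growth_of_no_common_ann) blast
    then show False using not_two_le[of k] h_Suc_le[of "Suc k"] K_le by simp
  qed
  then obtain p where p_ann: "p \<in> common_ann n (m + 3) (y ` triple k)" "nonzero_below (m + 3) p" by auto
  obtain S where "primitive S" "supp_below (m + 3) S" "S \<in> common_ann n (m + 3) (y ` triple k)"
    by (rule exists_primitive_common_ann[OF p_ann])
  then show thesis using that sole_ann_tripleI[OF K_le] by blast
qed

lemma sole_ann_transfer:
  assumes "sole_ann I S" "sole_ann I S'" "S \<in> ann n (m + 3) x"
  shows "S' \<in> ann n (m + 3) x"
proof -
  have "S' \<in> rat_span (m + 3) {S}" using assms(1) sole_annD(4)[OF assms(2)] by (simp add: sole_ann_def)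
  then show ?thesis using rat_span_subset_ann[of "{S}" n "m + 3" x] assms(3) by blast
qed

lemma log_height_sole_ann_le:
  assumes "sole_ann (triple k) S"
  shows "log_height S \<le> real m * t * h (k + 2) - (real m - 1) * h (k + 3) - h (k + 1)"
proof -
  have "sole_ann (insert (Suc (Suc k)) {k, Suc k}) S" using assms by (simp add: insert_commute)
  moreover have "S \<in> ann n (m + 3) (y (Suc k))" using sole_annD(4)[OF assms] by simp
  ultimately have "log_height S \<le> real m * t * h (Suc (Suc k)) - (real m - 1) * h (Suc (Suc (Suc k))) - h (Suc k)"
    by (rule slog_sole_ann_le) auto
  then show ?thesis by (simp add: eval_nat_numeral)
qed

definition junction :: "nat \<Rightarrow> (nat \<Rightarrow> int) \<Rightarrow> (nat \<Rightarrow> int) \<Rightarrow> bool" where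
  "junction a S' S \<longleftrightarrow> sole_ann (triple a) S' \<and> sole_ann (triple (Suc a)) S \<and> S' \<notin> ann n (m + 3) (y (a + 3))"

lemma junctionD:
  assumes "junction a S' S"
  shows "sole_ann (triple a) S'" "sole_ann (triple (Suc a)) S" "S' \<notin> ann n (m + 3) (y (a + 3))"
    "S \<in> ann n (m + 3) (y (a + 3))"
  using assms sole_annD(4)[of "triple (Suc a)" S] by (auto simp: junction_def eval_nat_numeral)

lemma junction_not_ann:
  assumes K_le: "K \<le> a" and at_junction: "junction a S' S"
  shows "S \<notin> ann n (m + 3) (y a)"
proof
  note S_sole = junctionD(2)[OF at_junction]
  assume "S \<in> ann n (m + 3) (y a)"
  then have "sole_ann (triple a) S" using sole_annD[OF S_sole] by (intro sole_ann_tripleI[OF K_le]) auto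
  from sole_ann_transfer[OF this junctionD(1)[OF at_junction] junctionD(4)[OF at_junction]] show False
    using junctionD(3)[OF at_junction] by blast
qed

lemma junction_indep:
  assumes "junction a S' S"
  shows "lin_indep (m + 3) [S, S']"
  using junctionD(3,4)[OF assms] sole_annD(3)[OF junctionD(2)[OF assms]] rat_span_subset_ann[of "{S}" n "m + 3" "y (a + 3)"]
  by (auto simp: lin_indep_pair_iff)

lemma h_le_log_height:
  assumes K_le: "K \<le> a" and at_junction: "junction a S' S"
  shows "h (a + 1) \<le> log_height S"
  using h_le_slog_hgt[of "m + 3" S a] junction_not_ann[OF assms] sole_annD(4)[OF junctionD(2)[OF at_junction]] n_eq two_le_m by simp

lemma h_le_log_height_add:
  assumes K_le: "K \<le> a" and at_junction: "junction a S' S"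
  shows "h (a + 3) \<le> log_height S + log_height S'"
proof -
  obtain P where P_ann: "primitive P" "supp_below (m + 2) P" "P \<in> ann n (m + 2) (y (Suc (Suc a)))"
    "P \<notin> ann n (m + 2) (y (Suc a))"
    by (rule exists_new_ann[of "Suc a"]) (use K_le in simp)
  have "h (Suc (Suc (Suc a))) \<le> log_height S + log_height S'"
    by (rule h_le_slog_pencil[OF junction_indep[OF at_junction] _ P_ann])
      (use sole_annD[OF junctionD(1)[OF at_junction]] sole_annD[OF junctionD(2)[OF at_junction]] in auto)
  then show ?thesis by (simp add: eval_nat_numeral)
qed

lemma h_growth_of_junction:
  assumes K_le: "K \<le> a" and at_junction: "junction a S' S"
  shows "h (a + 2) + h (a + 1) \<le> (1 + \<mu>) * h (a + 3)"
proof -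
  have "log_height S \<le> real m * t * h (a + 3) - (real m - 1) * h (a + 4) - h (a + 2)"
    using log_height_sole_ann_le[OF junctionD(2)[OF at_junction]] by (simp add: eval_nat_numeral)
  moreover have "(real m - 1) * h (a + 3) \<le> (real m - 1) * h (a + 4)"
    using m_ge_2 by (intro mult_left_mono h_mono) auto
  ultimately show ?thesis
    using h_le_log_height[OF K_le at_junction] unfolding mt_eq by (simp add: algebra_simps)
qed

lemma ann_of_in_span3: "sole_ann (triple b) S \<Longrightarrow> y i \<in> span3 b \<Longrightarrow> S \<in> ann n (m + 3) (y i)"
  using ann_of_span3 sole_annD(4) by blast

lemma exists_not_ann:
  assumes "nonzero_below (m + 3) S"
  obtains i where "b \<le> i" "S \<notin> ann n (m + 3) (y i)"
proof -
  have "\<forall>\<^sub>F k in sequentially. S \<notin> ann n (m + 3) (y k)"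
    by (rule eventually_not_in_ann[OF no_root assms _ near y_pos M_tendsto_0]) (use n_eq two_le_m in simp)
  then have "\<forall>\<^sub>F k in sequentially. b \<le> k \<and> S \<notin> ann n (m + 3) (y k)"
    by (intro eventually_conj eventually_ge_at_top)
  from eventually_happens'[OF _ this] show thesis using that by auto
qed

lemma last_in_span3:
  assumes S_sole: "sole_ann (triple b) S"
  obtains c where "b + 2 \<le> c" "\<And>i. b \<le> i \<Longrightarrow> i \<le> c \<Longrightarrow> y i \<in> span3 b" "y (Suc c) \<notin> span3 b"
proof -
  obtain i where "b \<le> i" "S \<notin> ann n (m + 3) (y i)" by (rule exists_not_ann[OF sole_annD(3)[OF S_sole]])
  then have "\<exists>i. b \<le> i \<and> y i \<notin> span3 b" using ann_of_in_span3[OF S_sole] by blast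
  then obtain i where i_ge: "b \<le> i" "y i \<notin> span3 b" and least: "\<And>j. j < i \<Longrightarrow> b \<le> j \<Longrightarrow> y j \<in> span3 b"
    using exists_least_iff[of "\<lambda>i. b \<le> i \<and> y i \<notin> span3 b"] by blast
  have "i \<notin> triple b" using i_ge(2) y_in_span3[of i b] by blast
  then have "b + 3 \<le> i" using i_ge(1) by auto
  then show thesis using that[of "i - 1"] i_ge(2) least by simp
qed

lemma log_height_le_of_ann_beyond_span3:
  assumes K_le: "K \<le> a" and at_junction: "junction a S' S"
    and c_bounds: "a + 3 \<le> c" "y c \<in> span3 (Suc a)" "y (Suc c) \<notin> span3 (Suc a)"
    and S_ann_Suc_c: "S \<in> ann n (m + 3) (y (Suc c))"
  shows "log_height S \<le> \<mu> * h (c + 1)"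
proof (cases "sole_ann (insert (Suc c) {c}) S")
  case True
  have "log_height S \<le> real m * t * h (Suc c) - (real m - 1) * h (Suc (Suc c)) - h (Suc c)"
    using ann_of_in_span3[OF junctionD(2)[OF at_junction] c_bounds(2)]
    by (intro slog_sole_ann_le[OF True]) auto
  moreover have "(real m - 1) * h (Suc c) \<le> (real m - 1) * h (Suc (Suc c))"
    using m_ge_2 by (intro mult_left_mono h_mono) auto
  ultimately show ?thesis unfolding mt_eq by (simp add: algebra_simps)
next
  case False
  note S_sole = junctionD(2)[OF at_junction]
  have S_ann_c: "S \<in> ann n (m + 3) (y c)" by (rule ann_of_in_span3[OF S_sole c_bounds(2)])
  have "rat_span (m + 3) {S} \<subseteq> common_ann n (m + 3) {y (Suc c), y c}"
    using S_ann_Suc_c S_ann_c rat_span_subset_ann[of "{S}" n "m + 3"] by auto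
  then obtain p where p_ann: "p \<in> common_ann n (m + 3) {y (Suc c), y c}" "p \<notin> rat_span (m + 3) {S}"
    using False sole_annD(1,2)[OF S_sole] by (auto simp: sole_ann_def)
  define G where "G = trunc (m + 3) p"
  have "lin_indep (m + 3) [S, G]" using p_ann(2) sole_annD(3)[OF S_sole] by (simp add: G_def lin_indep_pair_iff)
  moreover obtain P where "supp_below (m + 2) P" "P \<in> ann n (m + 2) (y (Suc c))" "P \<notin> ann n (m + 2) (y c)"
    by (rule exists_new_ann[of c]) (use K_le c_bounds(1) in auto)
  ultimately have "spread_points n m \<xi> y yp H M (Suc a) c S G P"
    using c_bounds sole_annD[OF S_sole] p_ann(1) S_ann_Suc_c by unfold_locales (auto simp: G_def)
  then have "2 * log_height S \<le> (2 + \<mu>) * h (c + 1) - h (a + 3) - h (a + 2)"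
    using slog_spread_ann_le by (simp add: eval_nat_numeral)
  moreover have "log_height S \<le> real m * t * h (a + 3) - h (a + 2) - (real m - 1) * h (c + 1)"
    using slog_span3_ann_le[OF c_bounds(2) S_sole] by (simp add: eval_nat_numeral)
  moreover have "h (a + 2) \<le> t * h (a + 1)" "h (a + 3) \<le> t * h (a + 2)"
    using h_Suc_le[of "a + 1"] h_Suc_le[of "a + 2"] K_le by (simp_all add: eval_nat_numeral)
  ultimately show ?thesis
    using spread_contradiction[OF h_pos _ _ _ h_le_log_height[OF K_le at_junction]] h_mono[of "a + 1" "a + 2"] by simp blast
qed

lemma junction_cases:
  assumes K_le: "K \<le> a" and at_junction: "junction a S' S"
  obtains c where "a + 3 \<le> c" "\<And>i. Suc a \<le> i \<Longrightarrow> i \<le> c \<Longrightarrow> y i \<in> span3 (Suc a)"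
    "log_height S \<le> \<mu> * h (c + 1) \<or> S \<notin> ann n (m + 3) (y (c + 1))"
proof -
  obtain c where c_bounds: "Suc a + 2 \<le> c" "\<And>i. Suc a \<le> i \<Longrightarrow> i \<le> c \<Longrightarrow> y i \<in> span3 (Suc a)"
    "y (Suc c) \<notin> span3 (Suc a)"
    by (rule last_in_span3[OF junctionD(2)[OF at_junction]]) blast
  have "log_height S \<le> \<mu> * h (c + 1)" if "S \<in> ann n (m + 3) (y (c + 1))"
    by (rule log_height_le_of_ann_beyond_span3[OF K_le at_junction]) (use c_bounds that in auto)
  then show thesis by (intro that[of c]) (use c_bounds(1,2) in auto)
qed

lemma next_junction:
  assumes K_le: "K \<le> a" and S_sole: "sole_ann (triple (Suc a)) S"
    and d_bounds: "Suc a \<le> d" "\<And>i. Suc a \<le> i \<Longrightarrow> i \<le> d + 2 \<Longrightarrow> y i \<in> span3 (Suc a)"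
    and not_ann: "S \<notin> ann n (m + 3) (y (d + 3))"
  obtains S2 where "junction d S S2"
proof -
  have "S \<in> ann n (m + 3) (y i)" if "i \<in> triple d" for i
    by (rule ann_of_in_span3[OF S_sole d_bounds(2)]) (use d_bounds(1) that in auto)
  then have "sole_ann (triple d) S"
    using K_le d_bounds(1) sole_annD(1,2)[OF S_sole] by (intro sole_ann_tripleI) auto
  moreover obtain S2 where "sole_ann (triple (Suc d)) S2"
    by (rule exists_sole_ann[of "Suc d"]) (use K_le d_bounds(1) in auto)
  ultimately show thesis using that not_ann by (auto simp: junction_def)
qed

lemma chained_junction_alternatives:
  assumes K_le: "K \<le> d" and at_junction: "junction d S S2"
  obtains c where "d + 3 \<le> c" "y c \<in> span3 (Suc d)"
    "log_height S2 \<le> \<mu> * h (c + 1) \<or> h (d + 3) + h (d + 2) \<le> (1 + \<mu>) * h (c + 1)"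
proof -
  obtain c where c_bounds: "d + 3 \<le> c" "\<And>i. Suc d \<le> i \<Longrightarrow> i \<le> c \<Longrightarrow> y i \<in> span3 (Suc d)"
    "log_height S2 \<le> \<mu> * h (c + 1) \<or> S2 \<notin> ann n (m + 3) (y (c + 1))"
    by (rule junction_cases[OF K_le at_junction]) blast
  have "h (d + 3) + h (d + 2) \<le> (1 + \<mu>) * h (c + 1)" if not_ann: "S2 \<notin> ann n (m + 3) (y (c + 1))"
  proof -
    obtain e where c_eq: "c = e + 2" "Suc d \<le> e" using c_bounds(1) that[of "c - 2"] by auto
    obtain S3 where junction_e: "junction e S2 S3"
      by (rule next_junction[OF K_le junctionD(2)[OF at_junction] c_eq(2)]) (use c_bounds(2) not_ann c_eq(1) in \<open>auto simp: eval_nat_numeral\<close>)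
    have "h (e + 2) + h (e + 1) \<le> (1 + \<mu>) * h (e + 3)"
      by (rule h_growth_of_junction[OF _ junction_e]) (use K_le c_eq in auto)
    moreover have "h (d + 3) \<le> h (e + 2)" "h (d + 2) \<le> h (e + 1)" using c_eq by (auto intro!: h_mono)
    ultimately show ?thesis using c_eq by (simp add: eval_nat_numeral)
  qed
  then show thesis using that[of c] c_bounds by auto
qed

lemma no_chained_junctions:
  assumes K_le: "K \<le> a" and at_junction: "junction a S' S"
    and d_bounds: "Suc a \<le> d" "\<And>i. Suc a \<le> i \<Longrightarrow> i \<le> d + 2 \<Longrightarrow> y i \<in> span3 (Suc a)"
    and not_ann: "S \<notin> ann n (m + 3) (y (d + 3))"
  shows False
proof -
  note S_sole = junctionD(2)[OF at_junction]
  obtain S2 where junction_d: "junction d S S2" by (rule next_junction[OF K_le S_sole d_bounds not_ann])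
  have K_le_d: "K \<le> d" using K_le d_bounds by simp
  obtain c where c_bounds: "d + 3 \<le> c" "y c \<in> span3 (Suc d)"
    and alternatives: "log_height S2 \<le> \<mu> * h (c + 1) \<or> h (d + 3) + h (d + 2) \<le> (1 + \<mu>) * h (c + 1)"
    by (rule chained_junction_alternatives[OF K_le_d junction_d])
  have growth: "h (a + 2) \<le> t * h (a + 1)" "h (a + 3) \<le> t * h (a + 2)" "h (d + 2) \<le> t * h (d + 1)"
    using h_Suc_le[of "a + 1"] h_Suc_le[of "a + 2"] h_Suc_le[of "d + 1"] K_le K_le_d
    by (simp_all add: eval_nat_numeral)
  have mono: "h (a + 1) \<le> h (a + 2)" "h (a + 2) \<le> h (a + 3)" "h (a + 3) \<le> h (d + 2)" "h (d + 2) \<le> h (d + 3)"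
    "h (a + 2) \<le> h (d + 1)"
    using d_bounds(1) by (auto intro!: h_mono)
  have S_le: "log_height S \<le> real m * t * h (a + 3) - h (a + 2) - (real m - 1) * h (d + 3)"
    using slog_span3_ann_le[OF d_bounds(2) S_sole, of "d + 2"] d_bounds(1) by (simp add: eval_nat_numeral)
  have S2_le: "log_height S2 \<le> real m * t * h (d + 3) - h (d + 2) - (real m - 1) * h (c + 1)"
    using slog_span3_ann_le[OF c_bounds(2) junctionD(2)[OF junction_d]] by (simp add: eval_nat_numeral)
  have "real m < 3"
    by (rule chained_bound[OF h_pos growth(1,2) mono(1,2) h_le_log_height[OF K_le at_junction] S_le mono(3) growth(3) mono(4)
        h_growth_of_junction[OF K_le_d junction_d]])
  then have "m = 2" using two_le_m by simp
  then show False
    using S_le S2_le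
    by (intro chained_contradiction[OF _ h_pos growth(1,2) mono(1) h_le_log_height[OF K_le at_junction] _ mono(5,3)
          h_le_log_height[OF K_le_d junction_d] _ alternatives]) auto
qed

lemma exists_junction:
  obtains a S' S where "K < a" "junction a S' S"
proof -
  obtain S' where S'_sole: "sole_ann (triple (Suc K)) S'" by (rule exists_sole_ann[of "Suc K"]) auto
  obtain i where "Suc K \<le> i" "S' \<notin> ann n (m + 3) (y i)" by (rule exists_not_ann[OF sole_annD(3)[OF S'_sole]])
  then obtain i where i_ge: "Suc K \<le> i" "S' \<notin> ann n (m + 3) (y i)"
    and least: "\<And>j. j < i \<Longrightarrow> Suc K \<le> j \<Longrightarrow> S' \<in> ann n (m + 3) (y j)"
    using exists_least_iff[of "\<lambda>i. Suc K \<le> i \<and> S' \<notin> ann n (m + 3) (y i)"] by blast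
  have "i \<notin> triple (Suc K)" using i_ge(2) sole_annD(4)[OF S'_sole] by auto
  then have "K + 4 \<le> i" using i_ge(1) by auto
  then obtain a where i_eq: "i = a + 3" "K < a" using that[of "i - 3"] by auto
  have "sole_ann (triple a) S'" using i_eq least sole_annD(1,2)[OF S'_sole] by (intro sole_ann_tripleI) auto
  moreover obtain S where "sole_ann (triple (Suc a)) S"
    by (rule exists_sole_ann[of "Suc a"]) (use i_eq in auto)
  ultimately show thesis using that[OF i_eq(2)] i_ge(2) i_eq(1) by (auto simp: junction_def)
qed

lemma no_separated_junction:
  assumes K_le: "K \<le> a" and at_junction: "junction (Suc a) S' S" and S'_ann: "S' \<in> ann n (m + 3) (y a)"
  shows False
proof -
  have K_le_Suc: "K \<le> Suc a" using K_le by simp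
  have "sole_ann (triple a) S'"
    using sole_annD[OF junctionD(1)[OF at_junction]] S'_ann by (intro sole_ann_tripleI[OF K_le]) auto
  from log_height_sole_ann_le[OF this]
  have S'_le: "log_height S' \<le> real m * t * h (a + 2) - (real m - 1) * h (a + 3) - h (a + 1)" .
  obtain c where c_bounds: "Suc a + 3 \<le> c" "\<And>i. Suc (Suc a) \<le> i \<Longrightarrow> i \<le> c \<Longrightarrow> y i \<in> span3 (Suc (Suc a))"
    and cases: "log_height S \<le> \<mu> * h (c + 1) \<or> S \<notin> ann n (m + 3) (y (c + 1))"
    by (rule junction_cases[OF K_le_Suc at_junction]) blast
  have S_le: "log_height S \<le> real m * t * h (a + 4) - h (a + 3) - (real m - 1) * h (c + 1)"
    using slog_span3_ann_le[OF c_bounds(2) junctionD(2)[OF at_junction], of c] c_bounds(1)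
    by (simp add: eval_nat_numeral)
  have growth: "h (a + 2) \<le> t * h (a + 1)" "h (a + 3) \<le> t * h (a + 2)" "h (a + 4) \<le> t * h (a + 3)"
    using h_Suc_le[of "a + 1"] h_Suc_le[of "a + 2"] h_Suc_le[of "a + 3"] K_le
    by (simp_all add: eval_nat_numeral)
  have lower: "h (a + 2) \<le> log_height S" "h (a + 4) \<le> log_height S + log_height S'"
    using h_le_log_height[OF K_le_Suc at_junction] h_le_log_height_add[OF K_le_Suc at_junction]
    by (simp_all add: eval_nat_numeral)
  from cases show False
  proof
    assume upper: "log_height S \<le> \<mu> * h (c + 1)"
    have "h (a + 2) \<le> h (a + 3)" by (simp add: h_mono)
    from separated_contradiction[OF h_pos growth(1) this growth(2,3) lower(1) S_le upper lower(2) S'_le] show False .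
  next
    assume not_ann: "S \<notin> ann n (m + 3) (y (c + 1))"
    obtain d where "c = d + 2" "Suc (Suc a) \<le> d" using c_bounds(1) that[of "c - 2"] by auto
    then show False
      using c_bounds(2) not_ann
      by (intro no_chained_junctions[OF K_le_Suc at_junction, of d]) (auto simp: eval_nat_numeral)
  qed
qed

lemma no_tail_sequence: False
proof -
  obtain a S' S where a_junction: "K < a" "junction a S' S" by (rule exists_junction)
  then obtain b where "a = Suc b" and K_le_b: "K \<le> b" by (cases a) auto
  then have at_junction: "junction (Suc b) S' S" using a_junction(2) by simp
  show False
  proof (cases "S' \<in> ann n (m + 3) (y b)")
    case True
    then show False by (rule no_separated_junction[OF K_le_b at_junction])
  next
    case False
    note S'_sole = junctionD(1)[OF at_junction]
    obtain S'' where S''_sole: "sole_ann (triple b) S''" by (rule exists_sole_ann[OF K_le_b])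
    have "S'' \<notin> ann n (m + 3) (y (b + 3))"
    proof
      assume "S'' \<in> ann n (m + 3) (y (b + 3))"
      then have "sole_ann (triple (Suc b)) S''"
        using K_le_b sole_annD[OF S''_sole] by (intro sole_ann_tripleI) (auto simp: eval_nat_numeral)
      then have "S' \<in> ann n (m + 3) (y b)"
        by (rule sole_ann_transfer[OF _ S'_sole]) (use sole_annD(4)[OF S''_sole] in simp)
      then show False using False by blast
    qed
    then have "junction b S'' S'" using S'_sole S''_sole by (simp add: junction_def)
    moreover have "y i \<in> span3 (Suc b)" if "Suc b \<le> i" "i \<le> Suc b + 2" for i
    proof (rule y_in_span3)
      have "i = Suc b \<or> i = Suc (Suc b) \<or> i = Suc (Suc (Suc b))" using that by linarith
      then show "i \<in> triple (Suc b)" by simp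
    qed
    ultimately show False
      by (rule no_chained_junctions[OF K_le_b _ order_refl _ junctionD(3)[OF at_junction]])
  qed
qed

end

lemma (in exponent_sequence) no_exponent_sequence: False
proof -
  obtain K where "\<And>k. K \<le> k \<Longrightarrow> \<forall>p\<in>common_ann n (m + 2) {y k, y (Suc k)}. \<not> nonzero_below (m + 2) p"
    using eventually_no_repeated_ann unfolding eventually_sequentially by blast
  then have "tail_sequence n m \<xi> y yp H M t \<mu> lam K" by unfold_locales blast
  then show False by (rule tail_sequence.no_tail_sequence)
qed

section \<open>Best approximations\<close>

definition nearest_point :: "nat \<Rightarrow> real \<Rightarrow> nat \<Rightarrow> nat \<Rightarrow> int" where
  "nearest_point n \<xi> r = (\<lambda>j. if j \<le> n then round (real r * \<xi> ^ j) else 0)"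

definition err :: "nat \<Rightarrow> real \<Rightarrow> nat \<Rightarrow> real" where
  "err n \<xi> r = (MAX k\<in>{1..n}. \<bar>real r * \<xi> ^ k - real_of_int (round (real r * \<xi> ^ k))\<bar>)"

lemma nearest_point_0 [simp]: "nearest_point n \<xi> r 0 = int r"
  by (simp add: nearest_point_def)

lemma supp_nearest_point: "supp_below (n + 1) (nearest_point n \<xi> r)"
  by (simp add: nearest_point_def supp_below_def)

lemma err_le_iff: "1 \<le> n \<Longrightarrow> err n \<xi> r \<le> L \<longleftrightarrow> (\<forall>k\<in>{1..n}. \<bar>real r * \<xi> ^ k - real_of_int (round (real r * \<xi> ^ k))\<bar> \<le> L)"
  unfolding err_def by (subst Max_le_iff) auto

lemma err_ge: "k \<in> {1..n} \<Longrightarrow> \<bar>real r * \<xi> ^ k - real_of_int (round (real r * \<xi> ^ k))\<bar> \<le> err n \<xi> r"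
  unfolding err_def by (rule Max_ge) auto

lemma err_nonneg: "1 \<le> n \<Longrightarrow> 0 \<le> err n \<xi> r"
  by (rule order_trans[OF abs_ge_zero err_ge[of 1]]) simp

lemma err_le_half: "1 \<le> n \<Longrightarrow> err n \<xi> r \<le> 1 / 2"
  by (rule iffD2[OF err_le_iff], assumption, rule ballI, subst abs_minus_commute, rule of_int_round_abs_le)

lemma near_curve_nearest_point:
  assumes "1 \<le> n"
  shows "near_curve n \<xi> (nearest_point n \<xi> r) (err n \<xi> r)"
  unfolding near_curve_def
proof (intro allI impI)
  fix i assume "i \<le> n"
  then show "\<bar>real_of_int (nearest_point n \<xi> r i) - real_of_int (nearest_point n \<xi> r 0) * \<xi> ^ i\<bar> \<le> err n \<xi> r"
    using err_ge[of i n r \<xi>] err_nonneg[OF assms, of \<xi> r]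
    by (cases "i = 0") (auto simp: nearest_point_def abs_minus_commute)
qed

lemma err_le_of_near_curve:
  assumes one_le_n: "1 \<le> n" and x_near: "near_curve n \<xi> x L" "\<bar>x 0\<bar> = int r"
  shows "err n \<xi> r \<le> L"
  unfolding err_le_iff[OF one_le_n]
proof
  fix k assume k_in: "k \<in> {1..n}"
  have r_eq: "real r = real_of_int (sgn (x 0)) * real_of_int (x 0)"
    using x_near(2) by (simp add: abs_sgn mult.commute flip: of_int_mult)
  have "\<bar>real r * \<xi> ^ k - real_of_int (round (real r * \<xi> ^ k))\<bar> \<le> \<bar>real r * \<xi> ^ k - real_of_int (sgn (x 0) * x k)\<bar>"
    using round_diff_minimal by blast
  also have "real r * \<xi> ^ k - real_of_int (sgn (x 0) * x k) = real_of_int (sgn (x 0)) * (real_of_int (x 0) * \<xi> ^ k - real_of_int (x k))"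
    unfolding r_eq by (simp add: algebra_simps)
  also have "\<bar>\<dots>\<bar> \<le> 1 * \<bar>real_of_int (x 0) * \<xi> ^ k - real_of_int (x k)\<bar>"
    unfolding abs_mult by (intro mult_right_mono) (auto simp: sgn_if)
  also have "\<dots> \<le> L" using x_near(1) k_in by (simp add: near_curve_def abs_minus_commute)
  finally show "\<bar>real r * \<xi> ^ k - real_of_int (round (real r * \<xi> ^ k))\<bar> \<le> L" .
qed

lemma err_pos:
  assumes one_le_n: "1 \<le> n" and no_root: "no_int_root n \<xi>" and r_ge: "1 \<le> r"
  shows "0 < err n \<xi> r"
proof (rule ccontr)
  assume "\<not> 0 < err n \<xi> r"
  then have zero: "real r * \<xi> - real_of_int (round (real r * \<xi>)) = 0"
    using err_ge[of 1 n r \<xi>] one_le_n by simp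
  define p where "p = (\<lambda>j::nat. if j = 0 then - round (real r * \<xi>) else int r)"
  have "nonzero_below 2 p" unfolding nonzero_below_def using r_ge by (intro exI[of _ 1]) (auto simp: p_def)
  then have "poly_value 2 p \<xi> \<noteq> 0" by (rule poly_value_nonzero[OF no_root]) (use one_le_n in simp)
  then show False using zero by (simp add: poly_value_def p_def numeral_2_eq_2)
qed

lemma primitive_proportional:
  assumes "primitive p" "primitive p'" "\<And>j. a * p j = b * p' j"
  shows "\<bar>a\<bar> = \<bar>b\<bar>"
proof -
  have Gcd_scaled: "Gcd (range (\<lambda>j. c * f j)) = \<bar>c\<bar>" if "primitive f" for c and f :: "nat \<Rightarrow> int"
    using Gcd_mult[of c "range f"] that by (simp add: primitive_def image_image)
  have "\<bar>a\<bar> = Gcd (range (\<lambda>j. a * p j))" by (rule Gcd_scaled[OF assms(1), symmetric])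
  also have "\<dots> = \<bar>b\<bar>" unfolding assms(3) by (rule Gcd_scaled[OF assms(2)])
  finally show ?thesis .
qed

definition min_ann :: "nat \<Rightarrow> nat \<Rightarrow> (nat \<Rightarrow> int) \<Rightarrow> nat \<Rightarrow> (nat \<Rightarrow> int) \<Rightarrow> bool" where
  "min_ann n m x d p \<longleftrightarrow> 1 \<le> d \<and> d \<le> m \<and> primitive p \<and> supp_below (Suc d) p \<and> p \<in> ann n (Suc d) x \<and>
     (\<forall>g\<in>ann n d x. \<not> nonzero_below d g)"

lemma min_annD:
  assumes "min_ann n m x d p"
  shows "1 \<le> d" "d \<le> m" "primitive p" "supp_below (Suc d) p" "nonzero_below (Suc d) p" "p \<in> ann n (Suc d) x"
    "g \<in> ann n d x \<Longrightarrow> \<not> nonzero_below d g"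
  using assms primitive_nonzero by (auto simp: min_ann_def)

lemma exists_min_ann:
  assumes p_ann: "nonzero_below N p" "p \<in> ann n N x" and N_le: "N \<le> m + 1" and x_0_nonzero: "x 0 \<noteq> 0"
  obtains d P where "Suc d \<le> N" "min_ann n m x d P"
proof -
  let ?A = "\<lambda>N. \<exists>p\<in>ann n N x. nonzero_below N p"
  obtain k where exists_ann_k: "?A k" and least: "\<And>j. j < k \<Longrightarrow> \<not> ?A j"
    using exists_least_iff[of ?A] p_ann by blast
  have "k \<le> N" using least[of N] p_ann by (meson not_le)
  obtain g where g_nonzero: "nonzero_below k g" "g \<in> common_ann n k {x}" using exists_ann_k by auto
  have "k \<noteq> 0" using g_nonzero(1) by (auto simp: nonzero_below_def)
  moreover have "k \<noteq> 1"
  proof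
    assume "k = 1"
    then have "dotp 1 (shift 0 x) g = 0" "g 0 \<noteq> 0" using g_nonzero by (auto simp: ann_iff nonzero_below_def)
    then show False using x_0_nonzero by (simp add: dotp_def)
  qed
  ultimately obtain d where k_eq: "k = Suc d" "1 \<le> d" by (cases k) auto
  obtain P where "primitive P" "supp_below k P" "P \<in> common_ann n k {x}"
    by (rule exists_primitive_common_ann[OF g_nonzero(2,1)])
  then have "min_ann n m x d P" using k_eq least[of d] \<open>k \<le> N\<close> N_le by (auto simp: min_ann_def)
  then show thesis using that k_eq(1) \<open>k \<le> N\<close> by blast
qed

lemma min_ann_degree_le:
  assumes "min_ann n m x d p" "min_ann n m x d' p'"
  shows "d' \<le> d"
proof (rule ccontr)
  assume "\<not> d' \<le> d"
  then have "p \<in> ann n d' x" using in_ann_mono[OF min_annD(6,4)[OF assms(1)], of d'] by simp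
  moreover obtain j where "j < Suc d" "p j \<noteq> 0"
    using min_annD(5)[OF assms(1)] by (auto simp: nonzero_below_def)
  then have "nonzero_below d' p" using \<open>\<not> d' \<le> d\<close> by (auto simp: nonzero_below_def intro!: exI[of _ j])
  ultimately show False using min_annD(7)[OF assms(2)] by blast
qed

locale best_points = exponent_numbers "real m" t \<mu>
  for m :: nat and t \<mu> :: real +
  fixes n :: nat and \<xi> lam :: real and q :: "nat \<Rightarrow> nat"
  assumes n_eq: "n = 2 * m + 1" and two_le_m: "2 \<le> m" and no_root: "no_int_root n \<xi>"
    and lam: "lam * (real m + 1 + \<mu>) = 1"
    and q_0: "q 0 = 1" and q_Suc: "q i < q (Suc i)"
    and err_Suc: "err n \<xi> (q (Suc i)) < err n \<xi> (q i)"
    and best: "1 \<le> r \<Longrightarrow> r < q (Suc i) \<Longrightarrow> err n \<xi> (q i) \<le> err n \<xi> r"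
    and eventually_small: "\<forall>\<^sub>F i in sequentially. (kappa n \<xi>)\<^sup>2 * err n \<xi> (q i) \<le> real (q (Suc i)) powr (- lam)"
begin

definition x :: "nat \<Rightarrow> nat \<Rightarrow> int" where
  "x i = nearest_point n \<xi> (q i)"

definition \<delta> :: "nat \<Rightarrow> real" where
  "\<delta> i = err n \<xi> (q i)"

definition small :: "nat \<Rightarrow> bool" where
  "small i \<longleftrightarrow> (kappa n \<xi>)\<^sup>2 * \<delta> i \<le> real (q (Suc i)) powr (- lam)"

lemma n_ge_1: "1 \<le> n"
  using n_eq by simp

lemma lam_pos: "0 < lam"
  using lam mu_pos zero_less_mult_pos2[of lam "real m + 1 + \<mu>"] by simp

lemma x_0: "x i 0 = int (q i)"
  by (simp add: x_def)

lemma supp_x: "supp_below (n + 1) (x i)"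
  unfolding x_def by (rule supp_nearest_point)

lemma near_x: "near_curve n \<xi> (x i) (\<delta> i)"
  unfolding x_def \<delta>_def by (rule near_curve_nearest_point[OF n_ge_1])

lemma strict_mono_q: "strict_mono q"
  by (simp add: strict_mono_Suc_iff q_Suc)

lemma q_less: "i < j \<Longrightarrow> q i < q j"
  using strict_mono_q by (rule strict_monoD)

lemma q_gt: "i < q i"
proof (induction i)
  case (Suc i)
  then show ?case using q_Suc[of i] by linarith
qed (simp add: q_0)

lemma x_0_pos: "1 \<le> x i 0"
  using q_gt[of i] by (simp add: x_0)

lemma \<delta>_less: "i < j \<Longrightarrow> \<delta> j < \<delta> i"
  using lift_Suc_mono_less[of "\<lambda>i. - \<delta> i" i j] err_Suc by (simp add: \<delta>_def)

lemma \<delta>_pos: "0 < \<delta> i"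
  unfolding \<delta>_def by (rule err_pos[OF n_ge_1 no_root]) (use q_gt[of i] in simp)

lemma \<delta>_le_half: "\<delta> i \<le> 1 / 2"
  unfolding \<delta>_def by (rule err_le_half[OF n_ge_1])

lemma filterlim_q: "filterlim (\<lambda>i. real (q i)) at_top sequentially"
  by (rule filterlim_compose[OF filterlim_real_sequentially filterlim_subseq[OF strict_mono_q]])

lemma \<delta>_tendsto_0: "\<delta> \<longlonglongrightarrow> 0"
proof (rule tendsto_sandwich[of "\<lambda>_. 0" _ _ "\<lambda>i. real (q (Suc i)) powr (- lam)"])
  have "1 * \<delta> i \<le> (kappa n \<xi>)\<^sup>2 * \<delta> i" for i
    using \<delta>_pos[of i] kappa_ge_1 by (intro mult_right_mono one_le_power) auto
  then show "\<forall>\<^sub>F i in sequentially. \<delta> i \<le> real (q (Suc i)) powr (- lam)"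
    using eventually_small by (auto simp: \<delta>_def elim!: eventually_mono intro: order_trans)
  have "filterlim (\<lambda>i. real (q (Suc i))) at_top sequentially"
    using filterlim_compose[OF filterlim_q filterlim_Suc] by simp
  then show "(\<lambda>i. real (q (Suc i)) powr (- lam)) \<longlonglongrightarrow> 0" using lam_pos by (intro tendsto_neg_powr) auto
qed (use \<delta>_pos in \<open>auto intro!: always_eventually less_imp_le\<close>)

lemma \<delta>_less_err: "1 \<le> r \<Longrightarrow> r < q i \<Longrightarrow> \<delta> i < err n \<xi> r"
  using q_0 best[of r "i - 1"] err_Suc[of "i - 1"] by (cases i) (auto simp: \<delta>_def)

lemma primitive_x: "primitive (x i)"
proof -
  define g where "g = Gcd (range (x i))"
  have dvd: "g dvd x i j" for j unfolding g_def by (rule Gcd_dvd) simp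
  define z where "z = (\<lambda>j. x i j div g)"
  have x_eq: "x i j = g * z j" for j using dvd by (simp add: z_def)
  have "0 < g * z 0" using x_0_pos[of i] x_eq[of 0] by simp
  moreover have "0 \<le> g" by (simp add: g_def)
  ultimately have pos: "1 \<le> g" "1 \<le> z 0" by (auto simp: zero_less_mult_iff)
  have "near_curve n \<xi> z (\<delta> i)"
    unfolding near_curve_def
  proof (intro allI impI)
    fix k assume k_le: "k \<le> n"
    have "1 * \<bar>real_of_int (z k) - real_of_int (z 0) * \<xi> ^ k\<bar> \<le> \<bar>real_of_int g\<bar> * \<bar>real_of_int (z k) - real_of_int (z 0) * \<xi> ^ k\<bar>"
      using pos(1) by (intro mult_right_mono) auto
    also have "\<dots> = \<bar>real_of_int (x i k) - real_of_int (x i 0) * \<xi> ^ k\<bar>"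
      unfolding abs_mult[symmetric] by (simp add: x_eq algebra_simps)
    also have "\<dots> \<le> \<delta> i" using near_x[of i] k_le by (simp add: near_curve_def)
    finally show "\<bar>real_of_int (z k) - real_of_int (z 0) * \<xi> ^ k\<bar> \<le> \<delta> i" by simp
  qed
  then have "err n \<xi> (nat (z 0)) \<le> \<delta> i" by (rule err_le_of_near_curve[OF n_ge_1]) (use pos(2) in simp)
  then have "\<not> nat (z 0) < q i" using \<delta>_less_err[of "nat (z 0)" i] pos(2) by force
  then have "int (q i) \<le> z 0" using pos(2) by (simp add: not_less le_nat_iff)
  then have "g * z 0 \<le> 1 * z 0" using x_eq[of 0] by (simp add: x_0)
  then have "g = 1" using pos by (simp add: mult_le_cancel_right)
  then show ?thesis by (simp add: g_def primitive_def)
qed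

lemma lin_indep_x:
  assumes "i \<noteq> j"
  shows "lin_indep (n + 1) [x i, x j]"
proof (rule ccontr)
  have "nonzero_below (n + 1) (x i)" by (rule primitive_nonzero[OF primitive_x supp_x])
  moreover assume "\<not> lin_indep (n + 1) [x i, x j]"
  ultimately obtain a b where a_nonzero: "a \<noteq> 0" and proportional: "\<And>k. k < n + 1 \<Longrightarrow> a * x j k = b * x i k"
    by (auto simp: lin_indep_pair_iff rat_span_singleton_iff)
  have proportional_k: "a * x j k = b * x i k" for k
    using proportional[of k] supp_x[of i] supp_x[of j] by (cases "k < n + 1") (auto simp: supp_below_def)
  have "\<bar>a\<bar> = \<bar>b\<bar>" by (rule primitive_proportional[OF primitive_x primitive_x proportional_k])
  then have "\<bar>a\<bar> * x j 0 = \<bar>a\<bar> * x i 0"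
    using arg_cong[OF proportional_k[of 0], of abs] x_0_pos[of i] x_0_pos[of j] by (simp add: abs_mult)
  then have "q i = q j" using a_nonzero by (simp add: x_0)
  then show False using assms strict_mono_eq[OF strict_mono_q] by blast
qed

lemma eventually_x_not_in_ann:
  "nonzero_below N p \<Longrightarrow> N \<le> n + 1 \<Longrightarrow> \<forall>\<^sub>F i in sequentially. p \<notin> ann n N (x i)"
  by (rule eventually_not_in_ann[OF no_root _ _ near_x x_0_pos \<delta>_tendsto_0])

lemma min_ann_height_product:
  assumes p_min_ann: "min_ann n m (x (Suc i)) d p" and not_ann: "p \<notin> ann n (Suc d) (x i)"
  shows "1 \<le> real (q (Suc i)) * ((kappa n \<xi>)\<^sup>2 * \<delta> i) ^ (n + 1 - d)"
proof -
  define e where "e = n + 2 - 2 * d"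
  let ?\<kappa> = "kappa n \<xi>" and ?W = "real (q (Suc i))"
  note d_bounds = min_annD(1,2)[OF p_min_ann]
  have e_bounds: "n + 1 - d = (d - 1) + e" "e + 1 \<le> 2 * (n + 1 - d)" using d_bounds n_eq by (auto simp: e_def)
  have kappa_bounds: "0 \<le> ?\<kappa>" "1 \<le> ?\<kappa>" using kappa_ge_1[of n \<xi>] by auto
  have "\<bar>real_of_int (x i 0)\<bar> \<le> \<bar>real_of_int (x (Suc i) 0)\<bar>" using q_Suc[of i] by (simp add: x_0)
  then have "1 \<le> ?\<kappa> * (hgt (Suc d) p * \<delta> i)"
    by (intro hgt_ge_of_not_in_ann[OF _ _ min_annD(6)[OF p_min_ann] not_ann near_x near_x less_imp_le[OF \<delta>_less]]) (use d_bounds n_eq in auto)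
  then have "1 \<le> (?\<kappa> * (hgt (Suc d) p * \<delta> i)) ^ e" by (rule one_le_power)
  also have "\<dots> = ?\<kappa> ^ e * (hgt (Suc d) p ^ e * \<delta> i ^ e)" by (simp add: power_mult_distrib)
  also have "\<dots> \<le> ?\<kappa> ^ e * ((?\<kappa> * (?W * \<delta> i ^ (d - 1))) * \<delta> i ^ e)"
  proof (intro mult_left_mono mult_right_mono)
    have "hgt (Suc d) p ^ e \<le> ?\<kappa> * (\<bar>real_of_int (x (Suc i) 0)\<bar> * \<delta> (Suc i) ^ (d - 1))"
      unfolding e_def using min_annD[OF p_min_ann] d_bounds n_eq \<delta>_le_half[of "Suc i"] x_0_pos[of "Suc i"]
      by (intro low_degree_ann_height gap_pos[OF no_root] near_x \<delta>_pos) auto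
    also have "\<dots> \<le> ?\<kappa> * (?W * \<delta> i ^ (d - 1))"
      using \<delta>_less[of i "Suc i"] \<delta>_pos[of "Suc i"] kappa_bounds
      by (intro mult_left_mono mult_mono power_mono) (auto simp: x_0)
    finally show "hgt (Suc d) p ^ e \<le> ?\<kappa> * (?W * \<delta> i ^ (d - 1))" .
  qed (use kappa_bounds \<delta>_pos[of i] in auto)
  also have "\<dots> = ?\<kappa> ^ (e + 1) * (?W * \<delta> i ^ (n + 1 - d))"
    by (simp only: e_bounds(1) power_add power_one_right mult_ac)
  also have "\<dots> \<le> ?\<kappa> ^ (2 * (n + 1 - d)) * (?W * \<delta> i ^ (n + 1 - d))"
    using \<delta>_pos[of i] kappa_bounds e_bounds(2) by (intro mult_right_mono power_increasing) auto
  also have "\<dots> = ?W * (?\<kappa>\<^sup>2 * \<delta> i) ^ (n + 1 - d)" by (simp add: power_mult_distrib power_mult mult_ac)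
  finally show ?thesis .
qed

lemma min_ann_inherited:
  assumes small: "small i" and p_min_ann: "min_ann n m (x (Suc i)) d p"
  shows "p \<in> ann n (Suc d) (x i)"
proof (rule ccontr)
  let ?W = "real (q (Suc i))"
  assume not_ann: "p \<notin> ann n (Suc d) (x i)"
  have W_gt_1: "1 < ?W" using q_gt[of "Suc i"] by simp
  have "1 \<le> ?W * ((kappa n \<xi>)\<^sup>2 * \<delta> i) ^ (n + 1 - d)" by (rule min_ann_height_product[OF p_min_ann not_ann])
  also have "\<dots> \<le> ?W * (?W powr (- lam)) ^ (n + 1 - d)"
    using small \<delta>_pos[of i] by (intro mult_left_mono power_mono) (auto simp: small_def)
  also have "\<dots> = ?W powr (1 + real (n + 1 - d) * - lam)" using W_gt_1 by (simp add: powr_power powr_mult_base)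
  also have "\<dots> < ?W powr 0"
  proof (rule powr_less_mono[OF _ W_gt_1])
    have "lam * (real m + 1 + \<mu>) < lam * (real m + 2)"
      using lam_pos mu_lt_1 by (intro mult_strict_left_mono) auto
    also have "\<dots> \<le> lam * real (n + 1 - d)"
      using lam_pos min_annD(2)[OF p_min_ann] n_eq by (intro mult_left_mono) auto
    finally have "1 < real (n + 1 - d) * lam" by (simp only: lam mult.commute)
    then show "1 + real (n + 1 - d) * - lam < 0" by (simp only: mult_minus_right)
  qed
  finally show False using W_gt_1 by simp
qed

lemma min_ann_predecessor:
  assumes "small i" "min_ann n m (x (Suc i)) d p"
  obtains d' p' where "d' \<le> d" "min_ann n m (x i) d' p'"
proof -
  have "Suc d \<le> m + 1" "x i 0 \<noteq> 0" using min_annD(2)[OF assms(2)] x_0_pos[of i] by simp_all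
  then obtain d' p' where "Suc d' \<le> Suc d" "min_ann n m (x i) d' p'"
    by (rule exists_min_ann[OF min_annD(5)[OF assms(2)] min_ann_inherited[OF assms]])
  then show thesis using that by simp
qed

lemma min_ann_persists:
  assumes small: "small i" and p_min_ann: "min_ann n m (x i) d p"
    and p'_min_ann: "min_ann n m (x (Suc i)) d p'"
  shows "min_ann n m (x (Suc i)) d p"
proof -
  have "p \<in> rat_span (Suc d) {p'}"
    by (rule low_degree_ann_unique[of d n "x i"])
      (use min_annD[OF p_min_ann] min_annD[OF p'_min_ann] min_ann_inherited[OF small p'_min_ann] n_eq in auto)
  then have "p \<in> ann n (Suc d) (x (Suc i))"
    using rat_span_subset_ann[of "{p'}" n "Suc d"] min_annD(6)[OF p'_min_ann] by blast
  then show ?thesis using p_min_ann p'_min_ann by (simp add: min_ann_def)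
qed

lemma exists_no_min_ann:
  assumes small: "\<And>i. I \<le> i \<Longrightarrow> small i"
  shows "\<exists>i\<ge>I. \<forall>d p. \<not> min_ann n m (x i) d p"
proof (rule ccontr)
  assume "\<not> ?thesis"
  then have "\<forall>i. \<exists>d p. I \<le> i \<longrightarrow> min_ann n m (x i) d p" by blast
  then obtain D P where "\<forall>i. I \<le> i \<longrightarrow> min_ann n m (x i) (D i) (P i)" by metis
  then have min_ann_P: "min_ann n m (x i) (D i) (P i)" if "I \<le> i" for i using that by blast
  have D_Suc: "D i \<le> D (Suc i)" if i_ge: "I \<le> i" for i
  proof -
    obtain d p where "d \<le> D (Suc i)" "min_ann n m (x i) d p"
      using min_ann_predecessor[OF small[OF i_ge] min_ann_P[of "Suc i"]] i_ge by auto
    then show ?thesis using min_ann_degree_le min_ann_P[OF i_ge] order_trans by blast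
  qed
  have "\<forall>i. I \<le> i \<longrightarrow> D i \<le> m" using min_annD(2)[OF min_ann_P] by blast
  then obtain i0 where i0_ge: "I \<le> i0" and max: "\<And>i. I \<le> i \<Longrightarrow> D i \<le> D i0"
    using ex_has_greatest_nat[of "\<lambda>i. I \<le> i" I D "Suc m"] by (auto simp: less_Suc_eq_le)
  have D_eq: "D i = D i0" if "i0 \<le> i" for i
    using that
  proof (induction i rule: dec_induct)
    case (step i)
    then show ?case using D_Suc[of i] max[of "Suc i"] i0_ge by simp
  qed simp
  have persists: "min_ann n m (x i) (D i0) (P i0)" if "i0 \<le> i" for i
    using that
  proof (induction i rule: dec_induct)
    case (step i)
    show ?case
      by (rule min_ann_persists[OF small step.IH]) (use min_ann_P[of "Suc i"] D_eq[of "Suc i"] step.hyps i0_ge in auto)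
  qed (rule min_ann_P[OF i0_ge])
  have "\<forall>\<^sub>F i in sequentially. P i0 \<notin> ann n (Suc (D i0)) (x i)"
    by (rule eventually_x_not_in_ann) (use min_annD(2,5)[OF min_ann_P[OF i0_ge]] n_eq in auto)
  then have "\<forall>\<^sub>F i in sequentially. i0 \<le> i \<and> P i0 \<notin> ann n (Suc (D i0)) (x i)"
    by (intro eventually_conj eventually_ge_at_top)
  from eventually_happens'[OF _ this] show False using min_annD(6)[OF persists] by auto
qed

lemma eventually_full_rank: "\<forall>\<^sub>F i in sequentially. full_rank n m (x i)"
proof -
  obtain I where small: "\<And>i. I \<le> i \<Longrightarrow> small i"
    using eventually_small unfolding eventually_sequentially small_def \<delta>_def by blast
  obtain i0 where i0_ge: "I \<le> i0" and no_min_ann_i0: "\<And>d p. \<not> min_ann n m (x i0) d p"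
    using exists_no_min_ann[OF small] by blast
  have no_min_ann: "\<not> min_ann n m (x i) d p" if "i0 \<le> i" for i d p
    using that
  proof (induction i arbitrary: d p rule: dec_induct)
    case (step i)
    show ?case
    proof
      assume "min_ann n m (x (Suc i)) d p"
      then obtain d' p' where "min_ann n m (x i) d' p'"
        by (rule min_ann_predecessor[OF small, rotated]) (use step.hyps i0_ge in auto)
      then show False using step.IH by blast
    qed
  qed (rule no_min_ann_i0)
  have "full_rank n m (x i)" if "i0 \<le> i" for i
    unfolding full_rank_def
  proof (intro ballI notI)
    fix p assume p_ann: "p \<in> ann n (m + 1) (x i)" "nonzero_below (m + 1) p"
    have "x i 0 \<noteq> 0" using x_0_pos[of i] by simp
    then show False using exists_min_ann[OF p_ann(2,1) order_refl] no_min_ann[OF that] by metis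
  qed
  then show ?thesis unfolding eventually_sequentially by blast
qed

definition plane :: "nat \<Rightarrow> (nat \<Rightarrow> int) set" where
  "plane i = rat_span (n + 1) {x i, x (Suc i)}"

lemma x_in_plane: "x i \<in> plane i" "x (Suc i) \<in> plane i"
  unfolding plane_def by (rule rat_span_base, simp)+

lemma rat_span_eq_plane:
  assumes "i \<noteq> j" "x i \<in> plane k" "x j \<in> plane k"
  shows "rat_span (n + 1) {x i, x j} = plane k"
  using rat_span_eq_of_length[OF lin_indep_x[OF assms(1)], of "[x k, x (Suc k)]"] assms(2,3)
  by (simp add: plane_def)

lemma plane_eq:
  assumes "i \<le> i'" "\<And>j. i \<le> j \<Longrightarrow> j < i' \<Longrightarrow> x (Suc (Suc j)) \<in> plane j"
  shows "plane i' = plane i"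
  using assms
proof (induction i' rule: dec_induct)
  case (step j)
  have "plane (Suc j) = plane j"
    unfolding plane_def[of "Suc j"]
    by (rule rat_span_eq_plane) (use step.prems[of j] step.hyps x_in_plane in auto)
  then show ?case using step by simp
qed simp

definition turning :: "nat set" where
  "turning = {i. x (Suc (Suc i)) \<notin> plane i \<and> (\<forall>j\<ge>i. full_rank n m (x j) \<and> small j)}"

lemma infinite_turning: "infinite turning"
proof
  assume "finite turning"
  have "\<forall>\<^sub>F i in sequentially. full_rank n m (x i) \<and> small i"
    using eventually_full_rank eventually_small unfolding small_def \<delta>_def by (rule eventually_conj)
  then obtain I0 where from_I0: "\<forall>i\<ge>I0. full_rank n m (x i) \<and> small i" by (auto simp: eventually_sequentially)
  obtain B where turning_bounded: "turning \<subseteq> {..<B}" using \<open>finite turning\<close> finite_nat_iff_bounded by auto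
  define I where "I = max I0 B"
  have "x (Suc (Suc j)) \<in> plane j" if "I \<le> j" for j
  proof -
    have "j \<notin> turning" using that turning_bounded by (auto simp: I_def)
    moreover have "\<forall>j'\<ge>j. full_rank n m (x j') \<and> small j'" using that from_I0 by (simp add: I_def)
    ultimately show ?thesis by (simp add: turning_def)
  qed
  then have plane: "x i \<in> plane I" if "I \<le> i" for i using plane_eq[OF that] x_in_plane(1)[of i] by simp
  obtain p where p_nonzero: "nonzero_below (n + 1) p" "p \<in> orth (n + 1) {x I, x (Suc I)}"
    using exists_orth[of "[x I, x (Suc I)]" "n + 1"] n_eq two_le_m by auto
  have "p \<in> ann n (n + 1) (x i)" if "I \<le> i" for i
    by (rule in_ann_of_rat_span[OF plane[OF that, unfolded plane_def]]) (use p_nonzero(2) in \<open>auto simp: ann_iff orth_def\<close>)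
  moreover have "\<forall>\<^sub>F i in sequentially. I \<le> i \<and> p \<notin> ann n (n + 1) (x i)"
    by (intro eventually_conj eventually_ge_at_top eventually_x_not_in_ann p_nonzero(1)) simp
  from eventually_happens'[OF _ this] obtain i where "I \<le> i" "p \<notin> ann n (n + 1) (x i)" by auto
  ultimately show False by blast
qed

definition turn :: "nat \<Rightarrow> nat" where
  "turn = enumerate turning"

lemma turn_in: "turn k \<in> turning"
  unfolding turn_def by (rule enumerate_in_set[OF infinite_turning])

lemma strict_mono_turn: "strict_mono turn"
  unfolding turn_def by (rule strict_mono_enumerate[OF infinite_turning])

lemma turn_less: "turn k < turn (Suc k)"
  using strict_mono_turn by (simp add: strict_mono_Suc_iff)

lemma full_rank_and_small: "turn k \<le> j \<Longrightarrow> full_rank n m (x j) \<and> small j"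
  using turn_in[of k] by (simp add: turning_def)

lemma plane_turn_Suc: "plane (turn (Suc k)) = plane (Suc (turn k))"
proof (rule plane_eq)
  show "Suc (turn k) \<le> turn (Suc k)" using turn_less[of k] by simp
  fix j assume j_ge: "Suc (turn k) \<le> j" "j < turn (Suc k)"
  show "x (Suc (Suc j)) \<in> plane j"
  proof (rule ccontr)
    assume "x (Suc (Suc j)) \<notin> plane j"
    then have "j \<in> turning" using full_rank_and_small[of k] j_ge(1) by (simp add: turning_def)
    then have "turn (Suc k) \<le> j"
      using j_ge(1) unfolding turn_def enumerate_Suc''[OF infinite_turning] by (intro Least_le) simp
    then show False using j_ge(2) by simp
  qed
qed

lemma turning_points_indep: "lin_indep (n + 1) [x (Suc (turn k)), x (Suc (turn (Suc k))), x (Suc (turn (Suc (Suc k))))]"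
proof -
  define f where "f = turn (Suc k)"
  let ?y = "x (Suc (turn k))" and ?y' = "x (Suc f)" and ?y'' = "x (Suc (turn (Suc (Suc k))))"
  have neq: "Suc (turn k) \<noteq> Suc f" "Suc f \<noteq> Suc (turn (Suc (Suc k)))"
    using turn_less[of k] turn_less[of "Suc k"] by (auto simp: f_def)
  have "?y \<in> plane f" unfolding f_def plane_turn_Suc by (rule x_in_plane)
  then have span: "rat_span (n + 1) {?y, ?y'} = plane f"
    by (rule rat_span_eq_plane[OF neq(1)]) (rule x_in_plane)
  have "?y'' \<notin> plane f"
  proof
    assume "?y'' \<in> plane f"
    then have "rat_span (n + 1) {?y', ?y''} = plane f" by (intro rat_span_eq_plane[OF neq(2)] x_in_plane)
    moreover have "?y'' \<in> plane (Suc f)" unfolding f_def plane_turn_Suc[symmetric] by (rule x_in_plane)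
    then have "rat_span (n + 1) {?y', ?y''} = plane (Suc f)"
      by (intro rat_span_eq_plane[OF neq(2)] x_in_plane)
    ultimately have "x (Suc (Suc f)) \<in> plane f" using x_in_plane(2)[of "Suc f"] by simp
    then show False using turn_in[of "Suc k"] by (simp add: turning_def f_def)
  qed
  then have "lin_indep (n + 1) ([?y, ?y'] @ [?y''])"
    unfolding lin_indep_snoc_iff[OF lin_indep_x[OF neq(1)]] using span by simp
  then show ?thesis by (simp add: f_def)
qed

lemma exponent_sequence_turning_points:
  "exponent_sequence n m \<xi> (\<lambda>k. x (Suc (turn k))) (\<lambda>k. x (Suc (Suc (turn k))))
    (\<lambda>k. real (q (Suc (Suc (turn (k - 1)))))) (\<lambda>k. \<delta> (Suc (turn k))) t \<mu> lam"
proof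
  fix k
  show "full_rank n m (x (Suc (turn k)))" using full_rank_and_small[of k] by simp
  show "x (Suc (turn k)) 0 \<le> x (Suc (turn (Suc k))) 0"
    using q_less[of "Suc (turn k)" "Suc (turn (Suc k))"] turn_less[of k] by (simp add: x_0)
  show "real_of_int (x (Suc (turn k)) 0) \<le> real (q (Suc (Suc (turn (Suc k - 1)))))"
    using q_Suc[of "Suc (turn k)"] by (simp add: x_0)
  show "\<bar>real_of_int (x (Suc (Suc (turn k))) 0)\<bar> \<le> real (q (Suc (Suc (turn (Suc k - 1)))))" by (simp add: x_0)
  show "near_curve n \<xi> (x (Suc (Suc (turn k)))) (\<delta> (Suc (turn k)))"
    by (rule near_curve_mono[OF near_x less_imp_le[OF \<delta>_less]]) simp
  show "x (Suc (turn (Suc k))) \<in> rat_span (n + 1) {x (Suc (turn k)), x (Suc (Suc (turn k)))}"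
    using x_in_plane(2)[of "turn (Suc k)"] unfolding plane_turn_Suc by (simp add: plane_def)
  show "1 < real (q (Suc (Suc (turn (k - 1)))))" using q_gt[of "Suc (Suc (turn (k - 1)))"] by simp
  have "turn (k - 1) \<le> turn k" using strict_mono_less_eq[OF strict_mono_turn] by simp
  then show "real (q (Suc (Suc (turn (k - 1))))) \<le> real (q (Suc (Suc (turn (Suc k - 1)))))"
    using strict_mono_less_eq[OF strict_mono_q] by simp
  show "\<delta> (Suc (turn k)) \<le> 1" using \<delta>_le_half[of "Suc (turn k)"] by simp
  show "\<delta> (Suc (turn (Suc k))) \<le> \<delta> (Suc (turn k))"
    using \<delta>_less[of "Suc (turn k)" "Suc (turn (Suc k))"] turn_less[of k] by simp
  show "(kappa n \<xi>)\<^sup>2 * \<delta> (Suc (turn k)) \<le> real (q (Suc (Suc (turn (Suc k - 1))))) powr (- lam)"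
    using full_rank_and_small[of k "Suc (turn k)"] by (simp add: small_def)
  have "strict_mono (\<lambda>k. Suc (turn k))" using strict_mono_turn by (simp add: strict_mono_Suc_iff)
  then show "(\<lambda>k. \<delta> (Suc (turn k))) \<longlonglongrightarrow> 0" using LIMSEQ_subseq_LIMSEQ[OF \<delta>_tendsto_0] by (simp add: o_def)
qed (rule n_eq two_le_m no_root primitive_x supp_x x_0_pos near_x turning_points_indep \<delta>_pos lam)+

lemma no_best_points: False
  by (rule exponent_sequence.no_exponent_sequence[OF exponent_sequence_turning_points])

end

section \<open>The degree hypothesis\<close>

lemma real_ring_simps:
  "carrier real_ring = UNIV" "a \<otimes>\<^bsub>real_ring\<^esub> b = a * b" "a \<oplus>\<^bsub>real_ring\<^esub> b = a + b" "\<one>\<^bsub>real_ring\<^esub> = 1"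
    "\<zero>\<^bsub>real_ring\<^esub> = 0"
  by (simp_all add: ring_of_type_algebra_def)

lemma real_ring_pow: "a [^]\<^bsub>real_ring\<^esub> (k :: nat) = a ^ k"
proof -
  interpret field real_ring by (rule field_from_type_algebra)
  show ?thesis by (induction k) (simp_all add: real_ring_simps)
qed

lemma subfield_Rats: "subfield \<rat> real_ring"
proof -
  interpret field real_ring by (rule field_from_type_algebra)
  show ?thesis
  proof (rule subfieldI')
    show "subring \<rat> real_ring"
    proof (rule subringI)
      fix h :: real assume h_in: "h \<in> \<rat>"
      have "\<ominus>\<^bsub>real_ring\<^esub> h = - h" by (rule minus_equality) (simp_all add: real_ring_simps)
      then show "\<ominus>\<^bsub>real_ring\<^esub> h \<in> \<rat>" using h_in by simp
    qed (simp_all add: real_ring_simps)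
    fix k :: real assume k_in: "k \<in> \<rat> - {\<zero>\<^bsub>real_ring\<^esub>}"
    then have "inv\<^bsub>real_ring\<^esub> k = inverse k" by (intro inv_char) (simp_all add: real_ring_simps)
    then show "inv\<^bsub>real_ring\<^esub> k \<in> \<rat>" using k_in by simp
  qed
qed

lemma eval_rev_list: "ring.eval real_ring (map f (rev [0..<k])) a = (\<Sum>j<k. f j * a ^ j)"
proof -
  interpret field real_ring by (rule field_from_type_algebra)
  show ?thesis
  proof (induction k)
    case (Suc k)
    have "map f (rev [0..<Suc k]) = f k # map f (rev [0..<k])" by simp
    then show ?case using Suc by (simp add: real_ring_simps real_ring_pow)
  qed (simp add: real_ring_simps)
qed

lemma rat_adjoin_eq_simple_extension:
  assumes "ring.algebraic real_ring \<rat> \<xi>"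
  shows "rat_adjoin \<xi> = ring.simple_extension real_ring \<rat> \<xi>"
proof -
  interpret field real_ring by (rule field_from_type_algebra)
  have \<xi>_carrier: "\<xi> \<in> carrier real_ring" and Rats: "\<rat> \<subseteq> carrier real_ring" "insert \<xi> \<rat> \<subseteq> carrier real_ring"
    by (auto simp: real_ring_simps)
  have "subfield (simple_extension \<rat> \<xi>) real_ring"
    using simple_extension_is_subfield[OF subfield_Rats \<xi>_carrier] assms by (simp add: over_def)
  moreover have "insert \<xi> \<rat> \<subseteq> simple_extension \<rat> \<xi>"
    using simple_extension_mem[OF subfieldE(1)[OF subfield_Rats] \<xi>_carrier] simple_extension_incl[OF Rats(1) \<xi>_carrier] by simp
  ultimately have "rat_adjoin \<xi> \<subseteq> simple_extension \<rat> \<xi>"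
    unfolding rat_adjoin_def by (rule generate_field_min_subfield1[OF Rats(2)])
  moreover have "insert \<xi> \<rat> \<subseteq> generate_field real_ring (insert \<xi> \<rat>)" by (auto intro: generate_field.incl)
  then have "simple_extension \<rat> \<xi> \<subseteq> rat_adjoin \<xi>"
    unfolding rat_adjoin_def
    by (intro simple_extension_subring_incl[OF subfieldE(1)[OF generate_field_is_subfield[OF Rats(2)]]]) auto
  ultimately show ?thesis by (rule antisym)
qed

lemma rat_adjoin_degree_le:
  assumes p: "p \<noteq> []" "polynomial\<^bsub>real_ring\<^esub> \<rat> p" and root: "ring.eval real_ring p \<xi> = 0"
  shows "rat_adjoin_degree \<xi> \<le> enat (length p - 1)"
proof -
  interpret field real_ring by (rule field_from_type_algebra)
  have p_carrier: "p \<in> carrier (univ_poly real_ring \<rat>)" using p(2) univ_poly_carrier by blast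
  have eval: "eval p \<xi> = \<zero>\<^bsub>real_ring\<^esub>" using root by (simp add: real_ring_simps)
  have \<xi>_carrier: "\<xi> \<in> carrier real_ring" by (simp add: real_ring_simps)
  have alg: "(algebraic over \<rat>) \<xi>" by (rule algebraicI[OF p_carrier p(1) eval])
  then have dim: "dimension (length (Irr \<rat> \<xi>) - 1) \<rat> (rat_adjoin \<xi>)"
    using dimension_simple_extension[OF subfield_Rats \<xi>_carrier] rat_adjoin_eq_simple_extension
    by (simp add: over_def)
  have "rat_adjoin_degree \<xi> = enat (length (Irr \<rat> \<xi>) - 1)"
    using finite_dimensionI[OF dim] dimI[OF subfield_Rats dim] by (simp add: rat_adjoin_degree_def over_def)
  moreover have "length (Irr \<rat> \<xi>) - 1 \<le> length p - 1"
    by (rule pdivides_imp_degree_le[OF subfieldE(1)[OF subfield_Rats] IrrE(1)[OF subfield_Rats \<xi>_carrier alg] p_carrier p(1)])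
      (rule Irr_minimal[OF subfield_Rats \<xi>_carrier alg p_carrier eval])
  ultimately show ?thesis by simp
qed

lemma no_int_root_of_degree:
  assumes "enat n < rat_adjoin_degree \<xi>"
  shows "no_int_root n \<xi>"
  unfolding no_int_root_def
proof (intro allI impI notI)
  fix p assume p_nonzero: "nonzero_below (n + 1) p" and root: "poly_value (n + 1) p \<xi> = 0"
  obtain k where "k < n + 1 \<and> p k \<noteq> 0" using p_nonzero by (auto simp: nonzero_below_def)
  then have "\<exists>e. (e < n + 1 \<and> p e \<noteq> 0) \<and> (\<forall>j. j < n + 1 \<and> p j \<noteq> 0 \<longrightarrow> j \<le> e)"
    by (rule ex_has_greatest_nat[where f = "\<lambda>e. e" and b = "n + 1"]) simp
  then obtain e where e_coeff: "e < n + 1" "p e \<noteq> 0" and above: "\<And>j. j < n + 1 \<Longrightarrow> e < j \<Longrightarrow> p j = 0"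
    by (meson not_le)
  define cs where "cs = map (\<lambda>j. real_of_int (p j)) (rev [0..<Suc e])"
  have cs: "cs \<noteq> []" "polynomial\<^bsub>real_ring\<^esub> \<rat> cs"
    unfolding polynomial_def using e_coeff(2) by (auto simp: cs_def real_ring_simps)
  have "ring.eval real_ring cs \<xi> = (\<Sum>j<Suc e. real_of_int (p j) * \<xi> ^ j)"
    unfolding cs_def by (rule eval_rev_list)
  also have "\<dots> = poly_value (n + 1) p \<xi>"
    unfolding poly_value_def using e_coeff(1) by (intro sum.mono_neutral_left) (auto intro!: above)
  finally have "rat_adjoin_degree \<xi> \<le> enat (length cs - 1)" using root by (intro rat_adjoin_degree_le cs) simp
  also have "\<dots> \<le> enat n" using e_coeff(1) by (simp add: cs_def)
  finally show False using assms by simp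
qed

section \<open>The theorem\<close>

lemma uniform_exponent_err:
  assumes l_pos: "0 < l" and one_le_n: "1 \<le> n" and ok: "uniform_exponent_ok n \<xi> l"
  shows "\<forall>\<^sub>F B in at_top. \<exists>r\<ge>1. real r \<le> B \<and> err n \<xi> r \<le> B powr (- l)"
  using ok[unfolded uniform_exponent_ok_def] eventually_gt_at_top[of 1]
proof eventually_elim
  case (elim B)
  then obtain z :: "nat \<Rightarrow> int" where z: "\<exists>k\<le>n. z k \<noteq> 0" "\<bar>real_of_int (z 0)\<bar> \<le> B"
    and Max_le: "(MAX k\<in>{1..n}. \<bar>real_of_int (z 0) * \<xi> ^ k - real_of_int (z k)\<bar>) \<le> B powr (- l)" by blast
  have coord_le: "\<bar>real_of_int (z 0) * \<xi> ^ k - real_of_int (z k)\<bar> \<le> B powr (- l)" if "k \<in> {1..n}" for k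
    by (rule order_trans[OF Max_ge Max_le]) (use that in auto)
  have near: "near_curve n \<xi> z (B powr (- l))"
    unfolding near_curve_def
  proof (intro allI impI)
    fix i assume "i \<le> n"
    then show "\<bar>real_of_int (z i) - real_of_int (z 0) * \<xi> ^ i\<bar> \<le> B powr (- l)"
      using coord_le[of i] by (cases "i = 0") (auto simp: abs_minus_commute)
  qed
  have "z 0 \<noteq> 0"
  proof
    assume zero: "z 0 = 0"
    obtain k where k_le: "k \<le> n" "z k \<noteq> 0" using z(1) by blast
    have "\<bar>real_of_int (z k)\<bar> \<le> B powr (- l)" using near k_le(1) zero by (auto simp: near_curve_def)
    also have "\<dots> < 1" using elim(2) l_pos by (simp add: powr_less_one)
    finally show False using k_le(2) by linarith
  qed
  moreover have "err n \<xi> (nat \<bar>z 0\<bar>) \<le> B powr (- l)" by (rule err_le_of_near_curve[OF one_le_n near]) simp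
  ultimately show ?case using z(2) by (intro exI[of _ "nat \<bar>z 0\<bar>"]) simp
qed

definition next_best :: "nat \<Rightarrow> real \<Rightarrow> nat \<Rightarrow> nat" where
  "next_best n \<xi> r = (LEAST r'. 1 \<le> r' \<and> err n \<xi> r' < err n \<xi> r)"

lemma next_best_minimal:
  assumes "1 \<le> r'" "r' < next_best n \<xi> r"
  shows "err n \<xi> r \<le> err n \<xi> r'"
  using not_less_Least[of r' "\<lambda>r'. 1 \<le> r' \<and> err n \<xi> r' < err n \<xi> r"] assms by (auto simp: next_best_def)

lemma exists_best_sequence:
  assumes one_le_n: "1 \<le> n" and no_root: "no_int_root n \<xi>" and small: "\<forall>e>0. \<exists>r\<ge>1. err n \<xi> r < e"
  obtains q where "q 0 = (1 :: nat)" "\<And>i. q i < q (Suc i)" "\<And>i. err n \<xi> (q (Suc i)) < err n \<xi> (q i)"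
    "\<And>i r. 1 \<le> r \<Longrightarrow> r < q (Suc i) \<Longrightarrow> err n \<xi> (q i) \<le> err n \<xi> r"
proof -
  define q where "q = rec_nat 1 (\<lambda>_. next_best n \<xi>)"
  have q_0: "q 0 = 1" and q_Suc: "q (Suc i) = next_best n \<xi> (q i)" for i by (simp_all add: q_def)
  have next_best: "1 \<le> next_best n \<xi> r \<and> err n \<xi> (next_best n \<xi> r) < err n \<xi> r" if "1 \<le> r" for r
    unfolding next_best_def by (rule LeastI_ex) (use small err_pos[OF one_le_n no_root that] in blast)
  have q_ge_1: "1 \<le> q i" for i by (induction i) (use next_best in \<open>auto simp: q_0 q_Suc\<close>)
  have err_Suc: "err n \<xi> (q (Suc i)) < err n \<xi> (q i)" for i
    using next_best[OF q_ge_1[of i]] by (simp add: q_Suc)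
  have best: "err n \<xi> (q i) \<le> err n \<xi> r" if "1 \<le> r" "r < q (Suc i)" for i r
    using next_best_minimal[OF that[unfolded q_Suc]] .
  have best_le: "err n \<xi> (q i) \<le> err n \<xi> r" if r_ge: "1 \<le> r" "r \<le> q i" for i r
  proof (cases "r = q i")
    case False
    then obtain j where "i = Suc j" using r_ge q_0 by (cases i) auto
    then show ?thesis using best[of r j] err_Suc[of j] r_ge False by simp
  qed simp
  have "q i < q (Suc i)" for i using best_le[OF q_ge_1, of "Suc i" i] err_Suc[of i] by (meson not_less)
  then show thesis using that q_0 err_Suc best by blast
qed

lemma alpha_root: "0 < alpha m" "(real m + 1) * alpha m + real m * (alpha m)\<^sup>2 = 1"
proof -
  have "0 < alpha m \<and> poly (P_poly m) (alpha m) = 0"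
    unfolding alpha_def by (rule theI'[OF P_poly_ex1_positive_root])
  then show "0 < alpha m" "(real m + 1) * alpha m + real m * (alpha m)\<^sup>2 = 1"
    by (auto simp: P_poly_def power2_eq_square algebra_simps)
qed

lemma exists_exponent_between:
  assumes one_le_m: "1 \<le> m" and l_gt: "alpha m < l"
  obtains lam where "alpha m < lam" "lam < l" "(real m + 1) * lam < 1"
proof -
  have "0 < real m * (alpha m)\<^sup>2" using one_le_m alpha_root(1)[of m] by simp
  then have "(real m + 1) * alpha m < 1" using alpha_root(2)[of m] by linarith
  then have "alpha m < min l (1 / (real m + 1))" using l_gt by (simp add: field_simps)
  then obtain lam where "alpha m < lam" "lam < min l (1 / (real m + 1))" using dense by blast
  then show thesis using that[of lam] by (simp add: field_simps)
qed

lemma exponent_numbers_of_gt_alpha: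
  assumes two_le_m: "2 \<le> m" and lam: "alpha m < lam" "(real m + 1) * lam < 1"
  obtains t \<mu> where "exponent_numbers (real m) t \<mu>" "lam * (real m + 1 + \<mu>) = 1"
proof -
  have lam_pos: "0 < lam" using alpha_root(1)[of m] lam(1) by simp
  define \<mu> where "\<mu> = 1 / lam - (real m + 1)"
  define t where "t = 1 + \<mu> / real m"
  have scale: "lam * (real m + 1 + \<mu>) = 1" using lam_pos by (simp add: \<mu>_def field_simps)
  have mu_pos: "0 < \<mu>" using lam(2) lam_pos by (simp add: \<mu>_def field_simps)
  have "exponent_numbers (real m) t \<mu>"
  proof
    show "2 \<le> real m" "1 < t" "\<mu> = real m * (t - 1)" using two_le_m mu_pos by (simp_all add: t_def)
    have "(real m + 1) * alpha m < (real m + 1) * lam" using lam(1) by (intro mult_strict_left_mono) auto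
    moreover have "real m * (alpha m)\<^sup>2 < real m * lam\<^sup>2"
      using lam(1) alpha_root(1)[of m] two_le_m by (intro mult_strict_left_mono power_strict_mono) auto
    ultimately have "1 < (real m + 1) * lam + real m * lam\<^sup>2" using alpha_root(2)[of m] by linarith
    then have less: "(1 - real m * lam) * (1 - lam) < real m * lam\<^sup>2 * 2"
      by (simp add: power2_eq_square algebra_simps)
    have "real m * lam\<^sup>2 * ((1 + \<mu>) * t) = (lam * (1 + \<mu>)) * (lam * (real m + \<mu>))"
      using two_le_m by (simp add: t_def power2_eq_square field_simps)
    also have "lam * (1 + \<mu>) = 1 - real m * lam" using scale by (simp add: algebra_simps)
    also have "lam * (real m + \<mu>) = 1 - lam" using scale by (simp add: algebra_simps)
    also note less
    finally show "(1 + \<mu>) * t < 2" using two_le_m lam_pos by simp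
  qed
  then show thesis using that scale by blast
qed

lemma eventually_powr_half_small:
  fixes lam l :: real
  assumes "lam < l"
  shows "\<forall>\<^sub>F B in at_top. C * (B / 2) powr (- l) \<le> B powr (- lam)"
proof -
  have "((\<lambda>B. (C * 2 powr l) * B powr (lam - l)) \<longlongrightarrow> (C * 2 powr l) * 0) at_top"
    using assms by (intro tendsto_mult tendsto_const tendsto_neg_powr filterlim_ident) auto
  then have "\<forall>\<^sub>F B in at_top. (C * 2 powr l) * B powr (lam - l) < 1" by (rule order_tendstoD) simp
  then show ?thesis using eventually_gt_at_top[of 0]
  proof eventually_elim
    case (elim B)
    have "C * (B / 2) powr (- l) = ((C * 2 powr l) * B powr (lam - l)) * B powr (- lam)"
      using elim(2) by (simp add: powr_divide powr_minus powr_diff field_simps)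
    also have "\<dots> \<le> 1 * B powr (- lam)" using elim by (intro mult_right_mono) auto
    finally show ?case by simp
  qed
qed

lemma eventually_best_small:
  assumes q_mono: "strict_mono q" and best: "\<And>i r. 1 \<le> r \<Longrightarrow> r < q (Suc i) \<Longrightarrow> err n \<xi> (q i) \<le> err n \<xi> r"
    and uniform: "\<forall>\<^sub>F B in at_top. \<exists>r\<ge>1. real r \<le> B \<and> err n \<xi> r \<le> B powr (- l)" and lam: "lam < l"
  shows "\<forall>\<^sub>F i in sequentially. (kappa n \<xi>)\<^sup>2 * err n \<xi> (q i) \<le> real (q (Suc i)) powr (- lam)"
proof -
  have "strict_mono (\<lambda>i. q (Suc i))" using q_mono by (simp add: strict_mono_Suc_iff)
  then have lim: "filterlim (\<lambda>i. real (q (Suc i))) at_top sequentially"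
    using filterlim_compose[OF filterlim_real_sequentially filterlim_subseq] by blast
  have "filterlim (\<lambda>B::real. B / 2) at_top at_top" by real_asymp
  with uniform have "\<forall>\<^sub>F B in at_top. \<exists>r\<ge>1. real r \<le> B / 2 \<and> err n \<xi> r \<le> (B / 2) powr (- l)"
    by (rule eventually_compose_filterlim)
  with eventually_powr_half_small[OF lam, of "(kappa n \<xi>)\<^sup>2"]
  have "\<forall>\<^sub>F B in at_top. 0 < B \<and> (kappa n \<xi>)\<^sup>2 * (B / 2) powr (- l) \<le> B powr (- lam) \<and>
      (\<exists>r\<ge>1. real r \<le> B / 2 \<and> err n \<xi> r \<le> (B / 2) powr (- l))"
    using eventually_gt_at_top by (intro eventually_conj)
  from eventually_compose_filterlim[OF this lim] show ?thesis
  proof eventually_elim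
    case (elim i)
    then obtain r where r_ge: "1 \<le> r" "real r \<le> real (q (Suc i)) / 2"
      "err n \<xi> r \<le> (real (q (Suc i)) / 2) powr (- l)" by blast
    have "real r < real (q (Suc i))" using r_ge(2) elim by linarith
    then have "err n \<xi> (q i) \<le> (real (q (Suc i)) / 2) powr (- l)" using best[OF r_ge(1)] r_ge(3) by fastforce
    then have "(kappa n \<xi>)\<^sup>2 * err n \<xi> (q i) \<le> (kappa n \<xi>)\<^sup>2 * (real (q (Suc i)) / 2) powr (- l)"
      by (intro mult_left_mono) auto
    then show ?case using elim by linarith
  qed
qed

lemma exists_err_less:
  assumes uniform: "\<forall>\<^sub>F B in at_top. \<exists>r\<ge>1. real r \<le> B \<and> err n \<xi> r \<le> B powr (- l)" and "0 < l"
  shows "\<forall>e>0. \<exists>r\<ge>1. err n \<xi> r < e"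
proof (intro allI impI)
  fix e :: real assume "0 < e"
  have "((\<lambda>B. B powr (- l)) \<longlongrightarrow> 0) at_top" using assms(2) by (intro tendsto_neg_powr filterlim_ident) auto
  then have "\<forall>\<^sub>F B in at_top. B powr (- l) < e" using \<open>0 < e\<close> by (rule order_tendstoD)
  from eventually_happens'[OF _ eventually_conj[OF uniform this]] show "\<exists>r\<ge>1. err n \<xi> r < e"
    by (auto intro: le_less_trans)
qed

theorem theorem1p2:
  fixes m n :: nat and \<xi> :: real
  assumes "n = 2 * m + 1" and "n \<ge> 5"
    and "rat_adjoin_degree \<xi> > enat n"
  shows "lambda_hat n \<xi> \<le> ereal (alpha m)"
proof (rule ccontr)
  assume "\<not> ?thesis"
  then obtain l where l_gt: "alpha m < l" "uniform_exponent_ok n \<xi> l"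
    unfolding lambda_hat_def not_le less_Sup_iff by auto
  have two_le_m: "2 \<le> m" and one_le_n: "1 \<le> n" using assms(1,2) by auto
  have no_root: "no_int_root n \<xi>" by (rule no_int_root_of_degree[OF assms(3)])
  obtain lam where lam: "alpha m < lam" "lam < l" "(real m + 1) * lam < 1"
    by (rule exists_exponent_between[OF _ l_gt(1)]) (use two_le_m in auto)
  obtain t \<mu> where numbers: "exponent_numbers (real m) t \<mu>" "lam * (real m + 1 + \<mu>) = 1"
    by (rule exponent_numbers_of_gt_alpha[OF two_le_m lam(1,3)])
  have "0 < l" using alpha_root(1)[of m] l_gt(1) by simp
  note uniform = uniform_exponent_err[OF this one_le_n l_gt(2)]
  obtain q where q: "q 0 = 1" "\<And>i. q i < q (Suc i)" "\<And>i. err n \<xi> (q (Suc i)) < err n \<xi> (q i)"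
    "\<And>i r. 1 \<le> r \<Longrightarrow> r < q (Suc i) \<Longrightarrow> err n \<xi> (q i) \<le> err n \<xi> r"
    by (rule exists_best_sequence[OF one_le_n no_root exists_err_less[OF uniform \<open>0 < l\<close>]]) blast
  have "strict_mono q" using q(2) by (simp add: strict_mono_Suc_iff)
  note small = eventually_best_small[OF this q(4) uniform lam(2)]
  have "best_points m t \<mu> n \<xi> lam q"
    using numbers assms(1) two_le_m no_root q small by (intro best_points.intro best_points_axioms.intro)
  then show False by (rule best_points.no_best_points)
qed

end
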